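(* Let $\iota: R\to A$ be a Frobenius extension and let $T$ be a Wakamatsu tilting left $R$-module. If $A\otimes_R T\in\operatorname{add}_R(T)$ as an $R$-module (by restriction along $\iota$), then $A\otimes_R T$ is a Wakamatsu tilting $A$-module.
   Context: All rings are associative with unit; modules are left modules unless otherwise specified. A ring extension $\iota:R\to A$ is a unital ring homomorphism, and $A$-modules are viewed as $R$-modules by restriction along $\iota$. It is a Frobenius extension if $A$ is finitely generated projective as a left $R$-module and $A\cong\operatorname{Hom}_R(A,R)$ as $A$-$R$-bimodules, where $(af)(x)=f(xa)$ and $(fr)(x)=f(x)r$. For an $R$-module $M$, $\operatorname{add}_R(M)$ is the class of direct summands of finite direct sums of copies of $M$. An $R$-module $T$ is Wakamatsu tilting if: (1) $T$ has a projective resolution by finitely generated projective $R$-modules; (2) $\operatorname{Ext}_R^i(T,T)=0$ for all $i>0$; (3) there is an exact sequence $0\to R\to T_0\to T_1\to T_2\to\cdots$ with each $T_j\in\operatorname{add}_R(T)$ which remains exact after applying $\operatorname{Hom}_R(-,T)$. *)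

theory Defs
  imports "HOL-Algebra.Free_Abelian_Groups" "HOL-Algebra.AbelCoset" "HOL-Algebra.Module"
begin

section \<open>Left modules over a not necessarily commutative ring\<close>

text \<open>
  The locale \<open>module\<close> of the library demands a commutative ring of scalars.  We reuse its record
  type (whose fields \<open>mult\<close> and \<open>one\<close> play no role for modules) and its notion of submodule, which
  does not mention commutativity.
\<close>

locale left_module = R?: ring R + M?: abelian_group M for R (structure) and M (structure) +
  assumes smult_closed [simp, intro]:
      "\<lbrakk>a \<in> carrier R; x \<in> carrier M\<rbrakk> \<Longrightarrow> a \<odot>\<^bsub>M\<^esub> x \<in> carrier M"
    and smult_l_distr:
      "\<lbrakk>a \<in> carrier R; b \<in> carrier R; x \<in> carrier M\<rbrakk> \<Longrightarrow>
        (a \<oplus> b) \<odot>\<^bsub>M\<^esub> x = a \<odot>\<^bsub>M\<^esub> x \<oplus>\<^bsub>M\<^esub> b \<odot>\<^bsub>M\<^esub> x"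
    and smult_r_distr:
      "\<lbrakk>a \<in> carrier R; x \<in> carrier M; y \<in> carrier M\<rbrakk> \<Longrightarrow>
        a \<odot>\<^bsub>M\<^esub> (x \<oplus>\<^bsub>M\<^esub> y) = a \<odot>\<^bsub>M\<^esub> x \<oplus>\<^bsub>M\<^esub> a \<odot>\<^bsub>M\<^esub> y"
    and smult_assoc1:
      "\<lbrakk>a \<in> carrier R; b \<in> carrier R; x \<in> carrier M\<rbrakk> \<Longrightarrow>
        (a \<otimes> b) \<odot>\<^bsub>M\<^esub> x = a \<odot>\<^bsub>M\<^esub> (b \<odot>\<^bsub>M\<^esub> x)"
    and smult_one [simp]: "x \<in> carrier M \<Longrightarrow> \<one> \<odot>\<^bsub>M\<^esub> x = x"

definition regular_module :: "'r ring \<Rightarrow> ('r, 'r) module" where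
  "regular_module R =
    \<lparr>carrier = carrier R, mult = mult R, one = one R, zero = zero R, add = add R, smult = mult R\<rparr>"

definition restrict_scalars :: "('r \<Rightarrow> 'a) \<Rightarrow> ('a, 'm) module \<Rightarrow> ('r, 'm) module" where
  "restrict_scalars \<iota> M =
    \<lparr>carrier = carrier M, mult = mult M, one = one M, zero = zero M, add = add M,
     smult = (\<lambda>r x. \<iota> r \<odot>\<^bsub>M\<^esub> x)\<rparr>"

definition module_hom :: "'r ring \<Rightarrow> ('r, 'm) module \<Rightarrow> ('r, 'n) module \<Rightarrow> ('m \<Rightarrow> 'n) set" where
  "module_hom R M N =
    {f \<in> carrier M \<rightarrow> carrier N.
      (\<forall>x \<in> carrier M. \<forall>y \<in> carrier M. f (x \<oplus>\<^bsub>M\<^esub> y) = f x \<oplus>\<^bsub>N\<^esub> f y) \<and>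
      (\<forall>r \<in> carrier R. \<forall>x \<in> carrier M. f (r \<odot>\<^bsub>M\<^esub> x) = r \<odot>\<^bsub>N\<^esub> f x)}"

definition module_iso :: "'r ring \<Rightarrow> ('r, 'm) module \<Rightarrow> ('r, 'n) module \<Rightarrow> ('m \<Rightarrow> 'n) set" where
  "module_iso R M N = {f \<in> module_hom R M N. bij_betw f (carrier M) (carrier N)}"

text \<open>
  The additive group of homomorphisms.  Its elements are extensional, so that equality of
  homomorphisms is equality on the carrier; the multiplicative fields are irrelevant.
\<close>

definition Hom :: "'r ring \<Rightarrow> ('r, 'm) module \<Rightarrow> ('r, 'n) module \<Rightarrow> ('m \<Rightarrow> 'n) ring" where
  "Hom R M N =
    \<lparr>carrier = module_hom R M N \<inter> extensional (carrier M), mult = undefined, one = undefined,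
     zero = (\<lambda>x \<in> carrier M. \<zero>\<^bsub>N\<^esub>), add = (\<lambda>f g. \<lambda>x \<in> carrier M. f x \<oplus>\<^bsub>N\<^esub> g x)\<rparr>"

text \<open>\<open>pullback M f\<close> is the map \<open>Hom(N, X) \<rightarrow> Hom(M, X)\<close> induced by \<open>f : M \<rightarrow> N\<close>.\<close>

definition pullback :: "('r, 'm) module \<Rightarrow> ('m \<Rightarrow> 'n) \<Rightarrow> ('n \<Rightarrow> 'x) \<Rightarrow> 'm \<Rightarrow> 'x" where
  "pullback M f g = compose (carrier M) g f"

text \<open>Exactness of \<open>L \<rightarrow> M \<rightarrow> N\<close> (with maps \<open>f\<close> and \<open>g\<close>) at \<open>M\<close>, for additive groups.\<close>

definition exact_at ::
  "('l, 'x) ring_scheme \<Rightarrow> ('l \<Rightarrow> 'm) \<Rightarrow> ('m, 'y) ring_scheme \<Rightarrow> ('m \<Rightarrow> 'n) \<Rightarrow> ('n, 'z) ring_scheme \<Rightarrow> bool"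
  where "exact_at L f M g N \<longleftrightarrow> f ` carrier L = a_kernel M N g"


section \<open>Direct summands, finitely generated and projective modules\<close>

definition direct_power :: "('r, 'm) module \<Rightarrow> nat \<Rightarrow> ('r, nat \<Rightarrow> 'm) module" where
  "direct_power M n =
    \<lparr>carrier = {..<n} \<rightarrow>\<^sub>E carrier M, mult = undefined, one = undefined,
     zero = (\<lambda>i \<in> {..<n}. \<zero>\<^bsub>M\<^esub>), add = (\<lambda>f g. \<lambda>i \<in> {..<n}. f i \<oplus>\<^bsub>M\<^esub> g i),
     smult = (\<lambda>r f. \<lambda>i \<in> {..<n}. r \<odot>\<^bsub>M\<^esub> f i)\<rparr>"

definition free_module :: "'r ring \<Rightarrow> 'b set \<Rightarrow> ('r, 'b \<Rightarrow> 'r) module" where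
  "free_module R B =
    \<lparr>carrier = {f \<in> B \<rightarrow>\<^sub>E carrier R. finite {b \<in> B. f b \<noteq> \<zero>\<^bsub>R\<^esub>}}, mult = undefined, one = undefined,
     zero = (\<lambda>b \<in> B. \<zero>\<^bsub>R\<^esub>), add = (\<lambda>f g. \<lambda>b \<in> B. f b \<oplus>\<^bsub>R\<^esub> g b),
     smult = (\<lambda>r f. \<lambda>b \<in> B. r \<otimes>\<^bsub>R\<^esub> f b)\<rparr>"

definition direct_summand :: "'r ring \<Rightarrow> 'm set \<Rightarrow> ('r, 'm) module \<Rightarrow> bool" where
  "direct_summand R K M \<longleftrightarrow> submodule K R M \<and>
    (\<exists>L. submodule L R M \<and> K \<inter> L = {\<zero>\<^bsub>M\<^esub>} \<and> K <+>\<^bsub>M\<^esub> L = carrier M)"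

definition iso_to_summand :: "'r ring \<Rightarrow> ('r, 'm) module \<Rightarrow> ('r, 'n) module \<Rightarrow> bool" where
  "iso_to_summand R M N \<longleftrightarrow> left_module R M \<and>
    (\<exists>K. direct_summand R K N \<and> module_iso R M (N\<lparr>carrier := K\<rparr>) \<noteq> {})"

text \<open>\<open>in_add R T M\<close> means that \<open>M\<close> belongs to \<open>add\<^sub>R(T)\<close>.\<close>

definition in_add :: "'r ring \<Rightarrow> ('r, 't) module \<Rightarrow> ('r, 'm) module \<Rightarrow> bool" where
  "in_add R T M \<longleftrightarrow> (\<exists>n. iso_to_summand R M (direct_power T n))"

definition fin_gen_module :: "'r ring \<Rightarrow> ('r, 'm) module \<Rightarrow> bool" where
  "fin_gen_module R M \<longleftrightarrow>
    (\<exists>S \<subseteq> carrier M. finite S \<and> (\<forall>K. submodule K R M \<and> S \<subseteq> K \<longrightarrow> K = carrier M))"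

text \<open>
  A module is projective if it is a direct summand of a free module.  Taking the basis inside the
  type of elements of the module is no restriction: a projective module is a summand of the free
  module on its own carrier.
\<close>

definition projective_module :: "'r ring \<Rightarrow> ('r, 'm) module \<Rightarrow> bool" where
  "projective_module R M \<longleftrightarrow> (\<exists>B :: 'm set. iso_to_summand R M (free_module R B))"


section \<open>Frobenius extensions\<close>

text \<open>
  \<open>Hom\<^sub>R(A, R)\<close> carries the \<open>A\<close>-\<open>R\<close>-bimodule structure \<open>(a f)(x) = f (x a)\<close> and
  \<open>(f r)(x) = f(x) r\<close>, and \<open>A\<close> is a right \<open>R\<close>-module through \<open>\<iota>\<close>.
\<close>

definition frobenius_extension :: "'r ring \<Rightarrow> 'a ring \<Rightarrow> ('r \<Rightarrow> 'a) \<Rightarrow> bool" where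
  "frobenius_extension R A \<iota> \<longleftrightarrow>
    ring R \<and> ring A \<and> \<iota> \<in> ring_hom R A \<and>
    (let A\<^sub>R = restrict_scalars \<iota> (regular_module A); D = Hom R A\<^sub>R (regular_module R) in
      fin_gen_module R A\<^sub>R \<and> projective_module R A\<^sub>R \<and>
      (\<exists>\<phi>. bij_betw \<phi> (carrier A) (carrier D) \<and>
        (\<forall>a \<in> carrier A. \<forall>b \<in> carrier A. \<phi> (a \<oplus>\<^bsub>A\<^esub> b) = \<phi> a \<oplus>\<^bsub>D\<^esub> \<phi> b) \<and>
        (\<forall>a \<in> carrier A. \<forall>b \<in> carrier A. \<phi> (a \<otimes>\<^bsub>A\<^esub> b) = (\<lambda>x \<in> carrier A. \<phi> b (x \<otimes>\<^bsub>A\<^esub> a))) \<and>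
        (\<forall>b \<in> carrier A. \<forall>r \<in> carrier R. \<phi> (b \<otimes>\<^bsub>A\<^esub> \<iota> r) = (\<lambda>x \<in> carrier A. \<phi> b x \<otimes>\<^bsub>R\<^esub> r))))"


section \<open>Extension of scalars\<close>

text \<open>
  \<open>A \<otimes>\<^sub>R T\<close> is the free abelian group on \<open>A \<times> T\<close> modulo the subgroup generated by the relations
  of biadditivity and \<open>R\<close>-balancedness; \<open>a \<in> A\<close> acts through \<open>(b, t) \<mapsto> (a b, t)\<close>.
\<close>

definition tensor_relations ::
  "'r ring \<Rightarrow> 'a ring \<Rightarrow> ('r \<Rightarrow> 'a) \<Rightarrow> ('r, 't) module \<Rightarrow> ('a \<times> 't \<Rightarrow>\<^sub>0 int) set" where
  "tensor_relations R A \<iota> T =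
    {frag_of (a \<oplus>\<^bsub>A\<^esub> b, t) - frag_of (a, t) - frag_of (b, t) | a b t.
        a \<in> carrier A \<and> b \<in> carrier A \<and> t \<in> carrier T} \<union>
    {frag_of (a, s \<oplus>\<^bsub>T\<^esub> t) - frag_of (a, s) - frag_of (a, t) | a s t.
        a \<in> carrier A \<and> s \<in> carrier T \<and> t \<in> carrier T} \<union>
    {frag_of (a \<otimes>\<^bsub>A\<^esub> \<iota> r, t) - frag_of (a, r \<odot>\<^bsub>T\<^esub> t) | a r t.
        a \<in> carrier A \<and> r \<in> carrier R \<and> t \<in> carrier T}"

definition extend_scalars ::
  "'r ring \<Rightarrow> 'a ring \<Rightarrow> ('r \<Rightarrow> 'a) \<Rightarrow> ('r, 't) module \<Rightarrow> ('a, ('a \<times> 't \<Rightarrow>\<^sub>0 int) set) module" where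
  "extend_scalars R A \<iota> T =
    (let F = free_Abelian_group (carrier A \<times> carrier T);
         K = generate F (tensor_relations R A \<iota> T);
         Q = F Mod K
     in \<lparr>carrier = carrier Q, mult = undefined, one = undefined, zero = one Q, add = mult Q,
         smult = (\<lambda>a X. \<Union>x \<in> X. K #>\<^bsub>F\<^esub> frag_extend (\<lambda>(b, t). frag_of (a \<otimes>\<^bsub>A\<^esub> b, t)) x)\<rparr>)"


section \<open>Projective resolutions and Ext\<close>

definition projective_resolution ::
  "'r ring \<Rightarrow> ('r, 'm) module \<Rightarrow> (nat \<Rightarrow> ('r, 'p) module) \<Rightarrow> (nat \<Rightarrow> 'p \<Rightarrow> 'p) \<Rightarrow> ('p \<Rightarrow> 'm) \<Rightarrow> bool" where
  "projective_resolution R M P d \<epsilon> \<longleftrightarrow>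
    (\<forall>n. projective_module R (P n)) \<and>
    (\<forall>n. d n \<in> module_hom R (P (Suc n)) (P n)) \<and>
    \<epsilon> \<in> module_hom R (P 0) M \<and>
    \<epsilon> ` carrier (P 0) = carrier M \<and>
    exact_at (P 1) (d 0) (P 0) \<epsilon> M \<and>
    (\<forall>n. exact_at (P (Suc (Suc n))) (d (Suc n)) (P (Suc n)) (d n) (P n))"

text \<open>The \<open>i\<close>-th cohomology group of the cochain complex \<open>Hom\<^sub>R(P\<^sub>0, N) \<rightarrow> Hom\<^sub>R(P\<^sub>1, N) \<rightarrow> \<dots>\<close>.\<close>

definition hom_cohomology ::
  "'r ring \<Rightarrow> (nat \<Rightarrow> ('r, 'p) module) \<Rightarrow> (nat \<Rightarrow> 'p \<Rightarrow> 'p) \<Rightarrow> ('r, 'n) module \<Rightarrow> nat \<Rightarrow> ('p \<Rightarrow> 'n) set monoid"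
  where
  "hom_cohomology R P d N i =
    (Hom R (P i) N)
      \<lparr>carrier := a_kernel (Hom R (P i) N) (Hom R (P (Suc i)) N) (pullback (P (Suc i)) (d i))\<rparr>
    A_Mod (case i of 0 \<Rightarrow> {\<zero>\<^bsub>Hom R (P 0) N\<^esub>}
                   | Suc k \<Rightarrow> pullback (P (Suc k)) (d k) ` carrier (Hom R (P k) N))"

text \<open>
  To speak of \<open>Ext\<close> for modules whose elements have an arbitrary type \<open>'m\<close>, we need one type in which
  every such module has a projective resolution.  The type \<open>('r, 'm) syz\<close> is large enough to
  index the generators of \<open>M\<close> as well as (through \<open>Comb\<close>) all finite \<open>'r\<close>-linear combinations of
  its own elements, hence all syzygies; see \<open>ex_projective_resolution\<close> below.
\<close>

datatype ('r, 'm) syz = Gen 'm | Comb "(('r, 'm) syz \<times> 'r) list"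

text \<open>As usual, \<open>Ext\<close> is computed from one chosen projective resolution of the first argument.\<close>

definition Ext ::
  "'r ring \<Rightarrow> ('r, 'm) module \<Rightarrow> ('r, 'n) module \<Rightarrow> nat \<Rightarrow> ((('r, 'm) syz \<Rightarrow> 'r) \<Rightarrow> 'n) set monoid" where
  "Ext R M N i =
    (let (P, d, \<epsilon>) = (SOME (P :: nat \<Rightarrow> ('r, ('r, 'm) syz \<Rightarrow> 'r) module, d, \<epsilon>).
                       projective_resolution R M P d \<epsilon>)
     in hom_cohomology R P d N i)"


section \<open>Wakamatsu tilting modules\<close>

text \<open>
  The existentially quantified modules live in types that are large enough up to isomorphism:
  finitely generated projective modules are direct summands of some \<open>R\<^sup>n\<close>, and modules in
  \<open>add\<^sub>R(T)\<close> are direct summands of some \<open>T\<^sup>n\<close>.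
\<close>

definition fp_infinity :: "'r ring \<Rightarrow> ('r, 'm) module \<Rightarrow> bool" where
  "fp_infinity R M \<longleftrightarrow>
    (\<exists>(P :: nat \<Rightarrow> ('r, nat \<Rightarrow> 'r) module) d \<epsilon>.
      projective_resolution R M P d \<epsilon> \<and> (\<forall>n. fin_gen_module R (P n)))"

definition exact_coresolution ::
  "'r ring \<Rightarrow> ('r, 'm) module \<Rightarrow> ('m \<Rightarrow> 'c) \<Rightarrow> (nat \<Rightarrow> ('r, 'c) module) \<Rightarrow> (nat \<Rightarrow> 'c \<Rightarrow> 'c) \<Rightarrow> bool" where
  "exact_coresolution R M \<eta> C \<delta> \<longleftrightarrow>
    \<eta> \<in> module_hom R M (C 0) \<and>
    (\<forall>n. \<delta> n \<in> module_hom R (C n) (C (Suc n))) \<and>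
    inj_on \<eta> (carrier M) \<and>
    exact_at M \<eta> (C 0) (\<delta> 0) (C 1) \<and>
    (\<forall>n. exact_at (C n) (\<delta> n) (C (Suc n)) (\<delta> (Suc n)) (C (Suc (Suc n))))"

text \<open>Exactness of \<open>\<dots> \<rightarrow> Hom(C\<^sub>1, T) \<rightarrow> Hom(C\<^sub>0, T) \<rightarrow> Hom(M, T) \<rightarrow> 0\<close>.\<close>

definition hom_exact ::
  "'r ring \<Rightarrow> ('r, 't) module \<Rightarrow> ('r, 'm) module \<Rightarrow> ('m \<Rightarrow> 'c) \<Rightarrow> (nat \<Rightarrow> ('r, 'c) module) \<Rightarrow>
    (nat \<Rightarrow> 'c \<Rightarrow> 'c) \<Rightarrow> bool" where
  "hom_exact R T M \<eta> C \<delta> \<longleftrightarrow>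
    pullback M \<eta> ` carrier (Hom R (C 0) T) = carrier (Hom R M T) \<and>
    exact_at (Hom R (C 1) T) (pullback (C 0) (\<delta> 0)) (Hom R (C 0) T) (pullback M \<eta>) (Hom R M T) \<and>
    (\<forall>n. exact_at (Hom R (C (Suc (Suc n))) T) (pullback (C (Suc n)) (\<delta> (Suc n)))
                  (Hom R (C (Suc n)) T) (pullback (C n) (\<delta> n)) (Hom R (C n) T))"

definition wakamatsu_tilting :: "'r ring \<Rightarrow> ('r, 't) module \<Rightarrow> bool" where
  "wakamatsu_tilting R T \<longleftrightarrow>
    left_module R T \<and>
    fp_infinity R T \<and>
    (\<forall>i>0. trivial_group (Ext R T T i)) \<and>
    (\<exists>(C :: nat \<Rightarrow> ('r, nat \<Rightarrow> 't) module) \<eta> \<delta>.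
      (\<forall>j. in_add R T (C j)) \<and>
      exact_coresolution R (regular_module R) \<eta> C \<delta> \<and>
      hom_exact R T (regular_module R) \<eta> C \<delta>)"


section \<open>Existence of projective resolutions\<close>

lemma (in left_module) smult_l_null: "x \<in> carrier M \<Longrightarrow> \<zero> \<odot>\<^bsub>M\<^esub> x = \<zero>\<^bsub>M\<^esub>"
  using smult_l_distr[of \<zero> \<zero> x] by (metis M.add.r_cancel_one' R.l_zero R.zero_closed smult_closed)

lemma (in left_module) smult_r_null: "a \<in> carrier R \<Longrightarrow> a \<odot>\<^bsub>M\<^esub> \<zero>\<^bsub>M\<^esub> = \<zero>\<^bsub>M\<^esub>"
  using smult_r_distr[of a "\<zero>\<^bsub>M\<^esub>" "\<zero>\<^bsub>M\<^esub>"]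
  by (metis M.add.r_cancel_one' M.l_zero M.zero_closed smult_closed)

lemma (in left_module) finsum_smult:
  "finite S \<Longrightarrow> a \<in> carrier R \<Longrightarrow> f \<in> S \<rightarrow> carrier M \<Longrightarrow>
    a \<odot>\<^bsub>M\<^esub> finsum M f S = finsum M (\<lambda>i. a \<odot>\<^bsub>M\<^esub> f i) S"
  by (induction S rule: finite_induct) (auto simp: smult_r_null smult_r_distr Pi_def)

lemma free_module_simps [simp]:
  "carrier (free_module R B) = {f \<in> B \<rightarrow>\<^sub>E carrier R. finite {b \<in> B. f b \<noteq> \<zero>\<^bsub>R\<^esub>}}"
  "zero (free_module R B) = (\<lambda>b \<in> B. \<zero>\<^bsub>R\<^esub>)"
  "add (free_module R B) f g = (\<lambda>b \<in> B. f b \<oplus>\<^bsub>R\<^esub> g b)"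
  "smult (free_module R B) r f = (\<lambda>b \<in> B. r \<otimes>\<^bsub>R\<^esub> f b)"
  by (simp_all add: free_module_def)

lemma left_module_free:
  assumes "ring R" shows "left_module R (free_module R B)"
proof -
  interpret R: ring R by fact
  let ?F = "free_module R B"
  have add: "finite {b \<in> B. f b \<oplus>\<^bsub>R\<^esub> g b \<noteq> \<zero>\<^bsub>R\<^esub>}"
    if "finite {b \<in> B. f b \<noteq> \<zero>\<^bsub>R\<^esub>}" "finite {b \<in> B. g b \<noteq> \<zero>\<^bsub>R\<^esub>}" for f g
    by (rule finite_subset[OF _ finite_UnI[OF that]]) auto
  have smul: "finite {b \<in> B. r \<otimes>\<^bsub>R\<^esub> f b \<noteq> \<zero>\<^bsub>R\<^esub>}"
    if "finite {b \<in> B. f b \<noteq> \<zero>\<^bsub>R\<^esub>}" "r \<in> carrier R" for f r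
    by (rule finite_subset[OF _ that(1)]) (use that in auto)
  have "abelian_group ?F"
  proof (rule abelian_groupI)
    fix f assume f: "f \<in> carrier ?F"
    have "finite {b \<in> B. \<ominus>\<^bsub>R\<^esub> f b \<noteq> \<zero>\<^bsub>R\<^esub>}"
      by (rule finite_subset[of _ "{b \<in> B. f b \<noteq> \<zero>\<^bsub>R\<^esub>}"]) (use f in auto)
    then show "\<exists>g \<in> carrier ?F. g \<oplus>\<^bsub>?F\<^esub> f = \<zero>\<^bsub>?F\<^esub>"
      using f by (intro bexI[of _ "\<lambda>b \<in> B. \<ominus>\<^bsub>R\<^esub> f b"])
        (auto simp: PiE_iff R.l_neg cong: conj_cong intro!: restrict_ext)
  qed (auto simp: PiE_iff add R.a_ac extensional_def fun_eq_iff restrict_def cong: conj_cong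
      intro!: add)
  then show ?thesis
    by (intro left_module.intro left_module_axioms.intro assms)
      (auto simp: PiE_iff R.l_distr R.r_distr R.m_assoc extensional_def fun_eq_iff restrict_def smul
        cong: conj_cong)
qed

definition lin_comb :: "('r, 'm) module \<Rightarrow> 'r ring \<Rightarrow> 'b set \<Rightarrow> ('b \<Rightarrow> 'm) \<Rightarrow> ('b \<Rightarrow> 'r) \<Rightarrow> 'm" where
  "lin_comb M R B e f = finsum M (\<lambda>b. f b \<odot>\<^bsub>M\<^esub> e b) {b \<in> B. f b \<noteq> \<zero>\<^bsub>R\<^esub>}"

lemma lin_comb_superset:
  assumes "left_module R M" and "e \<in> B \<rightarrow> carrier M" and "f \<in> carrier (free_module R B)"
    and "finite S" and "S \<subseteq> B" and "{b \<in> B. f b \<noteq> \<zero>\<^bsub>R\<^esub>} \<subseteq> S"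
  shows "lin_comb M R B e f = finsum M (\<lambda>b. f b \<odot>\<^bsub>M\<^esub> e b) S"
proof -
  interpret left_module R M by fact
  show ?thesis unfolding lin_comb_def
    using assms by (intro M.add.finprod_mono_neutral_cong_left) (auto simp: PiE_iff Pi_iff smult_l_null)
qed

lemma lin_comb_hom:
  assumes M: "left_module R M" and e: "e \<in> B \<rightarrow> carrier M"
  shows "lin_comb M R B e \<in> module_hom R (free_module R B) M"
proof -
  interpret left_module R M by fact
  interpret F: left_module R "free_module R B" by (rule left_module_free) (rule R.ring_axioms)
  let ?F = "free_module R B" and ?h = "lin_comb M R B e" and ?s = "\<lambda>f. {b \<in> B. f b \<noteq> \<zero>\<^bsub>R\<^esub>}"
  have 1: "?h \<in> carrier ?F \<rightarrow> carrier M"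
    using e by (auto simp: lin_comb_def PiE_iff Pi_iff intro!: M.finsum_closed)
  have 2: "?h (f \<oplus>\<^bsub>?F\<^esub> g) = ?h f \<oplus>\<^bsub>M\<^esub> ?h g" if fg: "f \<in> carrier ?F" "g \<in> carrier ?F" for f g
  proof -
    let ?S = "?s f \<union> ?s g"
    have S: "finite ?S" "?S \<subseteq> B" using fg by auto
    have c: "f \<oplus>\<^bsub>?F\<^esub> g \<in> carrier ?F" using fg by (rule F.a_closed)
    have "?h (f \<oplus>\<^bsub>?F\<^esub> g) = finsum M (\<lambda>b. (f \<oplus>\<^bsub>?F\<^esub> g) b \<odot>\<^bsub>M\<^esub> e b) ?S"
      by (rule lin_comb_superset[OF M e c S]) auto
    also have "\<dots> = finsum M (\<lambda>b. f b \<odot>\<^bsub>M\<^esub> e b \<oplus>\<^bsub>M\<^esub> g b \<odot>\<^bsub>M\<^esub> e b) ?S"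
      using fg e by (intro M.finsum_cong') (auto simp: PiE_iff Pi_iff smult_l_distr)
    also have "\<dots> = finsum M (\<lambda>b. f b \<odot>\<^bsub>M\<^esub> e b) ?S \<oplus>\<^bsub>M\<^esub> finsum M (\<lambda>b. g b \<odot>\<^bsub>M\<^esub> e b) ?S"
      using fg e by (intro M.finsum_addf) (auto simp: PiE_iff Pi_iff)
    also have "\<dots> = ?h f \<oplus>\<^bsub>M\<^esub> ?h g"
      using lin_comb_superset[OF M e fg(1) S] lin_comb_superset[OF M e fg(2) S] by auto
    finally show ?thesis .
  qed
  have 3: "?h (r \<odot>\<^bsub>?F\<^esub> f) = r \<odot>\<^bsub>M\<^esub> ?h f" if r: "r \<in> carrier R" and f: "f \<in> carrier ?F" for r f
  proof -
    have c: "r \<odot>\<^bsub>?F\<^esub> f \<in> carrier ?F" using r f by (rule F.smult_closed)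
    have S: "finite (?s f)" "?s f \<subseteq> B" using f by auto
    have "?h (r \<odot>\<^bsub>?F\<^esub> f) = finsum M (\<lambda>b. (r \<odot>\<^bsub>?F\<^esub> f) b \<odot>\<^bsub>M\<^esub> e b) (?s f)"
      by (rule lin_comb_superset[OF M e c S]) (use r in auto)
    also have "\<dots> = finsum M (\<lambda>b. r \<odot>\<^bsub>M\<^esub> (f b \<odot>\<^bsub>M\<^esub> e b)) (?s f)"
      using r f e by (intro M.finsum_cong') (auto simp: PiE_iff Pi_iff smult_assoc1)
    also have "\<dots> = r \<odot>\<^bsub>M\<^esub> ?h f"
      unfolding lin_comb_def using r f e
      by (intro finsum_smult[symmetric]) (auto simp: PiE_iff Pi_iff)
    finally show ?thesis .
  qed
  show ?thesis unfolding module_hom_def using 1 2 3 by blast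
qed

lemma lin_comb_image:
  assumes M: "left_module R M" and e: "e ` B = carrier M"
  shows "lin_comb M R B e ` carrier (free_module R B) = carrier M"
proof
  interpret left_module R M by fact
  have e': "e \<in> B \<rightarrow> carrier M" using e by auto
  show "lin_comb M R B e ` carrier (free_module R B) \<subseteq> carrier M"
    using lin_comb_hom[OF M e'] by (auto simp: module_hom_def)
  show "carrier M \<subseteq> lin_comb M R B e ` carrier (free_module R B)"
  proof
    fix x assume x: "x \<in> carrier M"
    then have "x \<in> e ` B" by (simp add: e)
    then obtain b where b: "b \<in> B" "e b = x" by blast
    let ?f = "\<lambda>c \<in> B. if c = b then \<one>\<^bsub>R\<^esub> else \<zero>\<^bsub>R\<^esub>"
    have "finite {c \<in> B. ?f c \<noteq> \<zero>\<^bsub>R\<^esub>}" by (rule finite_subset[of _ "{b}"]) auto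
    then have f: "?f \<in> carrier (free_module R B)" by simp
    have "lin_comb M R B e ?f = finsum M (\<lambda>c. ?f c \<odot>\<^bsub>M\<^esub> e c) {b}"
      by (rule lin_comb_superset[OF M e' f]) (use b in auto)
    also have "\<dots> = x" using b x by simp
    finally show "x \<in> lin_comb M R B e ` carrier (free_module R B)" using f by force
  qed
qed

lemma projective_free:
  fixes R :: "'a ring"
  assumes "ring R"
  shows "projective_module R (free_module R (UNIV :: 'b set))"
proof -
  interpret R: ring R by fact
  let ?F = "free_module R (UNIV :: 'b set)"
  have summand: "direct_summand R (carrier M) M" if "left_module R M" for M :: "('a, 'c) module"
  proof -
    interpret left_module R M by fact
    have "submodule (carrier M) R M" "submodule {\<zero>\<^bsub>M\<^esub>} R M"
      using M.add.subgroup_self M.add.triv_subgroup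
      by (auto intro!: submodule.intro submodule_axioms.intro simp: smult_r_null)
    moreover have "carrier M <+>\<^bsub>M\<^esub> {\<zero>\<^bsub>M\<^esub>} = carrier M"
      by (force simp: set_add_def')
    ultimately show ?thesis unfolding direct_summand_def by blast
  qed
  obtain B :: "('b \<Rightarrow> 'a) set" and \<phi> where
    \<phi>: "\<phi> \<in> module_iso R ?F (free_module R B)"
  proof (cases "\<one>\<^bsub>R\<^esub> = \<zero>\<^bsub>R\<^esub>")
    case True
    then have c: "carrier R = {\<zero>\<^bsub>R\<^esub>}" using R.one_zeroD by simp
    have "(\<lambda>f. \<lambda>p \<in> {}. undefined) \<in> module_iso R ?F (free_module R {})"
      unfolding module_iso_def module_hom_def bij_betw_def inj_on_def
      by (auto simp: c PiE_iff fun_eq_iff image_iff intro!: exI[where x = "\<lambda>_. \<zero>\<^bsub>R\<^esub>"])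
    then show ?thesis using that by blast
  next
    case False
    define \<delta> where "\<delta> = (\<lambda>b c :: 'b. if c = b then \<one>\<^bsub>R\<^esub> else \<zero>\<^bsub>R\<^esub>)"
    have inj: "inj \<delta>" using False by (auto simp: inj_def \<delta>_def fun_eq_iff split: if_splits)
    define g where "g = inv_into UNIV \<delta>"
    have g [simp]: "g (\<delta> b) = b" for b using inj by (simp add: g_def)
    have fin: "finite {p \<in> range \<delta>. Q (g p)} \<longleftrightarrow> finite {b. Q b}" for Q
    proof -
      have "{p \<in> range \<delta>. Q (g p)} = \<delta> ` {b. Q b}" by auto
      then show ?thesis using finite_image_iff[OF inj_on_subset[OF inj subset_UNIV], of "{b. Q b}"] by simp
    qed
    define \<phi> :: "('b \<Rightarrow> 'a) \<Rightarrow> ('b \<Rightarrow> 'a) \<Rightarrow> 'a" where "\<phi> f = (\<lambda>p \<in> range \<delta>. f (g p))" for f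
    have hom: "\<phi> \<in> module_hom R ?F (free_module R (range \<delta>))"
    proof -
      have "finite {p \<in> range \<delta>. \<phi> f p \<noteq> \<zero>\<^bsub>R\<^esub>}" if "finite {b. f b \<noteq> \<zero>\<^bsub>R\<^esub>}" for f
        using that fin[of "\<lambda>b. f b \<noteq> \<zero>\<^bsub>R\<^esub>"] by (simp add: \<phi>_def cong: conj_cong)
      then have "\<phi> \<in> carrier ?F \<rightarrow> carrier (free_module R (range \<delta>))"
        by (auto simp: PiE_iff) (auto simp: \<phi>_def)
      then show ?thesis
        unfolding module_hom_def by (simp add: \<phi>_def fun_eq_iff restrict_def)
    qed
    have "inj_on \<phi> (carrier ?F)"
    proof (rule inj_onI)
      fix f f' assume eq: "\<phi> f = \<phi> f'"
      have "f b = f' b" for b using fun_cong[OF eq, of "\<delta> b"] by (simp add: \<phi>_def)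
      then show "f = f'" by (rule ext)
    qed
    moreover have "carrier (free_module R (range \<delta>)) \<subseteq> \<phi> ` carrier ?F"
    proof
      fix h assume h: "h \<in> carrier (free_module R (range \<delta>))"
      have eq: "\<phi> (h \<circ> \<delta>) = h"
      proof
        fix p show "\<phi> (h \<circ> \<delta>) p = h p"
          using h by (cases "p \<in> range \<delta>") (auto simp: \<phi>_def PiE_iff extensional_def)
      qed
      have "{p \<in> range \<delta>. (h \<circ> \<delta>) (g p) \<noteq> \<zero>\<^bsub>R\<^esub>} = {p \<in> range \<delta>. h p \<noteq> \<zero>\<^bsub>R\<^esub>}"
        by auto
      then have "finite {b. (h \<circ> \<delta>) b \<noteq> \<zero>\<^bsub>R\<^esub>}"
        using h fin[of "\<lambda>b. (h \<circ> \<delta>) b \<noteq> \<zero>\<^bsub>R\<^esub>"] by simp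
      moreover have "(h \<circ> \<delta>) b \<in> carrier R" for b using h by (simp add: PiE_iff)
      ultimately have "h \<circ> \<delta> \<in> carrier ?F" by (simp add: PiE_iff)
      with eq show "h \<in> \<phi> ` carrier ?F" by (metis imageI)
    qed
    moreover have "\<phi> ` carrier ?F \<subseteq> carrier (free_module R (range \<delta>))"
      using hom by (auto simp: module_hom_def)
    ultimately have "\<phi> \<in> module_iso R ?F (free_module R (range \<delta>))"
      using hom unfolding module_iso_def bij_betw_def by blast
    then show ?thesis by (rule that)
  qed
  have "free_module R B\<lparr>carrier := carrier (free_module R B)\<rparr> = free_module R B" by simp
  then have "iso_to_summand R ?F (free_module R B)"
    unfolding iso_to_summand_def
    using summand[OF left_module_free[OF assms]] \<phi> left_module_free[OF assms] by (metis empty_iff)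
  then show ?thesis unfolding projective_module_def by blast
qed

lemma submodule_kernel:
  assumes "left_module R M" and "left_module R N" and "f \<in> module_hom R M N"
  shows "submodule (a_kernel M N f) R M"
proof -
  interpret M: left_module R M by fact
  interpret N: left_module R N by fact
  have "group_hom (add_monoid M) (add_monoid N) f"
    using assms(3) by (intro group_hom.intro group_hom_axioms.intro M.add.is_group N.add.is_group)
      (auto simp: module_hom_def hom_def)
  then have "subgroup (a_kernel M N f) (add_monoid M)"
    unfolding a_kernel_def by (rule group_hom.subgroup_kernel)
  then show ?thesis using assms(3)
    by (auto intro!: submodule.intro submodule_axioms.intro
        simp: a_kernel_def kernel_def module_hom_def N.smult_r_null)
qed

lemma left_module_submodule:
  fixes R :: "'r ring" and M :: "('r, 'm) module"
  assumes "left_module R M" and "submodule K R M"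
  shows "left_module R (M\<lparr>carrier := K\<rparr>)"
proof -
  interpret M: left_module R M by fact
  interpret K: submodule K R M by fact
  have "abelian_monoid (M\<lparr>carrier := K\<rparr>)"
    using comm_monoid.submonoid_is_comm_monoid[OF _ K.subgroup_is_submonoid]
      M.abelian_monoid_axioms M.a_comm_monoid by (auto simp: abelian_monoid_def)
  moreover have "group (add_monoid (M\<lparr>carrier := K\<rparr>))"
    using K.subgroup_is_group M.add.is_group by simp
  ultimately have "abelian_group (M\<lparr>carrier := K\<rparr>)"
    by (auto intro!: abelian_group.intro abelian_group_axioms.intro comm_group.intro
        simp: abelian_monoid_def)
  moreover have "K \<subseteq> carrier M" using K.subset by simp
  ultimately show ?thesis
    by (intro left_module.intro left_module_axioms.intro M.R.ring_axioms)
      (auto simp: M.smult_l_distr M.smult_r_distr M.smult_assoc1 subset_iff)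
qed

lemma ex_surj_from_free:
  fixes R :: "'r ring" and M :: "('r, 'c) module" and e :: "'b \<Rightarrow> 'c"
  assumes "left_module R M" and "submodule K R M" and "K \<subseteq> range e"
  shows "\<exists>q \<in> module_hom R (free_module R (UNIV :: 'b set)) M.
    q ` carrier (free_module R (UNIV :: 'b set)) = K"
proof -
  interpret M: left_module R M by fact
  interpret K: submodule K R M by fact
  let ?F = "free_module R (UNIV :: 'b set)" and ?K = "M\<lparr>carrier := K\<rparr>"
  let ?e = "\<lambda>b. if e b \<in> K then e b else \<zero>\<^bsub>M\<^esub>"
  have zero: "\<zero>\<^bsub>M\<^esub> \<in> K" using K.one_closed by simp
  moreover have "k \<in> range ?e" if k: "k \<in> K" for k
  proof -
    obtain b where "k = e b" using assms(3) k by blast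
    then show ?thesis using k by (intro range_eqI[of _ _ b]) simp
  qed
  ultimately have e: "range ?e = carrier ?K" by auto
  note K = left_module_submodule[OF assms(1,2)]
  have "lin_comb ?K R UNIV ?e \<in> module_hom R ?F ?K"
    by (rule lin_comb_hom[OF K]) (use zero in simp)
  moreover have "K \<subseteq> carrier M" using K.subset by simp
  ultimately have "lin_comb ?K R UNIV ?e \<in> module_hom R ?F M"
    by (auto simp: module_hom_def Pi_iff)
  with lin_comb_image[OF K e] show ?thesis by auto
qed

theorem ex_projective_resolution:
  fixes R :: "'r ring" and M :: "('r, 'm) module"
  assumes M: "left_module R M"
  shows "\<exists>(P :: nat \<Rightarrow> ('r, ('r, 'm) syz \<Rightarrow> 'r) module) d \<epsilon>. projective_resolution R M P d \<epsilon>"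
proof -
  interpret left_module R M by fact
  define F where "F = free_module R (UNIV :: ('r, 'm) syz set)"
  have F: "left_module R F" unfolding F_def by (rule left_module_free) (rule R.ring_axioms)
  have "carrier M \<subseteq> range (\<lambda>s. case s of Gen x \<Rightarrow> x)"
    by (auto intro: range_eqI[of _ _ "Gen _"])
  moreover have "submodule (carrier M) R M"
    using M.add.subgroup_self by (auto intro!: submodule.intro submodule_axioms.intro)
  ultimately obtain \<epsilon> where \<epsilon>: "\<epsilon> \<in> module_hom R F M" "\<epsilon> ` carrier F = carrier M"
    using ex_surj_from_free[OF M] unfolding F_def by metis
  define dec :: "('r, 'm) syz \<Rightarrow> ('r, 'm) syz \<Rightarrow> 'r" where
    "dec s = (\<lambda>b. case s of Comb l \<Rightarrow> (case map_of l b of None \<Rightarrow> \<zero>\<^bsub>R\<^esub> | Some r \<Rightarrow> r))" for s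
  have dec: "carrier F \<subseteq> range dec"
  proof
    fix f assume "f \<in> carrier F"
    then have "finite {b. f b \<noteq> \<zero>\<^bsub>R\<^esub>}" by (simp add: F_def)
    then obtain bs where bs: "set bs = {b. f b \<noteq> \<zero>\<^bsub>R\<^esub>}" using finite_list by blast
    have "dec (Comb (map (\<lambda>b. (b, f b)) bs)) = f"
      using bs by (auto simp: dec_def map_of_map_restrict restrict_map_def fun_eq_iff)
    then show "f \<in> range dec" by (metis rangeI)
  qed
  have "\<exists>q \<in> module_hom R F F. q ` carrier F = K" if K: "submodule K R F" for K
  proof -
    have "K \<subseteq> carrier F" using subgroup.subset[OF submodule.axioms(1)[OF K]] by simp
    then show ?thesis using ex_surj_from_free[OF F K, of dec] dec unfolding F_def by blast
  qed
  then obtain q where q: "\<And>K. submodule K R F \<Longrightarrow> q K \<in> module_hom R F F \<and> q K ` carrier F = K"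
    by metis
  define d where "d = rec_nat (q (a_kernel F M \<epsilon>)) (\<lambda>_ f. q (a_kernel F F f))"
  have d0: "d 0 = q (a_kernel F M \<epsilon>)" and dS: "d (Suc n) = q (a_kernel F F (d n))" for n
    by (simp_all add: d_def)
  have hom: "d n \<in> module_hom R F F" for n
    by (induction n) (auto simp: d0 dS q submodule_kernel F M \<epsilon>)
  have "projective_module R F" unfolding F_def by (rule projective_free) (rule R.ring_axioms)
  then have "projective_resolution R M (\<lambda>_. F) d \<epsilon>"
    unfolding projective_resolution_def exact_at_def
    using hom \<epsilon>
    by (auto simp: d0 dS q submodule_kernel F M)
  then show ?thesis by blast
qed

end

theory Submission
  imports Defs
begin

text \<open>
  A Frobenius extension has a Frobenius system: an \<open>R\<close>-bimodule map \<open>E : A \<rightarrow> R\<close> and elements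
  \<open>x\<^sub>i, y\<^sub>i\<close> of \<open>A\<close> with \<open>a = \<Sum> E(a y\<^sub>i) x\<^sub>i = \<Sum> y\<^sub>i E(x\<^sub>i a)\<close>.  Hence \<open>A \<otimes>\<^sub>R M\<close> is isomorphic to
  \<open>F M = Hom\<^sub>R(A, M)\<close>; the functor \<open>F\<close> is exact, is left adjoint to restriction, preserves projectivity
  and sends \<open>R\<close> to \<open>A\<close> and \<open>add\<^sub>R(T)\<close> into \<open>add\<^sub>A(A \<otimes>\<^sub>R T)\<close>.  So \<open>F\<close> carries resolutions and coresolutions
  over \<open>R\<close> to such over \<open>A\<close>.  By the adjunction, \<open>Hom\<^sub>A(F X, A \<otimes>\<^sub>R T) = Hom\<^sub>R(X, A \<otimes>\<^sub>R T)\<close>, and because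
  \<open>A \<otimes>\<^sub>R T\<close> lies in \<open>add\<^sub>R(T)\<close>, this complex is exact wherever \<open>Hom\<^sub>R(X, T)\<close> is.  This gives
  the vanishing of \<open>Ext\<close> (for \<open>X\<close> a projective resolution of \<open>T\<close>) and the exactness of the
  \<open>Hom\<close>-complex of the coresolution.
\<close>

section \<open>Module homomorphisms\<close>

text \<open>Coinduction replaces the tensor product because its elements are functions: kernels,
  sums and equalities can be checked at each point of A, whereas the tensor product is a quotient of
  a free abelian group. The latter is met only for \<open>T\<close> itself and compared with the
  coinduced module through its universal property. Over a general extension coinduction is right
  adjoint to restriction; that it is also left adjoint is due to the Frobenius system.

  Two obstacles of form shape the rest. \<open>Ext\<close> uses a resolution picked by choice, with
  a fixed type of elements, so its vanishing has to be related to coinduced resolutions, whose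
  elements have other types. Likewise the definitions quantify over modules of sequences, so
  coinduced modules must be exchanged for isomorphic summands of finite powers.

  Membership in add is rephrased as an equation: the identity is a finite sum of maps factoring
  through the given module. Coinduction preserves this equation, and Hom problems can be solved one
  component at a time.\<close>

lemma module_homI:
  assumes "\<And>x. x \<in> carrier M \<Longrightarrow> f x \<in> carrier N"
    and "\<And>x y. x \<in> carrier M \<Longrightarrow> y \<in> carrier M \<Longrightarrow> f (x \<oplus>\<^bsub>M\<^esub> y) = f x \<oplus>\<^bsub>N\<^esub> f y"
    and "\<And>r x. r \<in> carrier R \<Longrightarrow> x \<in> carrier M \<Longrightarrow> f (r \<odot>\<^bsub>M\<^esub> x) = r \<odot>\<^bsub>N\<^esub> f x"
  shows "f \<in> module_hom R M N"
  using assms by (simp add: module_hom_def)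

lemma module_homD:
  assumes "f \<in> module_hom R M N"
  shows "x \<in> carrier M \<Longrightarrow> f x \<in> carrier N"
    and "x \<in> carrier M \<Longrightarrow> y \<in> carrier M \<Longrightarrow> f (x \<oplus>\<^bsub>M\<^esub> y) = f x \<oplus>\<^bsub>N\<^esub> f y"
    and "r \<in> carrier R \<Longrightarrow> x \<in> carrier M \<Longrightarrow> f (r \<odot>\<^bsub>M\<^esub> x) = r \<odot>\<^bsub>N\<^esub> f x"
  using assms by (auto simp: module_hom_def)

lemma module_hom_cong:
  assumes "left_module R M" and "f \<in> module_hom R M N" and "\<And>x. x \<in> carrier M \<Longrightarrow> g x = f x"
  shows "g \<in> module_hom R M N"
proof -
  interpret M: left_module R M by fact
  show ?thesis using assms(2,3) by (auto simp: module_hom_def Pi_iff)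
qed

lemma module_hom_id: "(\<lambda>x. x) \<in> module_hom R M M"
  by (simp add: module_hom_def)

lemma module_hom_comp:
  "f \<in> module_hom R L M \<Longrightarrow> g \<in> module_hom R M N \<Longrightarrow> (\<lambda>x. g (f x)) \<in> module_hom R L N"
  by (auto simp: module_hom_def Pi_iff)

section \<open>Additive maps, and sums and differences of homomorphisms\<close>

lemma (in abelian_group) eq_if_minus_zero:
  assumes "x \<in> carrier G" and "y \<in> carrier G" and "x \<ominus> y = \<zero>"
  shows "x = y"
proof -
  have "x = (x \<ominus> y) \<oplus> y" using assms(1,2) by (simp add: minus_eq a_assoc l_neg)
  also have "\<dots> = y" using assms(2) unfolding assms(3) by simp
  finally show ?thesis .
qed

text \<open>This and the next two lemmas speak of additive maps because several maps to which they
  apply are not linear over one common ring: evaluation of a coinduced element at a point,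
  \<open>\<lambda>c. c \<odot> u m\<close> for fixed \<open>m\<close>, or \<open>E\<close> after a
  multiplication.\<close>

lemma additive_zero:
  assumes "abelian_group M" and "abelian_group N" and "f \<in> carrier M \<rightarrow> carrier N"
    and "\<And>x y. x \<in> carrier M \<Longrightarrow> y \<in> carrier M \<Longrightarrow> f (x \<oplus>\<^bsub>M\<^esub> y) = f x \<oplus>\<^bsub>N\<^esub> f y"
  shows "f \<zero>\<^bsub>M\<^esub> = \<zero>\<^bsub>N\<^esub>"
proof -
  interpret M: abelian_group M by fact
  interpret N: abelian_group N by fact
  have c: "f \<zero>\<^bsub>M\<^esub> \<in> carrier N" using assms(3) by auto
  have "f \<zero>\<^bsub>M\<^esub> \<oplus>\<^bsub>N\<^esub> f \<zero>\<^bsub>M\<^esub> = f \<zero>\<^bsub>M\<^esub>" using assms(4)[of "\<zero>\<^bsub>M\<^esub>" "\<zero>\<^bsub>M\<^esub>"] by simp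
  then show ?thesis using c by (metis N.add.r_cancel_one')
qed

lemma additive_finsum:
  assumes "abelian_group M" and "abelian_group N" and "f \<in> carrier M \<rightarrow> carrier N"
    and "\<And>x y. x \<in> carrier M \<Longrightarrow> y \<in> carrier M \<Longrightarrow> f (x \<oplus>\<^bsub>M\<^esub> y) = f x \<oplus>\<^bsub>N\<^esub> f y"
    and "finite I" and "g \<in> I \<rightarrow> carrier M"
  shows "f (finsum M g I) = finsum N (\<lambda>i. f (g i)) I"
proof -
  interpret M: abelian_group M by fact
  interpret N: abelian_group N by fact
  show ?thesis using assms(5,6)
  proof (induction I rule: finite_induct)
    case empty
    then show ?case using additive_zero[OF assms(1-4)] by simp
  next
    case (insert i I)
    have g: "g \<in> I \<rightarrow> carrier M" "g i \<in> carrier M" using insert.prems by auto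
    then have fg: "(\<lambda>i. f (g i)) \<in> I \<rightarrow> carrier N" "f (g i) \<in> carrier N" using assms(3) by auto
    have "f (finsum M g (insert i I)) = f (g i \<oplus>\<^bsub>M\<^esub> finsum M g I)"
      using insert.hyps g by simp
    also have "\<dots> = f (g i) \<oplus>\<^bsub>N\<^esub> finsum N (\<lambda>i. f (g i)) I"
      using assms(4) g insert.IH by simp
    also have "\<dots> = finsum N (\<lambda>i. f (g i)) (insert i I)"
      using insert.hyps fg by simp
    finally show ?case .
  qed
qed

lemma additive_minus:
  assumes "abelian_group M" and "abelian_group N" and "f \<in> carrier M \<rightarrow> carrier N"
    and "\<And>x y. x \<in> carrier M \<Longrightarrow> y \<in> carrier M \<Longrightarrow> f (x \<oplus>\<^bsub>M\<^esub> y) = f x \<oplus>\<^bsub>N\<^esub> f y"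
    and x: "x \<in> carrier M" and y: "y \<in> carrier M"
  shows "f (x \<ominus>\<^bsub>M\<^esub> y) = f x \<ominus>\<^bsub>N\<^esub> f y"
proof -
  interpret M: abelian_group M by fact
  interpret N: abelian_group N by fact
  have c: "f (x \<ominus>\<^bsub>M\<^esub> y) \<in> carrier N" "f x \<in> carrier N" "f y \<in> carrier N"
    using assms(3) x y by auto
  have "x = (x \<ominus>\<^bsub>M\<^esub> y) \<oplus>\<^bsub>M\<^esub> y"
    using x y by (simp add: M.minus_eq M.a_assoc M.l_neg)
  then have "f x = f (x \<ominus>\<^bsub>M\<^esub> y) \<oplus>\<^bsub>N\<^esub> f y"
    using assms(4)[of "x \<ominus>\<^bsub>M\<^esub> y" y] x y by simp
  then show ?thesis using c by (simp add: N.minus_eq N.a_assoc N.r_neg)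
qed

lemma module_hom_zero:
  assumes "left_module R M" and "left_module R N" and "f \<in> module_hom R M N"
  shows "f \<zero>\<^bsub>M\<^esub> = \<zero>\<^bsub>N\<^esub>"
  by (rule additive_zero[OF left_module.axioms(2)[OF assms(1)] left_module.axioms(2)[OF assms(2)]])
    (use assms in \<open>auto simp: module_hom_def\<close>)

lemma module_hom_finsum:
  assumes "left_module R M" and "left_module R N" and "f \<in> module_hom R M N"
    and "finite I" and "g \<in> I \<rightarrow> carrier M"
  shows "f (finsum M g I) = finsum N (\<lambda>i. f (g i)) I"
  by (rule additive_finsum[OF left_module.axioms(2)[OF assms(1)] left_module.axioms(2)[OF assms(2)]])
    (use assms in \<open>auto simp: module_hom_def\<close>)

lemma module_hom_minus:
  assumes "left_module R M" and "left_module R N" and "f \<in> module_hom R M N"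
    and "x \<in> carrier M" and "y \<in> carrier M"
  shows "f (x \<ominus>\<^bsub>M\<^esub> y) = f x \<ominus>\<^bsub>N\<^esub> f y"
  by (rule additive_minus[OF left_module.axioms(2)[OF assms(1)] left_module.axioms(2)[OF assms(2)]])
    (use assms in \<open>auto simp: module_hom_def\<close>)

lemma (in left_module) smult_minus:
  assumes "a \<in> carrier R" and "x \<in> carrier M" and "y \<in> carrier M"
  shows "a \<odot>\<^bsub>M\<^esub> (x \<ominus>\<^bsub>M\<^esub> y) = a \<odot>\<^bsub>M\<^esub> x \<ominus>\<^bsub>M\<^esub> a \<odot>\<^bsub>M\<^esub> y"
  by (rule additive_minus[where f = "\<lambda>x. a \<odot>\<^bsub>M\<^esub> x", OF M.abelian_group_axioms M.abelian_group_axioms])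
    (use assms smult_r_distr in auto)

lemma module_hom_const_zero:
  assumes "left_module R N"
  shows "(\<lambda>x. \<zero>\<^bsub>N\<^esub>) \<in> module_hom R M N"
proof -
  interpret N: left_module R N by fact
  show ?thesis by (rule module_homI) (auto simp: N.smult_r_null)
qed

lemma module_hom_add:
  assumes "left_module R N" and "f \<in> module_hom R M N" and "g \<in> module_hom R M N"
  shows "(\<lambda>x. f x \<oplus>\<^bsub>N\<^esub> g x) \<in> module_hom R M N"
proof -
  interpret N: left_module R N by fact
  show ?thesis
    by (rule module_homI)
      (auto simp: module_homD[OF assms(2)] module_homD[OF assms(3)] N.smult_r_distr N.M.add.m_ac)
qed

lemma module_hom_diff:
  assumes "left_module R N" and "f \<in> module_hom R M N" and "g \<in> module_hom R M N"
  shows "(\<lambda>x. f x \<ominus>\<^bsub>N\<^esub> g x) \<in> module_hom R M N"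
proof -
  interpret N: left_module R N by fact
  note f = module_homD[OF assms(2)] and g = module_homD[OF assms(3)]
  show ?thesis
  proof (rule module_homI)
    show "f (x \<oplus>\<^bsub>M\<^esub> y) \<ominus>\<^bsub>N\<^esub> g (x \<oplus>\<^bsub>M\<^esub> y) = (f x \<ominus>\<^bsub>N\<^esub> g x) \<oplus>\<^bsub>N\<^esub> (f y \<ominus>\<^bsub>N\<^esub> g y)"
      if "x \<in> carrier M" "y \<in> carrier M" for x y
      using that f g by (simp add: N.M.minus_eq N.M.minus_add N.M.add.m_ac)
  qed (simp_all add: f g N.smult_minus)
qed

lemma module_hom_finsum_maps:
  assumes "left_module R N" and "finite I" and f: "\<And>k. k \<in> I \<Longrightarrow> f k \<in> module_hom R M N"
  shows "(\<lambda>x. finsum N (\<lambda>k. f k x) I) \<in> module_hom R M N"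
proof -
  interpret N: left_module R N by fact
  show ?thesis
  proof (rule module_homI)
    show "finsum N (\<lambda>k. f k x) I \<in> carrier N" if "x \<in> carrier M" for x
      using that module_homD(1)[OF f] by (auto intro!: N.M.finsum_closed)
    show "finsum N (\<lambda>k. f k (x \<oplus>\<^bsub>M\<^esub> y)) I = finsum N (\<lambda>k. f k x) I \<oplus>\<^bsub>N\<^esub> finsum N (\<lambda>k. f k y) I"
      if "x \<in> carrier M" "y \<in> carrier M" for x y
    proof -
      have "finsum N (\<lambda>k. f k (x \<oplus>\<^bsub>M\<^esub> y)) I = finsum N (\<lambda>k. f k x \<oplus>\<^bsub>N\<^esub> f k y) I"
        using that module_homD[OF f] by (intro N.M.finsum_cong') auto
      also have "\<dots> = finsum N (\<lambda>k. f k x) I \<oplus>\<^bsub>N\<^esub> finsum N (\<lambda>k. f k y) I"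
        using that module_homD(1)[OF f] by (intro N.M.finsum_addf) auto
      finally show ?thesis .
    qed
    show "finsum N (\<lambda>k. f k (r \<odot>\<^bsub>M\<^esub> x)) I = r \<odot>\<^bsub>N\<^esub> finsum N (\<lambda>k. f k x) I"
      if "r \<in> carrier R" "x \<in> carrier M" for r x
      using that module_homD[OF f] assms(2)
      by (subst N.finsum_smult) (auto intro!: N.M.finsum_cong')
  qed
qed

section \<open>Isomorphisms and their inverses\<close>

lemma module_iso_hom: "f \<in> module_iso R M N \<Longrightarrow> f \<in> module_hom R M N"
  by (simp add: module_iso_def)

lemma module_iso_id: "(\<lambda>x. x) \<in> module_iso R M M"
  by (simp add: module_iso_def module_hom_id bij_betw_def)

lemma module_iso_inverse:
  assumes "left_module R M" and "f \<in> module_iso R M N"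
  obtains g where "g \<in> module_iso R N M" and "\<And>x. x \<in> carrier M \<Longrightarrow> g (f x) = x"
    and "\<And>y. y \<in> carrier N \<Longrightarrow> f (g y) = y"
proof -
  interpret M: left_module R M by fact
  let ?g = "inv_into (carrier M) f"
  have f: "f \<in> module_hom R M N" and b: "bij_betw f (carrier M) (carrier N)"
    using assms(2) by (auto simp: module_iso_def)
  have inv: "?g (f x) = x" if "x \<in> carrier M" for x
    using b that by (simp add: bij_betw_def)
  have inv': "f (?g y) = y" "?g y \<in> carrier M" if "y \<in> carrier N" for y
    using b that by (auto simp: bij_betw_def f_inv_into_f inv_into_into)
  have "?g \<in> module_hom R N M"
  proof (rule module_homI)
    show "?g (y \<oplus>\<^bsub>N\<^esub> z) = ?g y \<oplus>\<^bsub>M\<^esub> ?g z" if "y \<in> carrier N" "z \<in> carrier N" for y z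
      using inv[of "?g y \<oplus>\<^bsub>M\<^esub> ?g z"] that inv' module_homD[OF f] by simp
    show "?g (r \<odot>\<^bsub>N\<^esub> y) = r \<odot>\<^bsub>M\<^esub> ?g y" if "r \<in> carrier R" "y \<in> carrier N" for r y
      using inv[of "r \<odot>\<^bsub>M\<^esub> ?g y"] that inv' module_homD[OF f] by simp
  qed (use inv' in auto)
  then have "?g \<in> module_iso R N M"
    using bij_betw_inv_into[OF b] by (simp add: module_iso_def)
  then show ?thesis using inv inv' that by blast
qed


section \<open>Retracts\<close>

lemma submodule_carrier:
  assumes "left_module R M" and "submodule K R M"
  shows "x \<in> K \<Longrightarrow> x \<in> carrier M"
  using subgroup.subset[OF submodule.axioms(1)[OF assms(2)]] by auto

lemma submodule_ops:
  assumes "left_module R M" and "submodule K R M"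
  shows "\<zero>\<^bsub>M\<^esub> \<in> K" and "x \<in> K \<Longrightarrow> y \<in> K \<Longrightarrow> x \<oplus>\<^bsub>M\<^esub> y \<in> K"
    and "x \<in> K \<Longrightarrow> y \<in> K \<Longrightarrow> x \<ominus>\<^bsub>M\<^esub> y \<in> K"
    and "r \<in> carrier R \<Longrightarrow> x \<in> K \<Longrightarrow> r \<odot>\<^bsub>M\<^esub> x \<in> K"
proof -
  interpret M: left_module R M by fact
  interpret K: submodule K R M by fact
  show "\<zero>\<^bsub>M\<^esub> \<in> K" using K.one_closed by simp
  show add: "x \<in> K \<Longrightarrow> y \<in> K \<Longrightarrow> x \<oplus>\<^bsub>M\<^esub> y \<in> K" for x y using K.m_closed by simp
  show "x \<in> K \<Longrightarrow> y \<in> K \<Longrightarrow> x \<ominus>\<^bsub>M\<^esub> y \<in> K"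
    using K.m_inv_closed[of y] add by (simp add: M.M.minus_eq a_inv_def)
  show "r \<in> carrier R \<Longrightarrow> x \<in> K \<Longrightarrow> r \<odot>\<^bsub>M\<^esub> x \<in> K" by simp
qed

lemma left_module_submoduleI:
  assumes "left_module R M" and "K \<subseteq> carrier M" and "\<zero>\<^bsub>M\<^esub> \<in> K"
    and "\<And>x y. x \<in> K \<Longrightarrow> y \<in> K \<Longrightarrow> x \<ominus>\<^bsub>M\<^esub> y \<in> K"
    and "\<And>r x. r \<in> carrier R \<Longrightarrow> x \<in> K \<Longrightarrow> r \<odot>\<^bsub>M\<^esub> x \<in> K"
  shows "submodule K R M"
proof -
  interpret M: left_module R M by fact
  have neg: "\<ominus>\<^bsub>M\<^esub> x \<in> K" if "x \<in> K" for x
    using assms(2,3) assms(4)[of "\<zero>\<^bsub>M\<^esub>" x] that by (auto simp: M.M.minus_eq)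
  have add: "x \<oplus>\<^bsub>M\<^esub> y \<in> K" if "x \<in> K" "y \<in> K" for x y
  proof -
    have "x \<ominus>\<^bsub>M\<^esub> (\<ominus>\<^bsub>M\<^esub> y) \<in> K" using that neg assms(4) by blast
    moreover have "x \<in> carrier M" "y \<in> carrier M" using that assms(2) by auto
    ultimately show ?thesis by (simp add: M.M.minus_eq)
  qed
  have "subgroup K (add_monoid M)"
    using assms(2,3) add neg by (intro subgroup.intro) (auto simp: a_inv_def)
  then show ?thesis using assms(5) by (intro submodule.intro submodule_axioms.intro) auto
qed

lemma direct_summand_projection:
  assumes "left_module R N" and "direct_summand R K N"
  obtains p where "p \<in> module_hom R N (N\<lparr>carrier := K\<rparr>)" and "\<And>x. x \<in> K \<Longrightarrow> p x = x"
proof -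
  interpret N: left_module R N by fact
  obtain L where K: "submodule K R N" and L: "submodule L R N"
    and int: "K \<inter> L = {\<zero>\<^bsub>N\<^esub>}" and sum: "K <+>\<^bsub>N\<^esub> L = carrier N"
    using assms(2) unfolding direct_summand_def by blast
  note cK = submodule_carrier[OF assms(1) K] and cL = submodule_carrier[OF assms(1) L]
  note oK = submodule_ops[OF assms(1) K] and oL = submodule_ops[OF assms(1) L]
  have uniq: "k = k'" if "k \<in> K" "l \<in> L" "k' \<in> K" "l' \<in> L" "k \<oplus>\<^bsub>N\<^esub> l = k' \<oplus>\<^bsub>N\<^esub> l'" for k l k' l'
  proof -
    have c: "k \<in> carrier N" "l \<in> carrier N" "k' \<in> carrier N" "l' \<in> carrier N"
      using that cK cL by auto
    \<comment> \<open>The difference of the \<open>K\<close>-parts is the opposite difference of the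
      \<open>L\<close>-parts, so it lies in both submodules.\<close>
    have "k \<ominus>\<^bsub>N\<^esub> k' = (k \<oplus>\<^bsub>N\<^esub> l) \<ominus>\<^bsub>N\<^esub> l \<ominus>\<^bsub>N\<^esub> k'"
      using c by (simp add: N.M.minus_eq N.M.a_assoc N.M.r_neg)
    also have "\<dots> = l' \<ominus>\<^bsub>N\<^esub> l"
    proof -
      have "k' \<oplus>\<^bsub>N\<^esub> l' \<ominus>\<^bsub>N\<^esub> l \<ominus>\<^bsub>N\<^esub> k' = (k' \<oplus>\<^bsub>N\<^esub> \<ominus>\<^bsub>N\<^esub> k') \<oplus>\<^bsub>N\<^esub> (l' \<ominus>\<^bsub>N\<^esub> l)"
        using c by (simp add: N.M.minus_eq N.M.a_ac del: N.M.r_neg)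
      then show ?thesis unfolding that(5) using c by (simp add: N.M.r_neg)
    qed
    finally have "k \<ominus>\<^bsub>N\<^esub> k' \<in> K \<inter> L" using that oK(3)[of k k'] oL(3)[of l' l] by simp
    then have "k \<ominus>\<^bsub>N\<^esub> k' = \<zero>\<^bsub>N\<^esub>" using int by simp
    then show ?thesis using c N.M.eq_if_minus_zero by blast
  qed
  have "\<exists>k l. k \<in> K \<and> l \<in> L \<and> x = k \<oplus>\<^bsub>N\<^esub> l" if "x \<in> carrier N" for x
  proof -
    have "x \<in> K <+>\<^bsub>N\<^esub> L" using that sum by simp
    then show ?thesis unfolding set_add_def' by blast
  qed
  then obtain p q where pq: "\<And>x. x \<in> carrier N \<Longrightarrow> p x \<in> K \<and> q x \<in> L \<and> x = p x \<oplus>\<^bsub>N\<^esub> q x"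
    by metis
  have p: "p x = k" if "x = k \<oplus>\<^bsub>N\<^esub> l" "k \<in> K" "l \<in> L" for x k l
    using pq[of x] uniq[of "p x" "q x" k l] that cK cL by auto
  have "p \<in> module_hom R N (N\<lparr>carrier := K\<rparr>)"
  proof (rule module_homI)
    fix x y assume xy: "x \<in> carrier N" "y \<in> carrier N"
    have c: "p x \<in> carrier N" "p y \<in> carrier N" "q x \<in> carrier N" "q y \<in> carrier N"
      using pq xy cK cL by auto
    have "x \<oplus>\<^bsub>N\<^esub> y = (p x \<oplus>\<^bsub>N\<^esub> q x) \<oplus>\<^bsub>N\<^esub> (p y \<oplus>\<^bsub>N\<^esub> q y)"
      using pq xy by metis
    also have "\<dots> = (p x \<oplus>\<^bsub>N\<^esub> p y) \<oplus>\<^bsub>N\<^esub> (q x \<oplus>\<^bsub>N\<^esub> q y)"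
      using c by (simp add: N.M.a_ac)
    finally show "p (x \<oplus>\<^bsub>N\<^esub> y) = p x \<oplus>\<^bsub>N\<lparr>carrier := K\<rparr>\<^esub> p y"
      using p[of "x \<oplus>\<^bsub>N\<^esub> y"] pq xy oK oL by simp
  next
    fix r x assume rx: "r \<in> carrier R" "x \<in> carrier N"
    have c: "p x \<in> carrier N" "q x \<in> carrier N"
      using pq rx cK cL by auto
    have "r \<odot>\<^bsub>N\<^esub> x = r \<odot>\<^bsub>N\<^esub> (p x \<oplus>\<^bsub>N\<^esub> q x)" using pq rx by metis
    also have "\<dots> = r \<odot>\<^bsub>N\<^esub> p x \<oplus>\<^bsub>N\<^esub> r \<odot>\<^bsub>N\<^esub> q x" using c rx by (simp add: N.smult_r_distr)
    finally show "p (r \<odot>\<^bsub>N\<^esub> x) = r \<odot>\<^bsub>N\<lparr>carrier := K\<rparr>\<^esub> p x"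
      using p[of "r \<odot>\<^bsub>N\<^esub> x"] pq rx oK oL by simp
  qed (use pq in auto)
  moreover have "p x = x" if "x \<in> K" for x
    using p[of x x "\<zero>\<^bsub>N\<^esub>"] that cK oL by simp
  ultimately show ?thesis using that by blast
qed

text \<open>A retraction consists of two maps and an equation, which functors carry along more
  easily than an internal complement. Conversely, the kernel of \<open>p\<close> complements the
  image of \<open>i\<close>, because x = i (p x) + (x - i (p x)).\<close>

lemma iso_to_summand_iff_retract:
  assumes N: "left_module R N"
  shows "iso_to_summand R M N \<longleftrightarrow> left_module R M \<and>
    (\<exists>i \<in> module_hom R M N. \<exists>p \<in> module_hom R N M. \<forall>x \<in> carrier M. p (i x) = x)"
    (is "?lhs \<longleftrightarrow> ?rhs")
proof
  interpret N: left_module R N by fact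
  show ?rhs if lhs: ?lhs
  proof -
    obtain K where M: "left_module R M" and K: "direct_summand R K N"
      and ne: "module_iso R M (N\<lparr>carrier := K\<rparr>) \<noteq> {}"
      using lhs unfolding iso_to_summand_def by blast
    obtain \<sigma> where \<sigma>: "\<sigma> \<in> module_iso R M (N\<lparr>carrier := K\<rparr>)"
      using ne by blast
    have sub: "submodule K R N" using K by (simp add: direct_summand_def)
    obtain p where p: "p \<in> module_hom R N (N\<lparr>carrier := K\<rparr>)" "\<And>x. x \<in> K \<Longrightarrow> p x = x"
      using direct_summand_projection[OF N K] by blast
    obtain \<tau> where \<tau>: "\<tau> \<in> module_iso R (N\<lparr>carrier := K\<rparr>) M" "\<And>x. x \<in> carrier M \<Longrightarrow> \<tau> (\<sigma> x) = x"
      using module_iso_inverse[OF M \<sigma>] by blast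
    have \<sigma>K: "\<sigma> x \<in> K" if "x \<in> carrier M" for x
      using module_homD(1)[OF module_iso_hom[OF \<sigma>] that] by simp
    have "\<sigma> \<in> module_hom R M N"
      using module_homD[OF module_iso_hom[OF \<sigma>]] submodule_carrier[OF N sub] \<sigma>K
      by (intro module_homI) auto
    moreover have "(\<lambda>x. \<tau> (p x)) \<in> module_hom R N M"
      using module_hom_comp[OF p(1) module_iso_hom[OF \<tau>(1)]] .
    ultimately show ?rhs using M p(2) \<tau>(2) \<sigma>K by (metis (no_types, lifting))
  qed
  show ?lhs if rhs: ?rhs
  proof -
    obtain i p where M: "left_module R M" and i: "i \<in> module_hom R M N" and p: "p \<in> module_hom R N M"
      and pi: "\<And>x. x \<in> carrier M \<Longrightarrow> p (i x) = x"
      using rhs by blast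
    interpret M: left_module R M by fact
    let ?K = "i ` carrier M" and ?L = "{x \<in> carrier N. p x = \<zero>\<^bsub>M\<^esub>}"
    note i' = module_homD[OF i] and p' = module_homD[OF p]
    have iz: "i \<zero>\<^bsub>M\<^esub> = \<zero>\<^bsub>N\<^esub>" and pz: "p \<zero>\<^bsub>N\<^esub> = \<zero>\<^bsub>M\<^esub>"
      using module_hom_zero[OF M N i] module_hom_zero[OF N M p] by auto
    have K: "submodule ?K R N"
    proof (rule left_module_submoduleI[OF N])
      show "\<zero>\<^bsub>N\<^esub> \<in> ?K" using iz by (metis M.M.zero_closed imageI)
      show "x \<ominus>\<^bsub>N\<^esub> y \<in> ?K" if "x \<in> ?K" "y \<in> ?K" for x y
        using that by (auto simp flip: module_hom_minus[OF M N i])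
      show "r \<odot>\<^bsub>N\<^esub> x \<in> ?K" if "r \<in> carrier R" "x \<in> ?K" for r x
        using that by (auto simp flip: i'(3))
    qed (use i' in auto)
    have zz: "\<zero>\<^bsub>M\<^esub> \<ominus>\<^bsub>M\<^esub> \<zero>\<^bsub>M\<^esub> = \<zero>\<^bsub>M\<^esub>" by (simp add: M.M.minus_eq)
    have L: "submodule ?L R N"
      by (rule left_module_submoduleI[OF N])
        (auto simp: pz zz p' module_hom_minus[OF N M p] M.smult_r_null)
    have "?K \<inter> ?L = {\<zero>\<^bsub>N\<^esub>}"
      using pi iz pz by (auto, metis M.M.zero_closed imageI)
    moreover have "?K <+>\<^bsub>N\<^esub> ?L = carrier N"
    proof
      show "?K <+>\<^bsub>N\<^esub> ?L \<subseteq> carrier N" using i' by (auto simp: set_add_def')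
      show "carrier N \<subseteq> ?K <+>\<^bsub>N\<^esub> ?L"
      proof
        fix x assume x: "x \<in> carrier N"
        have c: "i (p x) \<in> carrier N" "p x \<in> carrier M" using x i' p' by auto
        have "x \<ominus>\<^bsub>N\<^esub> i (p x) \<in> ?L"
          using x c by (auto simp: module_hom_minus[OF N M p] pi M.M.minus_eq M.M.r_neg)
        moreover have "x = i (p x) \<oplus>\<^bsub>N\<^esub> (x \<ominus>\<^bsub>N\<^esub> i (p x))"
          using x c by (simp add: N.M.minus_eq N.M.a_lcomm N.M.r_neg)
        ultimately show "x \<in> ?K <+>\<^bsub>N\<^esub> ?L" using c unfolding set_add_def' by blast
      qed
    qed
    ultimately have "direct_summand R ?K N" unfolding direct_summand_def using K L by blast
    moreover have "i \<in> module_iso R M (N\<lparr>carrier := ?K\<rparr>)"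
    proof -
      have "i \<in> module_hom R M (N\<lparr>carrier := ?K\<rparr>)" by (rule module_homI) (auto simp: i')
      moreover have "inj_on i (carrier M)" by (rule inj_on_inverseI[of _ p]) (rule pi)
      ultimately show ?thesis by (simp add: module_iso_def bij_betw_def)
    qed
    ultimately show ?lhs unfolding iso_to_summand_def using M by blast
  qed
qed


section \<open>Finite direct sums and free modules\<close>

lemma direct_power_simps [simp]:
  "carrier (direct_power M n) = {..<n} \<rightarrow>\<^sub>E carrier M"
  "zero (direct_power M n) = (\<lambda>i \<in> {..<n}. \<zero>\<^bsub>M\<^esub>)"
  "add (direct_power M n) f g = (\<lambda>i \<in> {..<n}. f i \<oplus>\<^bsub>M\<^esub> g i)"
  "smult (direct_power M n) r f = (\<lambda>i \<in> {..<n}. r \<odot>\<^bsub>M\<^esub> f i)"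
  by (simp_all add: direct_power_def)

lemma regular_module_simps [simp]:
  "carrier (regular_module R) = carrier R"
  "zero (regular_module R) = zero R"
  "add (regular_module R) = add R"
  "smult (regular_module R) = mult R"
  by (simp_all add: regular_module_def)

lemma left_module_regular:
  assumes "ring R" shows "left_module R (regular_module R)"
proof -
  interpret R: ring R by fact
  have "abelian_group (regular_module R)"
  proof (rule abelian_groupI)
    fix x assume "x \<in> carrier (regular_module R)"
    then show "\<exists>y \<in> carrier (regular_module R). y \<oplus>\<^bsub>regular_module R\<^esub> x = \<zero>\<^bsub>regular_module R\<^esub>"
      by (intro bexI[of _ "\<ominus>\<^bsub>R\<^esub> x"]) (simp_all add: R.l_neg)
  qed (simp_all add: R.a_ac)
  then show ?thesis
    by (intro left_module.intro left_module_axioms.intro assms)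
      (auto simp: R.l_distr R.r_distr R.m_assoc)
qed

lemma left_module_direct_power:
  assumes "left_module R M" shows "left_module R (direct_power M n)"
proof -
  interpret M: left_module R M by fact
  have "abelian_group (direct_power M n)"
  proof (rule abelian_groupI)
    fix f assume f: "f \<in> carrier (direct_power M n)"
    then show "\<exists>g \<in> carrier (direct_power M n). g \<oplus>\<^bsub>direct_power M n\<^esub> f = \<zero>\<^bsub>direct_power M n\<^esub>"
      by (intro bexI[of _ "\<lambda>i \<in> {..<n}. \<ominus>\<^bsub>M\<^esub> f i"])
        (auto simp: PiE_iff M.M.l_neg intro!: restrict_ext)
  qed (auto simp: PiE_iff M.M.a_ac extensional_def fun_eq_iff restrict_def)
  then show ?thesis
    by (intro left_module.intro left_module_axioms.intro M.R.ring_axioms)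
      (auto simp: PiE_iff M.smult_l_distr M.smult_r_distr M.smult_assoc1 extensional_def fun_eq_iff
        restrict_def)
qed

lemma direct_power_proj:
  "k < n \<Longrightarrow> (\<lambda>f. f k) \<in> module_hom R (direct_power M n) M"
  by (rule module_homI) auto

text \<open>The inclusion of the factor with index \<open>k\<close>. For \<open>k\<close> at least
  \<open>n\<close> it is the zero map, so it is linear for every \<open>k\<close>.\<close>

definition power_inj :: "('r, 'm) module \<Rightarrow> nat \<Rightarrow> nat \<Rightarrow> 'm \<Rightarrow> nat \<Rightarrow> 'm" where
  "power_inj M n k x = (\<lambda>i \<in> {..<n}. if k = i then x else \<zero>\<^bsub>M\<^esub>)"

lemma power_inj_hom:
  assumes "left_module R M"
  shows "power_inj M n k \<in> module_hom R M (direct_power M n)"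
proof -
  interpret M: left_module R M by fact
  show ?thesis
    by (rule module_homI) (auto simp: power_inj_def fun_eq_iff M.smult_r_null)
qed

lemma power_inj_decomp:
  fixes R :: "'r ring"
  assumes M: "left_module R M" and f: "f \<in> carrier (direct_power M n)"
  shows "finsum (direct_power M n) (\<lambda>k. power_inj M n k (f k)) {..<n} = f"
proof
  interpret M: left_module R M by fact
  interpret D: left_module R "direct_power M n" by (rule left_module_direct_power[OF M])
  let ?s = "finsum (direct_power M n) (\<lambda>k. power_inj M n k (f k)) {..<n}"
  have inj: "(\<lambda>k. power_inj M n k (f k)) \<in> {..<n} \<rightarrow> carrier (direct_power M n)"
    using f by (intro Pi_I module_homD(1)[OF power_inj_hom[OF M]]) (auto simp: PiE_iff)
  then have s: "?s \<in> carrier (direct_power M n)" by (rule D.M.finsum_closed)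
  fix j show "?s j = f j"
  proof (cases "j < n")
    case True
    have "?s j = finsum M (\<lambda>k. power_inj M n k (f k) j) {..<n}"
      using module_hom_finsum[OF D.left_module_axioms M direct_power_proj[OF True] _ inj] by simp
    also have "\<dots> = finsum M (\<lambda>k. if j = k then f k else \<zero>\<^bsub>M\<^esub>) {..<n}"
      by (rule M.M.finsum_cong') (use True f in \<open>auto simp: power_inj_def PiE_iff\<close>)
    also have "\<dots> = f j"
      by (rule M.M.finsum_singleton) (use True f in \<open>auto simp: PiE_iff\<close>)
    finally show ?thesis .
  next
    case False
    then show ?thesis using s f by (auto simp: PiE_iff extensional_def)
  qed
qed

text \<open>Inclusion and projection of a summand of a finite power, taken apart into their
  components. No power of \<open>T\<close> occurs any more, so the condition can be moved to another
  ring and another element type by mapping the families.\<close>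

definition family_retract :: "'r ring \<Rightarrow> ('r, 't) module \<Rightarrow> ('r, 'm) module \<Rightarrow> bool" where
  "family_retract R T M \<longleftrightarrow> (\<exists>(n::nat) i p.
    (\<forall>k<n. i k \<in> module_hom R M T) \<and> (\<forall>k<n. p k \<in> module_hom R T M) \<and>
    (\<forall>x \<in> carrier M. finsum M (\<lambda>k. p k (i k x)) {..<n} = x))"

lemma family_retractI:
  fixes n :: nat
  assumes "\<And>k. k < n \<Longrightarrow> i k \<in> module_hom R M T" and "\<And>k. k < n \<Longrightarrow> p k \<in> module_hom R T M"
    and "\<And>x. x \<in> carrier M \<Longrightarrow> finsum M (\<lambda>k. p k (i k x)) {..<n} = x"
  shows "family_retract R T M"
  unfolding family_retract_def
  by (rule exI[of _ n], rule exI[of _ i], rule exI[of _ p]) (use assms in simp)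

lemma family_retractE:
  assumes "family_retract R T M"
  obtains n :: nat and i p where "\<And>k. k < n \<Longrightarrow> i k \<in> module_hom R M T"
    and "\<And>k. k < n \<Longrightarrow> p k \<in> module_hom R T M"
    and "\<And>x. x \<in> carrier M \<Longrightarrow> finsum M (\<lambda>k. p k (i k x)) {..<n} = x"
proof -
  obtain n :: nat and i p where "(\<forall>k<n. i k \<in> module_hom R M T) \<and> (\<forall>k<n. p k \<in> module_hom R T M) \<and>
      (\<forall>x \<in> carrier M. finsum M (\<lambda>k. p k (i k x)) {..<n} = x)"
    using assms unfolding family_retract_def by (elim exE)
  then show ?thesis by (intro that[of n i p]) auto
qed

text \<open>One direction composes inclusion and projection with the coordinate maps of the power;
  the other assembles the families into a tuple and a sum.\<close>

lemma in_add_iff_family_retract: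
  assumes T: "left_module R T"
  shows "in_add R T M \<longleftrightarrow> left_module R M \<and> family_retract R T M"
proof
  assume "in_add R T M"
  then obtain n i p where M: "left_module R M"
    and i: "i \<in> module_hom R M (direct_power T n)" and p: "p \<in> module_hom R (direct_power T n) M"
    and pi: "\<And>x. x \<in> carrier M \<Longrightarrow> p (i x) = x"
    unfolding in_add_def iso_to_summand_iff_retract[OF left_module_direct_power[OF T]] by blast
  have "finsum M (\<lambda>k. p (power_inj T n k (i x k))) {..<n} = x" if x: "x \<in> carrier M" for x
  proof -
    have ix: "i x \<in> carrier (direct_power T n)" by (rule module_homD(1)[OF i x])
    have "(\<lambda>k. power_inj T n k (i x k)) \<in> {..<n} \<rightarrow> carrier (direct_power T n)"
      using ix by (intro Pi_I module_homD(1)[OF power_inj_hom[OF T]]) (auto simp: PiE_iff)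
    then show ?thesis
      using module_hom_finsum[OF left_module_direct_power[OF T] M p finite_lessThan]
        power_inj_decomp[OF T ix] pi[OF x] by metis
  qed
  then have "family_retract R T M"
    by (intro family_retractI[where i = "\<lambda>k x. i x k" and p = "\<lambda>k x. p (power_inj T n k x)"]
        module_hom_comp[OF i direct_power_proj] module_hom_comp[OF power_inj_hom[OF T] p])
  with M show "left_module R M \<and> family_retract R T M" ..
next
  assume MT: "left_module R M \<and> family_retract R T M"
  then have M: "left_module R M" by blast
  obtain n :: nat and i p where i: "\<And>k. k < n \<Longrightarrow> i k \<in> module_hom R M T"
    and p: "\<And>k. k < n \<Longrightarrow> p k \<in> module_hom R T M"
    and pi: "\<And>x. x \<in> carrier M \<Longrightarrow> finsum M (\<lambda>k. p k (i k x)) {..<n} = x"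
    using family_retractE[of R T M] MT by blast
  interpret M: left_module R M by fact
  have "(\<lambda>x. \<lambda>k \<in> {..<n}. i k x) \<in> module_hom R M (direct_power T n)"
    by (rule module_homI) (auto simp: module_homD[OF i] fun_eq_iff)
  moreover have "(\<lambda>f. finsum M (\<lambda>k. p k (f k)) {..<n}) \<in> module_hom R (direct_power T n) M"
    using module_hom_comp[OF direct_power_proj p] by (intro module_hom_finsum_maps[OF M]) auto
  moreover have "finsum M (\<lambda>k. p k ((\<lambda>k \<in> {..<n}. i k x) k)) {..<n} = x" if x: "x \<in> carrier M" for x
  proof -
    have "finsum M (\<lambda>k. p k ((\<lambda>k \<in> {..<n}. i k x) k)) {..<n} = finsum M (\<lambda>k. p k (i k x)) {..<n}"
      using x module_homD(1)[OF i] module_homD(1)[OF p] by (intro M.M.finsum_cong') auto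
    then show ?thesis using pi[OF x] by simp
  qed
  ultimately have "iso_to_summand R M (direct_power T n)"
    unfolding iso_to_summand_iff_retract[OF left_module_direct_power[OF T]]
    using M by (intro conjI bexI[of _ "\<lambda>x. \<lambda>k \<in> {..<n}. i k x"]
        bexI[of _ "\<lambda>f. finsum M (\<lambda>k. p k (f k)) {..<n}"] ballI)
  then show "in_add R T M" unfolding in_add_def ..
qed

text \<open>For an index outside \<open>B\<close> this is the zero vector, so it belongs to the free
  module for every index. \<open>projective_lift\<close> relies on this when it chooses preimages
  for all indices at once.\<close>

definition unit_vec :: "'r ring \<Rightarrow> 'b set \<Rightarrow> 'b \<Rightarrow> 'b \<Rightarrow> 'r" where
  "unit_vec R B b = (\<lambda>c \<in> B. if c = b then \<one>\<^bsub>R\<^esub> else \<zero>\<^bsub>R\<^esub>)"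

lemma unit_vec_carrier:
  assumes "ring R"
  shows "unit_vec R B b \<in> carrier (free_module R B)"
proof -
  interpret R: ring R by fact
  have "finite {c \<in> B. unit_vec R B b c \<noteq> \<zero>\<^bsub>R\<^esub>}"
    by (rule finite_subset[of _ "{b}"]) (auto simp: unit_vec_def)
  then show ?thesis by (auto simp: unit_vec_def)
qed

lemma lin_comb_unit_vec:
  assumes M: "left_module R M" and e: "e \<in> B \<rightarrow> carrier M" and b: "b \<in> B"
  shows "lin_comb M R B e (unit_vec R B b) = e b"
proof -
  interpret M: left_module R M by fact
  have "lin_comb M R B e (unit_vec R B b) = finsum M (\<lambda>c. unit_vec R B b c \<odot>\<^bsub>M\<^esub> e c) {b}"
    by (rule lin_comb_superset[OF M e unit_vec_carrier])
      (use b in \<open>auto simp: unit_vec_def M.R.ring_axioms\<close>)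
  also have "\<dots> = e b"
    using b e by (auto simp: unit_vec_def Pi_iff)
  finally show ?thesis .
qed

lemma module_hom_lin_comb:
  assumes M: "left_module R M" and N: "left_module R N" and \<phi>: "\<phi> \<in> module_hom R M N"
    and e: "e \<in> B \<rightarrow> carrier M" and f: "f \<in> carrier (free_module R B)"
  shows "\<phi> (lin_comb M R B e f) = lin_comb N R B (\<lambda>b. \<phi> (e b)) f"
proof -
  interpret M: left_module R M by fact
  interpret N: left_module R N by fact
  have "\<phi> (lin_comb M R B e f) = finsum N (\<lambda>b. \<phi> (f b \<odot>\<^bsub>M\<^esub> e b)) {b \<in> B. f b \<noteq> \<zero>\<^bsub>R\<^esub>}"
    unfolding lin_comb_def by (rule module_hom_finsum[OF M N \<phi>]) (use e f in \<open>auto simp: PiE_iff Pi_iff\<close>)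
  also have "\<dots> = lin_comb N R B (\<lambda>b. \<phi> (e b)) f"
    unfolding lin_comb_def using e f module_homD[OF \<phi>]
    by (intro N.M.finsum_cong') (auto simp: PiE_iff Pi_iff)
  finally show ?thesis .
qed

lemma lin_comb_unit_vecs:
  assumes R: "ring R" and f: "f \<in> carrier (free_module R B)"
  shows "lin_comb (free_module R B) R B (unit_vec R B) f = f"
proof
  interpret R: ring R by fact
  interpret F: left_module R "free_module R B" by (rule left_module_free[OF R])
  let ?F = "free_module R B"
  have e: "unit_vec R B \<in> B \<rightarrow> carrier ?F" by (intro Pi_I unit_vec_carrier[OF R])
  have c: "lin_comb ?F R B (unit_vec R B) f \<in> carrier ?F"
    using module_homD(1)[OF lin_comb_hom[OF F.left_module_axioms e] f] .
  fix b show "lin_comb ?F R B (unit_vec R B) f b = f b"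
  proof (cases "b \<in> B")
    case True
    have h: "(\<lambda>f. f b) \<in> module_hom R ?F (regular_module R)"
      by (rule module_homI) (use True in auto)
    \<comment> \<open>\<open>b\<close> is inserted because it need not lie in the support of
      \<open>f\<close>; the sum over \<open>?S\<close> then collapses to its term at
      \<open>b\<close>.\<close>
    let ?S = "insert b {b \<in> B. f b \<noteq> \<zero>\<^bsub>R\<^esub>}"
    have "lin_comb ?F R B (unit_vec R B) f b = lin_comb (regular_module R) R B (\<lambda>c. unit_vec R B c b) f"
      by (rule module_hom_lin_comb[OF F.left_module_axioms left_module_regular[OF R] h e f])
    also have "\<dots> = finsum (regular_module R) (\<lambda>c. f c \<odot>\<^bsub>regular_module R\<^esub> unit_vec R B c b) ?S"
      by (rule lin_comb_superset[OF left_module_regular[OF R] _ f])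
        (use True f in \<open>auto simp: unit_vec_def\<close>)
    also have "\<dots> = finsum (regular_module R) (\<lambda>c. if b = c then f c else \<zero>\<^bsub>regular_module R\<^esub>) ?S"
      using True f
      by (intro abelian_monoid.finsum_cong'[OF abelian_group.axioms(1)[OF left_module.axioms(2)[OF left_module_regular[OF R]]]])
        (auto simp: unit_vec_def PiE_iff)
    also have "\<dots> = f b"
      using True f
      by (intro abelian_monoid.finsum_singleton[OF abelian_group.axioms(1)[OF left_module.axioms(2)[OF left_module_regular[OF R]]]])
        (auto simp: PiE_iff)
    finally show ?thesis .
  next
    case False
    then show ?thesis using c f by (auto simp: PiE_iff extensional_def)
  qed
qed


section \<open>Projective modules\<close>

text \<open>The definition asks for a basis inside the element type of \<open>P\<close>. The carrier
  of \<open>P\<close> is such a basis, so it remains to split the canonical map from the free module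
  on it.\<close>

lemma projective_moduleI:
  assumes P: "left_module R P" and s: "s \<in> module_hom R P (free_module R (carrier P))"
    and "\<And>x. x \<in> carrier P \<Longrightarrow> lin_comb P R (carrier P) (\<lambda>x. x) (s x) = x"
  shows "projective_module R P"
proof -
  have R: "ring R" using P by (rule left_module.axioms)
  have "lin_comb P R (carrier P) (\<lambda>x. x) \<in> module_hom R (free_module R (carrier P)) P"
    by (rule lin_comb_hom[OF P]) auto
  then have "iso_to_summand R P (free_module R (carrier P))"
    unfolding iso_to_summand_iff_retract[OF left_module_free[OF R]] using assms by blast
  then show ?thesis unfolding projective_module_def by blast
qed

lemma projective_left_module: "projective_module R P \<Longrightarrow> left_module R P"
  by (auto simp: projective_module_def iso_to_summand_def)

text \<open>Comparing images instead of assuming \<open>\<pi>\<close> surjective lets the lemma lift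
  through the differentials of an exact sequence. Preimages are chosen for the images of the basis
  vectors and extended linearly.\<close>

lemma projective_lift:
  fixes P :: "('r, 'p) module"
  assumes P: "projective_module R P" and X: "left_module R X" and Y: "left_module R Y"
    and \<pi>: "\<pi> \<in> module_hom R X Y" and g: "g \<in> module_hom R P Y"
    and im: "g ` carrier P \<subseteq> \<pi> ` carrier X"
  obtains h where "h \<in> module_hom R P X" and "\<And>x. x \<in> carrier P \<Longrightarrow> \<pi> (h x) = g x"
proof -
  have R: "ring R" using X by (rule left_module.axioms)
  note lP = projective_left_module[OF P]
  obtain B :: "'p set" and i p where i: "i \<in> module_hom R P (free_module R B)"
    and p: "p \<in> module_hom R (free_module R B) P" and pi: "\<And>x. x \<in> carrier P \<Longrightarrow> p (i x) = x"
    using P unfolding projective_module_def iso_to_summand_iff_retract[OF left_module_free[OF R]]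
    by blast
  let ?e = "\<lambda>b. p (unit_vec R B b)"
  have e: "?e b \<in> carrier P" for b by (rule module_homD(1)[OF p unit_vec_carrier[OF R]])
  have "\<exists>x. x \<in> carrier X \<and> \<pi> x = g (?e b)" for b using im e by (metis image_iff image_subset_iff)
  then obtain x where x: "\<And>b. x b \<in> carrier X" "\<And>b. \<pi> (x b) = g (?e b)" by metis
  have hom: "lin_comb X R B x \<in> module_hom R (free_module R B) X"
    by (rule lin_comb_hom[OF X]) (use x in auto)
  have "\<pi> (lin_comb X R B x (i y)) = g y" if y: "y \<in> carrier P" for y
  proof -
    have c: "i y \<in> carrier (free_module R B)" by (rule module_homD(1)[OF i y])
    have "\<pi> (lin_comb X R B x (i y)) = lin_comb Y R B (\<lambda>b. \<pi> (x b)) (i y)"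
      by (rule module_hom_lin_comb[OF X Y \<pi> _ c]) (use x in auto)
    also have "\<dots> = g (lin_comb P R B ?e (i y))"
      unfolding x(2) by (rule module_hom_lin_comb[OF lP Y g _ c, symmetric]) (use e in auto)
    also have "lin_comb P R B ?e (i y) = p (lin_comb (free_module R B) R B (unit_vec R B) (i y))"
      by (rule module_hom_lin_comb[OF left_module_free[OF R] lP p _ c, symmetric])
        (intro Pi_I unit_vec_carrier[OF R])
    also have "\<dots> = y" using lin_comb_unit_vecs[OF R c] pi[OF y] by simp
    finally show ?thesis .
  qed
  with module_hom_comp[OF i hom] show ?thesis by (rule that)
qed

section \<open>Finitely generated projective modules and dual bases\<close>

lemma submodule_finsum:
  assumes M: "left_module R M" and K: "submodule K R M" and "finite I" and "f \<in> I \<rightarrow> K"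
  shows "finsum M f I \<in> K"
proof -
  interpret M: left_module R M by fact
  show ?thesis using assms(3,4)
  proof (induction I rule: finite_induct)
    case empty
    then show ?case using submodule_ops(1)[OF M K] by simp
  next
    case (insert i I)
    then have "finsum M f (insert i I) = f i \<oplus>\<^bsub>M\<^esub> finsum M f I"
      using submodule_carrier[OF M K] by (intro M.M.finsum_insert) auto
    then show ?case using insert submodule_ops(2)[OF M K] by auto
  qed
qed

text \<open>The dual basis lemma: \<open>z k\<close> is the value of \<open>p k\<close> at one, and
  linearity turns \<open>p k (i k x)\<close> into a multiple of it.\<close>

lemma in_add_regular_expansion:
  assumes R: "ring R" and "in_add R (regular_module R) M"
  obtains n :: nat and i z where "\<And>k. k < n \<Longrightarrow> i k \<in> module_hom R M (regular_module R)"
    and "\<And>k. k < n \<Longrightarrow> z k \<in> carrier M"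
    and "\<And>x. x \<in> carrier M \<Longrightarrow> finsum M (\<lambda>k. i k x \<odot>\<^bsub>M\<^esub> z k) {..<n} = x"
proof -
  interpret R: ring R by fact
  have M: "left_module R M" and ret: "family_retract R (regular_module R) M"
    using assms(2) in_add_iff_family_retract[OF left_module_regular[OF R]] by auto
  obtain n :: nat and i p where i: "\<And>k. k < n \<Longrightarrow> i k \<in> module_hom R M (regular_module R)"
    and p: "\<And>k. k < n \<Longrightarrow> p k \<in> module_hom R (regular_module R) M"
    and pi: "\<And>x. x \<in> carrier M \<Longrightarrow> finsum M (\<lambda>k. p k (i k x)) {..<n} = x"
    using family_retractE[OF ret] by blast
  interpret M: left_module R M by fact
  have z: "p k \<one>\<^bsub>R\<^esub> \<in> carrier M" if "k < n" for k using module_homD(1)[OF p[OF that]] by simp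
  have "finsum M (\<lambda>k. i k x \<odot>\<^bsub>M\<^esub> p k \<one>\<^bsub>R\<^esub>) {..<n} = x" if x: "x \<in> carrier M" for x
  proof -
    have c: "i k x \<in> carrier R" if "k < n" for k using module_homD(1)[OF i[OF that] x] by simp
    have eq: "i k x \<odot>\<^bsub>M\<^esub> p k \<one>\<^bsub>R\<^esub> = p k (i k x)" if "k < n" for k
      using module_homD(3)[OF p[OF that] c[OF that], of "\<one>\<^bsub>R\<^esub>"] c[OF that] by simp
    have "finsum M (\<lambda>k. i k x \<odot>\<^bsub>M\<^esub> p k \<one>\<^bsub>R\<^esub>) {..<n} = finsum M (\<lambda>k. p k (i k x)) {..<n}"
      by (rule M.M.finsum_cong') (use c z eq module_homD(1)[OF p] in auto)
    then show ?thesis using pi[OF x] by simp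
  qed
  then show ?thesis using i z by (rule that[rotated 2])
qed

text \<open>Both claims come from a dual basis. The section into the free module sends
  \<open>x\<close> to the sum of the basis vectors at \<open>z k\<close> with coefficients
  \<open>i k x\<close>; coincidences among the \<open>z k\<close> do no harm, as the coefficients
  then add up.\<close>

lemma in_add_regular_fin_gen_projective:
  assumes R: "ring R" and M: "in_add R (regular_module R) M"
  shows "projective_module R M" and "fin_gen_module R M"
proof -
  interpret R: ring R by fact
  have lM: "left_module R M"
    using M in_add_iff_family_retract[OF left_module_regular[OF R]] by blast
  interpret M: left_module R M by fact
  let ?F = "free_module R (carrier M)"
  interpret F: left_module R ?F by (rule left_module_free[OF R])
  obtain n :: nat and i z where i: "\<And>k. k < n \<Longrightarrow> i k \<in> module_hom R M (regular_module R)"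
    and z: "\<And>k. k < n \<Longrightarrow> z k \<in> carrier M"
    and iz: "\<And>x. x \<in> carrier M \<Longrightarrow> finsum M (\<lambda>k. i k x \<odot>\<^bsub>M\<^esub> z k) {..<n} = x"
    using in_add_regular_expansion[OF R M] by blast
  note i' = module_homD[OF i, simplified]
  let ?t = "\<lambda>k x. i k x \<odot>\<^bsub>?F\<^esub> unit_vec R (carrier M) (z k)"
  note u = unit_vec_carrier[OF R, of "carrier M"]
  have t: "?t k \<in> module_hom R M ?F" if "k < n" for k
    using that u i' F.smult_closed[OF _ u] F.smult_l_distr[OF _ _ u] F.smult_assoc1[OF _ _ u]
    by (intro module_homI) (simp_all del: free_module_simps)
  have hom: "lin_comb M R (carrier M) (\<lambda>x. x) \<in> module_hom R ?F M"
    by (rule lin_comb_hom[OF lM]) auto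
  show "projective_module R M"
  proof (rule projective_moduleI[OF lM])
    show "(\<lambda>x. finsum ?F (\<lambda>k. ?t k x) {..<n}) \<in> module_hom R M ?F"
      by (rule module_hom_finsum_maps[OF F.left_module_axioms]) (use t in auto)
    fix x assume x: "x \<in> carrier M"
    have "lin_comb M R (carrier M) (\<lambda>x. x) (finsum ?F (\<lambda>k. ?t k x) {..<n}) =
        finsum M (\<lambda>k. lin_comb M R (carrier M) (\<lambda>x. x) (?t k x)) {..<n}"
      by (rule module_hom_finsum[OF F.left_module_axioms lM hom])
        (use x module_homD(1)[OF t] in \<open>auto simp del: free_module_simps\<close>)
    also have "\<dots> = finsum M (\<lambda>k. i k x \<odot>\<^bsub>M\<^esub> z k) {..<n}"
      using x i' z u module_homD(3)[OF hom _ u] lin_comb_unit_vec[OF lM, of "\<lambda>x. x" "carrier M"]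
      by (intro M.M.finsum_cong') (auto simp del: free_module_simps)
    finally show "lin_comb M R (carrier M) (\<lambda>x. x) (finsum ?F (\<lambda>k. ?t k x) {..<n}) = x"
      using iz[OF x] by simp
  qed
  show "fin_gen_module R M"
    unfolding fin_gen_module_def
  proof (intro exI[of _ "z ` {..<n}"] conjI allI impI)
    fix K assume "submodule K R M \<and> z ` {..<n} \<subseteq> K"
    then have K: "submodule K R M" and zK: "\<And>k. k < n \<Longrightarrow> z k \<in> K" by auto
    have "x \<in> K" if x: "x \<in> carrier M" for x
      using submodule_finsum[OF lM K finite_lessThan[of n], of "\<lambda>k. i k x \<odot>\<^bsub>M\<^esub> z k"]
        iz[OF x] i' zK x submodule_ops(4)[OF lM K] by auto
    then show "K = carrier M" using submodule_carrier[OF lM K] by blast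
  qed (use z in auto)
qed

text \<open>Only finitely many basis elements matter: the elements whose coordinates vanish outside
  the supports of the generators form a submodule that contains the generators. The remaining basis
  elements are numbered to give the two families.\<close>

lemma fin_gen_projective_in_add_regular:
  fixes M :: "('r, 'm) module"
  assumes fg: "fin_gen_module R M" and P: "projective_module R M"
  shows "in_add R (regular_module R) M"
proof -
  note M = projective_left_module[OF P]
  interpret M: left_module R M by fact
  have R: "ring R" by (rule M.R.ring_axioms)
  obtain B :: "'m set" and i p where i: "i \<in> module_hom R M (free_module R B)"
    and p: "p \<in> module_hom R (free_module R B) M" and pi: "\<And>x. x \<in> carrier M \<Longrightarrow> p (i x) = x"
    using P unfolding projective_module_def iso_to_summand_iff_retract[OF left_module_free[OF R]]
    by blast
  obtain S where S: "S \<subseteq> carrier M" "finite S" "\<And>K. submodule K R M \<Longrightarrow> S \<subseteq> K \<Longrightarrow> K = carrier M"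
    using fg unfolding fin_gen_module_def by blast
  note i' = module_homD[OF i]
  define B' where "B' = (\<Union>s \<in> S. {b \<in> B. i s b \<noteq> \<zero>\<^bsub>R\<^esub>})"
  have B': "finite B'" "B' \<subseteq> B"
    using S i' unfolding B'_def by auto
  have coord: "(\<lambda>x. i x b) \<in> module_hom R M (regular_module R)" if "b \<in> B" for b
    by (rule module_homI) (use that i' in auto)
  let ?K = "{x \<in> carrier M. \<forall>b \<in> B - B'. i x b = \<zero>\<^bsub>R\<^esub>}"
  interpret Reg: left_module R "regular_module R" by (rule left_module_regular[OF R])
  have zz: "\<zero>\<^bsub>R\<^esub> \<ominus>\<^bsub>regular_module R\<^esub> \<zero>\<^bsub>R\<^esub> = \<zero>\<^bsub>R\<^esub>"
    using Reg.M.r_neg[OF Reg.M.zero_closed] by (simp add: a_minus_def)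
  have "submodule ?K R M"
  proof (rule left_module_submoduleI[OF M])
    show "\<zero>\<^bsub>M\<^esub> \<in> ?K"
      using module_hom_zero[OF M left_module_regular[OF R] coord] by simp
    show "x \<ominus>\<^bsub>M\<^esub> y \<in> ?K" if "x \<in> ?K" "y \<in> ?K" for x y
      using that module_hom_minus[OF M left_module_regular[OF R] coord, of _ x y] zz by auto
    show "r \<odot>\<^bsub>M\<^esub> x \<in> ?K" if "r \<in> carrier R" "x \<in> ?K" for r x
      using that i'(3)[of r x] by auto
  qed auto
  moreover have "S \<subseteq> ?K" using S unfolding B'_def by auto
  ultimately have K: "i x b = \<zero>\<^bsub>R\<^esub>" if "x \<in> carrier M" "b \<in> B - B'" for x b
    using S(3) that by blast
  obtain g where g: "bij_betw g {..<card B'} B'"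
    using ex_bij_betw_nat_finite[OF B'(1)] by (auto simp: lessThan_atLeast0)
  let ?e = "\<lambda>b. p (unit_vec R B b)"
  have e: "?e b \<in> carrier M" for b by (rule module_homD(1)[OF p unit_vec_carrier[OF R]])
  have gB: "g k \<in> B" if "k < card B'" for k using g B' that by (auto simp: bij_betw_def)
  have "finsum M (\<lambda>k. i x (g k) \<odot>\<^bsub>M\<^esub> ?e (g k)) {..<card B'} = x" if x: "x \<in> carrier M" for x
  proof -
    have c: "i x \<in> carrier (free_module R B)" by (rule module_homD(1)[OF i x])
    have "finsum M (\<lambda>k. i x (g k) \<odot>\<^bsub>M\<^esub> ?e (g k)) {..<card B'} =
        finsum M (\<lambda>b. i x b \<odot>\<^bsub>M\<^esub> ?e b) (g ` {..<card B'})"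
      by (rule M.M.finsum_reindex[symmetric])
        (use g gB c e B'(2) in \<open>auto simp: bij_betw_def PiE_iff intro!: M.smult_closed\<close>)
    also have "g ` {..<card B'} = B'" using g by (simp add: bij_betw_def)
    also have "finsum M (\<lambda>b. i x b \<odot>\<^bsub>M\<^esub> ?e b) B' = lin_comb M R B ?e (i x)"
      by (rule lin_comb_superset[OF M _ c, symmetric]) (use B' K x e in auto)
    also have "\<dots> = p (lin_comb (free_module R B) R B (unit_vec R B) (i x))"
      by (rule module_hom_lin_comb[OF left_module_free[OF R] M p _ c, symmetric])
        (intro Pi_I unit_vec_carrier[OF R])
    also have "\<dots> = x" using lin_comb_unit_vecs[OF R c] pi[OF x] by simp
    finally show ?thesis .
  qed
  moreover have "(\<lambda>r. r \<odot>\<^bsub>M\<^esub> ?e b) \<in> module_hom R (regular_module R) M" for b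
    by (rule module_homI) (simp_all add: e M.smult_l_distr M.smult_assoc1)
  ultimately have "family_retract R (regular_module R) M"
    using coord[OF gB] by (intro family_retractI[where i = "\<lambda>k x. i x (g k)"
          and p = "\<lambda>k r. r \<odot>\<^bsub>M\<^esub> ?e (g k)" and n = "card B'"])
  then show ?thesis using in_add_iff_family_retract[OF left_module_regular[OF R]] M by blast
qed


section \<open>Comparison of projective resolutions\<close>

lemma exact_at_iff:
  "exact_at L f M g N \<longleftrightarrow> f ` carrier L = {x \<in> carrier M. g x = \<zero>\<^bsub>N\<^esub>}"
  by (simp add: exact_at_def a_kernel_def')

lemma exact_atD:
  assumes "exact_at L f M g N"
  shows "x \<in> carrier L \<Longrightarrow> g (f x) = \<zero>\<^bsub>N\<^esub>"
    and "y \<in> carrier M \<Longrightarrow> g y = \<zero>\<^bsub>N\<^esub> \<Longrightarrow> y \<in> f ` carrier L"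
  using assms unfolding exact_at_iff by blast+

lemma projective_resolutionD:
  assumes "projective_resolution R M P d \<epsilon>"
  shows "projective_module R (P n)" and "left_module R (P n)"
    and "d n \<in> module_hom R (P (Suc n)) (P n)" and "\<epsilon> \<in> module_hom R (P 0) M"
    and "\<epsilon> ` carrier (P 0) = carrier M" and "exact_at (P (Suc 0)) (d 0) (P 0) \<epsilon> M"
    and "exact_at (P (Suc (Suc n))) (d (Suc n)) (P (Suc n)) (d n) (P n)"
  using assms projective_left_module unfolding projective_resolution_def by auto

text \<open>The comparison map between two resolutions of \<open>M\<close>, lifting the identity
  degree by degree through dependent choice.\<close>

lemma resolution_chain_map:
  assumes P: "projective_resolution R M P d \<epsilon>" and Q: "projective_resolution R M Q d' \<epsilon>'"
    and M: "left_module R M"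
  obtains u where "\<And>n. u n \<in> module_hom R (P n) (Q n)"
    and "\<And>x. x \<in> carrier (P 0) \<Longrightarrow> \<epsilon>' (u 0 x) = \<epsilon> x"
    and "\<And>n x. x \<in> carrier (P (Suc n)) \<Longrightarrow> d' n (u (Suc n) x) = u n (d n x)"
proof -
  note p = projective_resolutionD[OF P] and q = projective_resolutionD[OF Q]
  \<comment> \<open>Besides linearity, \<open>?A\<close> records that the next lift exists:
    \<open>u\<close> after the differential lands in the image of \<open>d'\<close>.
    \<open>?B\<close> links consecutive degrees by commutation with the differentials.\<close>
  let ?A = "\<lambda>n u. u \<in> module_hom R (P n) (Q n) \<and> (n = 0 \<longrightarrow> (\<forall>x \<in> carrier (P 0). \<epsilon>' (u x) = \<epsilon> x)) \<and>
    (\<forall>x \<in> carrier (P (Suc n)). u (d n x) \<in> d' n ` carrier (Q (Suc n)))"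
  let ?B = "\<lambda>n u v. \<forall>x \<in> carrier (P (Suc n)). d' n (v x) = u (d n x)"
  have "\<exists>u. ?A 0 u"
  proof -
    have "\<epsilon> ` carrier (P 0) \<subseteq> \<epsilon>' ` carrier (Q 0)" using p(5) q(5) by simp
    then obtain u where u: "u \<in> module_hom R (P 0) (Q 0)" "\<And>x. x \<in> carrier (P 0) \<Longrightarrow> \<epsilon>' (u x) = \<epsilon> x"
      using projective_lift[OF p(1) q(2) M q(4) p(4)] by metis
    have "u (d 0 x) \<in> d' 0 ` carrier (Q (Suc 0))" if x: "x \<in> carrier (P (Suc 0))" for x
      using exact_atD(2)[OF q(6)] u module_homD(1)[OF p(3) x] exact_atD(1)[OF p(6) x]
        module_homD(1)[OF u(1)] by simp
    with u show ?thesis by auto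
  qed
  moreover have "\<exists>v. ?A (Suc n) v \<and> ?B n u v" if u: "?A n u" for n u
  proof -
    have hom: "(\<lambda>x. u (d n x)) \<in> module_hom R (P (Suc n)) (Q n)"
      using module_hom_comp[OF p(3)] u by blast
    have "(\<lambda>x. u (d n x)) ` carrier (P (Suc n)) \<subseteq> d' n ` carrier (Q (Suc n))"
      using u by blast
    then obtain v where v: "v \<in> module_hom R (P (Suc n)) (Q (Suc n))"
        "\<And>x. x \<in> carrier (P (Suc n)) \<Longrightarrow> d' n (v x) = u (d n x)"
      using projective_lift[OF p(1) q(2) q(2) q(3) hom] by metis
    have "v (d (Suc n) x) \<in> d' (Suc n) ` carrier (Q (Suc (Suc n)))" if x: "x \<in> carrier (P (Suc (Suc n)))" for x
    proof -
      have dx: "d (Suc n) x \<in> carrier (P (Suc n))" by (rule module_homD(1)[OF p(3) x])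
      have "d' n (v (d (Suc n) x)) = u \<zero>\<^bsub>P n\<^esub>"
        using v(2)[OF dx] exact_atD(1)[OF p(7) x] by simp
      also have "\<dots> = \<zero>\<^bsub>Q n\<^esub>" using module_hom_zero[OF p(2) q(2)] u by blast
      finally show ?thesis using exact_atD(2)[OF q(7)] module_homD(1)[OF v(1) dx] by blast
    qed
    with v show ?thesis by auto
  qed
  ultimately obtain u where "\<And>n. ?A n (u n) \<and> ?B n (u n) (u (Suc n))"
    using dependent_nat_choice[of ?A ?B] by blast
  then show ?thesis by (intro that[of u]) auto
qed

text \<open>A chain map over zero is null homotopic: the obstruction to the next step is a cycle,
  hence a boundary, and lifts. Only the identity in positive degrees is exported, since
  \<open>Ext\<close> is wanted only there.\<close>

lemma resolution_null_homotopy: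
  assumes P: "projective_resolution R M P d \<epsilon>" and Q: "projective_resolution R M Q d' \<epsilon>'"
    and M: "left_module R M"
    and w: "\<And>n. w n \<in> module_hom R (P n) (Q n)"
    and w0: "\<And>x. x \<in> carrier (P 0) \<Longrightarrow> \<epsilon>' (w 0 x) = \<zero>\<^bsub>M\<^esub>"
    and wS: "\<And>n x. x \<in> carrier (P (Suc n)) \<Longrightarrow> d' n (w (Suc n) x) = w n (d n x)"
  obtains s where "\<And>n. s n \<in> module_hom R (P n) (Q (Suc n))"
    and "\<And>n x. x \<in> carrier (P (Suc n)) \<Longrightarrow>
      d' (Suc n) (s (Suc n) x) = w (Suc n) x \<ominus>\<^bsub>Q (Suc n)\<^esub> s n (d n x)"
proof -
  note p = projective_resolutionD[OF P] and q = projective_resolutionD[OF Q]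
  let ?g = "\<lambda>n s x. w (Suc n) x \<ominus>\<^bsub>Q (Suc n)\<^esub> s (d n x)"
  let ?A = "\<lambda>n s. s \<in> module_hom R (P n) (Q (Suc n)) \<and>
    (\<forall>x \<in> carrier (P (Suc n)). ?g n s x \<in> d' (Suc n) ` carrier (Q (Suc (Suc n))))"
  let ?B = "\<lambda>n s t. \<forall>x \<in> carrier (P (Suc n)). d' (Suc n) (t x) = ?g n s x"
  have hom: "?g n s \<in> module_hom R (P (Suc n)) (Q (Suc n))" if "s \<in> module_hom R (P n) (Q (Suc n))" for n s
    by (rule module_hom_diff[OF q(2) w module_hom_comp[OF p(3) that]])
  \<comment> \<open>The boundary of the obstruction; it vanishes once the homotopy identity is known
    one degree lower.\<close>
  have dg: "d' n (?g n s x) = w n (d n x) \<ominus>\<^bsub>Q n\<^esub> d' n (s (d n x))"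
    if "s \<in> module_hom R (P n) (Q (Suc n))" "x \<in> carrier (P (Suc n))" for n s x
  proof -
    have dx: "d n x \<in> carrier (P n)" by (rule module_homD(1)[OF p(3) that(2)])
    show ?thesis
      using module_hom_minus[OF q(2) q(2) q(3) module_homD(1)[OF w that(2)] module_homD(1)[OF that(1) dx]]
        wS[OF that(2)] by simp
  qed
  have cancel: "y \<ominus>\<^bsub>Q n\<^esub> y = \<zero>\<^bsub>Q n\<^esub>" if "y \<in> carrier (Q n)" for y n
  proof -
    interpret Qn: left_module R "Q n" by (rule q(2))
    show ?thesis using that by (simp add: Qn.M.minus_eq Qn.M.r_neg)
  qed
  have "\<exists>s. ?A 0 s"
  proof -
    have "w 0 ` carrier (P 0) \<subseteq> d' 0 ` carrier (Q (Suc 0))"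
      using exact_atD(2)[OF q(6)] w0 module_homD(1)[OF w] by blast
    then obtain s where s: "s \<in> module_hom R (P 0) (Q (Suc 0))" "\<And>x. x \<in> carrier (P 0) \<Longrightarrow> d' 0 (s x) = w 0 x"
      using projective_lift[OF p(1) q(2) q(2) q(3) w] by metis
    have "?g 0 s x \<in> d' (Suc 0) ` carrier (Q (Suc (Suc 0)))" if x: "x \<in> carrier (P (Suc 0))" for x
    proof -
      have dx: "d 0 x \<in> carrier (P 0)" by (rule module_homD(1)[OF p(3) x])
      have "d' 0 (?g 0 s x) = \<zero>\<^bsub>Q 0\<^esub>"
        using dg[OF s(1) x] s(2)[OF dx] cancel[OF module_homD(1)[OF w dx]] by simp
      then show ?thesis using exact_atD(2)[OF q(7)] module_homD(1)[OF hom[OF s(1)] x] by blast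
    qed
    with s show ?thesis by auto
  qed
  moreover have "\<exists>t. ?A (Suc n) t \<and> ?B n s t" if s: "?A n s" for n s
  proof -
    have sh: "s \<in> module_hom R (P n) (Q (Suc n))" using s by blast
    have "?g n s ` carrier (P (Suc n)) \<subseteq> d' (Suc n) ` carrier (Q (Suc (Suc n)))"
      using s by blast
    then obtain t where t: "t \<in> module_hom R (P (Suc n)) (Q (Suc (Suc n)))"
        "\<And>x. x \<in> carrier (P (Suc n)) \<Longrightarrow> d' (Suc n) (t x) = ?g n s x"
      using projective_lift[OF p(1) q(2) q(2) q(3) hom[OF sh]] by metis
    have "?g (Suc n) t x \<in> d' (Suc (Suc n)) ` carrier (Q (Suc (Suc (Suc n))))"
      if x: "x \<in> carrier (P (Suc (Suc n)))" for x
    proof -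
      interpret Q: left_module R "Q (Suc n)" by (rule q(2))
      have dx: "d (Suc n) x \<in> carrier (P (Suc n))" by (rule module_homD(1)[OF p(3) x])
      have "s (d n (d (Suc n) x)) = \<zero>\<^bsub>Q (Suc n)\<^esub>"
        using exact_atD(1)[OF p(7) x] module_hom_zero[OF p(2) q(2) sh] by simp
      then have "d' (Suc n) (t (d (Suc n) x)) = w (Suc n) (d (Suc n) x)"
        using t(2)[OF dx] module_homD(1)[OF w dx] by (simp add: Q.M.minus_eq)
      then have "d' (Suc n) (?g (Suc n) t x) = \<zero>\<^bsub>Q (Suc n)\<^esub>"
        using dg[OF t(1) x] cancel[OF module_homD(1)[OF w dx]] by simp
      then show ?thesis using exact_atD(2)[OF q(7)] module_homD(1)[OF hom[OF t(1)] x] by blast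
    qed
    with t show ?thesis by auto
  qed
  ultimately obtain s where "\<And>n. ?A n (s n) \<and> ?B n (s n) (s (Suc n))"
    using dependent_nat_choice[of ?A ?B] by blast
  then show ?thesis by (intro that[of s]) auto
qed


section \<open>Exactness of contravariant Hom\<close>

text \<open>Exactness of \<open>Hom(Z, N) \<rightarrow> Hom(Y, N) \<rightarrow> Hom(X, N)\<close> at the middle term, stated for arbitrary
  representatives instead of the extensional elements of \<open>Hom\<close>.\<close>

definition coexact :: "'r ring \<Rightarrow> ('r, 'n) module \<Rightarrow> ('r, 'x) module \<Rightarrow> ('x \<Rightarrow> 'y) \<Rightarrow> ('r, 'y) module \<Rightarrow>
    ('y \<Rightarrow> 'z) \<Rightarrow> ('r, 'z) module \<Rightarrow> bool" where
  "coexact R N X f Y g Z \<longleftrightarrow>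
    (\<forall>\<phi> \<in> module_hom R Y N. (\<forall>x \<in> carrier X. \<phi> (f x) = \<zero>\<^bsub>N\<^esub>) \<longrightarrow>
      (\<exists>\<psi> \<in> module_hom R Z N. \<forall>y \<in> carrier Y. \<psi> (g y) = \<phi> y))"

lemma coexactI:
  assumes "\<And>\<phi>. \<phi> \<in> module_hom R Y N \<Longrightarrow> (\<And>x. x \<in> carrier X \<Longrightarrow> \<phi> (f x) = \<zero>\<^bsub>N\<^esub>) \<Longrightarrow>
    \<exists>\<psi> \<in> module_hom R Z N. \<forall>y \<in> carrier Y. \<psi> (g y) = \<phi> y"
  shows "coexact R N X f Y g Z"
  using assms unfolding coexact_def by blast

lemma coexactD:
  assumes "coexact R N X f Y g Z" and "\<phi> \<in> module_hom R Y N"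
    and "\<And>x. x \<in> carrier X \<Longrightarrow> \<phi> (f x) = \<zero>\<^bsub>N\<^esub>"
  shows "\<exists>\<psi> \<in> module_hom R Z N. \<forall>y \<in> carrier Y. \<psi> (g y) = \<phi> y"
  using assms unfolding coexact_def by blast

text \<open>Whether every cocycle is a coboundary does not depend on the resolution. With comparison
  maps \<open>u\<close>, \<open>v\<close> and a homotopy \<open>s\<close> from the identity to their
  composite, a solution \<open>\<psi>\<close> for the cocycle pulled back along \<open>v\<close>
  yields the solution \<psi> u + \<phi> s. The resolutions may have different element types.\<close>

lemma coexact_resolution:
  assumes P: "projective_resolution R M P d \<epsilon>" and Q: "projective_resolution R M Q d' \<epsilon>'"
    and M: "left_module R M" and N: "left_module R N"
    and coex: "coexact R N (Q (Suc (Suc i))) (d' (Suc i)) (Q (Suc i)) (d' i) (Q i)"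
  shows "coexact R N (P (Suc (Suc i))) (d (Suc i)) (P (Suc i)) (d i) (P i)"
proof (rule coexactI)
  note p = projective_resolutionD[OF P] and q = projective_resolutionD[OF Q]
  interpret M: left_module R M by fact
  interpret N: left_module R N by fact
  fix \<phi> assume \<phi>: "\<phi> \<in> module_hom R (P (Suc i)) N"
    and \<phi>d: "\<And>x. x \<in> carrier (P (Suc (Suc i))) \<Longrightarrow> \<phi> (d (Suc i) x) = \<zero>\<^bsub>N\<^esub>"
  obtain u where u: "\<And>n. u n \<in> module_hom R (P n) (Q n)"
      "\<And>x. x \<in> carrier (P 0) \<Longrightarrow> \<epsilon>' (u 0 x) = \<epsilon> x"
      "\<And>n x. x \<in> carrier (P (Suc n)) \<Longrightarrow> d' n (u (Suc n) x) = u n (d n x)"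
    using resolution_chain_map[OF P Q M] by blast
  obtain v where v: "\<And>n. v n \<in> module_hom R (Q n) (P n)"
      "\<And>x. x \<in> carrier (Q 0) \<Longrightarrow> \<epsilon> (v 0 x) = \<epsilon>' x"
      "\<And>n x. x \<in> carrier (Q (Suc n)) \<Longrightarrow> d n (v (Suc n) x) = v n (d' n x)"
    using resolution_chain_map[OF Q P M] by blast
  note uc = module_homD(1)[OF u(1)] and vc = module_homD(1)[OF v(1)] and dc = module_homD(1)[OF p(3)]
  \<comment> \<open>The identity minus the composite of the comparison maps lifts the zero map of
    \<open>M\<close>, hence is null homotopic.\<close>
  define w where "w n x = x \<ominus>\<^bsub>P n\<^esub> v n (u n x)" for n x
  have w: "w n \<in> module_hom R (P n) (P n)" for n
    unfolding w_def by (rule module_hom_diff[OF p(2) module_hom_id module_hom_comp[OF u(1) v(1)]])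
  have w0: "\<epsilon> (w 0 x) = \<zero>\<^bsub>M\<^esub>" if x: "x \<in> carrier (P 0)" for x
    using module_hom_minus[OF p(2) M p(4) x vc[OF uc[OF x]]] u(2)[OF x] v(2)[OF uc[OF x]]
      module_homD(1)[OF p(4) x] by (simp add: w_def M.M.minus_eq M.M.r_neg)
  have wS: "d n (w (Suc n) x) = w n (d n x)" if x: "x \<in> carrier (P (Suc n))" for n x
    using module_hom_minus[OF p(2) p(2) p(3) x vc[OF uc[OF x]]] v(3)[OF uc[OF x]] u(3)[OF x]
    by (simp add: w_def)
  obtain s where s: "\<And>n. s n \<in> module_hom R (P n) (P (Suc n))"
      "\<And>n x. x \<in> carrier (P (Suc n)) \<Longrightarrow> d (Suc n) (s (Suc n) x) = w (Suc n) x \<ominus>\<^bsub>P (Suc n)\<^esub> s n (d n x)"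
    using resolution_null_homotopy[where w = w, OF P P M w w0 wS] by blast
  have "\<phi> (v (Suc i) (d' (Suc i) y)) = \<zero>\<^bsub>N\<^esub>" if y: "y \<in> carrier (Q (Suc (Suc i)))" for y
    using \<phi>d[OF vc[OF y]] v(3)[OF y] by simp
  then obtain \<psi> where \<psi>: "\<psi> \<in> module_hom R (Q i) N"
      "\<And>y. y \<in> carrier (Q (Suc i)) \<Longrightarrow> \<psi> (d' i y) = \<phi> (v (Suc i) y)"
    using coexactD[OF coex module_hom_comp[OF v(1) \<phi>]] by blast
  let ?\<chi> = "\<lambda>x. \<psi> (u i x) \<oplus>\<^bsub>N\<^esub> \<phi> (s i x)"
  have "?\<chi> \<in> module_hom R (P i) N"
    by (rule module_hom_add[OF N module_hom_comp[OF u(1) \<psi>(1)] module_hom_comp[OF s(1) \<phi>]])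
  moreover have "?\<chi> (d i x) = \<phi> x" if x: "x \<in> carrier (P (Suc i))" for x
  proof -
    note sx = module_homD(1)[OF s(1) dc[OF x]] and wx = module_homD(1)[OF w x]
    note vu = vc[OF uc[OF x]]
    have c: "\<phi> x \<in> carrier N" "\<phi> (v (Suc i) (u (Suc i) x)) \<in> carrier N" "\<phi> (s i (d i x)) \<in> carrier N"
      "\<phi> (w (Suc i) x) \<in> carrier N"
      using module_homD(1)[OF \<phi>] x vu sx wx by auto
    \<comment> \<open>Since the cocycle \<open>\<phi>\<close> kills boundaries, the homotopy
      identity becomes \<phi> w = \<phi> s d.\<close>
    have "\<phi> (w (Suc i) x) \<ominus>\<^bsub>N\<^esub> \<phi> (s i (d i x)) = \<zero>\<^bsub>N\<^esub>"
      using \<phi>d[OF module_homD(1)[OF s(1) x]] s(2)[OF x] module_hom_minus[OF p(2) N \<phi> wx sx] by simp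
    then have "\<phi> (s i (d i x)) = \<phi> (w (Suc i) x)"
      by (rule N.M.eq_if_minus_zero[OF c(4,3), symmetric])
    also have "\<dots> = \<phi> x \<ominus>\<^bsub>N\<^esub> \<phi> (v (Suc i) (u (Suc i) x))"
      unfolding w_def by (rule module_hom_minus[OF p(2) N \<phi> x vu])
    finally have "\<phi> (s i (d i x)) = \<phi> x \<ominus>\<^bsub>N\<^esub> \<phi> (v (Suc i) (u (Suc i) x))" .
    moreover have "\<psi> (u i (d i x)) = \<phi> (v (Suc i) (u (Suc i) x))"
      using u(3)[OF x] \<psi>(2)[OF uc[OF x]] by simp
    ultimately show ?thesis using c by (simp add: N.M.minus_eq N.M.a_lcomm N.M.r_neg)
  qed
  ultimately show "\<exists>\<psi> \<in> module_hom R (P i) N. \<forall>y \<in> carrier (P (Suc i)). \<psi> (d i y) = \<phi> y"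
    by (intro bexI[of _ ?\<chi>] ballI)
qed

section \<open>Exactness in the groups of extensional homomorphisms\<close>

lemma Hom_simps [simp]:
  "carrier (Hom R M N) = module_hom R M N \<inter> extensional (carrier M)"
  "zero (Hom R M N) = (\<lambda>x \<in> carrier M. \<zero>\<^bsub>N\<^esub>)"
  "add (Hom R M N) f g = (\<lambda>x \<in> carrier M. f x \<oplus>\<^bsub>N\<^esub> g x)"
  by (simp_all add: Hom_def)

lemma Hom_restrict:
  assumes "left_module R M" and "f \<in> module_hom R M N"
  shows "restrict f (carrier M) \<in> carrier (Hom R M N)"
  using module_hom_cong[OF assms, of "restrict f (carrier M)"] by simp

lemma abelian_group_Hom:
  assumes M: "left_module R M" and N: "left_module R N"
  shows "abelian_group (Hom R M N)"
proof -
  interpret N: left_module R N by fact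
  show ?thesis
  proof (rule abelian_groupI)
    show "f \<oplus>\<^bsub>Hom R M N\<^esub> g \<in> carrier (Hom R M N)" if "f \<in> carrier (Hom R M N)" "g \<in> carrier (Hom R M N)" for f g
      using Hom_restrict[OF M module_hom_add[OF N]] that by simp
    show "\<zero>\<^bsub>Hom R M N\<^esub> \<in> carrier (Hom R M N)"
      using Hom_restrict[OF M module_hom_const_zero[OF N]] by simp
    fix f assume f: "f \<in> carrier (Hom R M N)"
    have "(\<lambda>x \<in> carrier M. \<zero>\<^bsub>N\<^esub> \<ominus>\<^bsub>N\<^esub> f x) \<in> carrier (Hom R M N)"
      using Hom_restrict[OF M module_hom_diff[OF N module_hom_const_zero[OF N]]] f by simp
    then show "\<exists>g \<in> carrier (Hom R M N). g \<oplus>\<^bsub>Hom R M N\<^esub> f = \<zero>\<^bsub>Hom R M N\<^esub>"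
      by (rule bexI[rotated])
        (use f module_homD(1)[of f R M N] in \<open>auto simp: N.M.minus_eq N.M.l_neg intro!: restrict_ext\<close>)
  qed (auto simp: fun_eq_iff restrict_def module_homD(1) N.M.a_ac extensional_def)
qed

lemma pullback_hom:
  assumes "left_module R M" and "f \<in> module_hom R M N" and "g \<in> module_hom R N X"
  shows "pullback M f g \<in> carrier (Hom R M X)"
  using Hom_restrict[OF assms(1) module_hom_comp[OF assms(2,3)]] by (simp add: pullback_def compose_def)

text \<open>Restricting a homomorphism to the carrier passes from arbitrary representatives to
  elements of \<open>Hom\<close>. That the composite \<open>g\<close> after \<open>f\<close>
  vanishes accounts for the image lying in the kernel.\<close>

lemma exact_at_Hom_iff:
  assumes X: "left_module R X" and Y: "left_module R Y" and Z: "left_module R Z" and N: "left_module R N"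
    and f: "f \<in> module_hom R X Y" and g: "g \<in> module_hom R Y Z"
    and gf: "\<And>x. x \<in> carrier X \<Longrightarrow> g (f x) = \<zero>\<^bsub>Z\<^esub>"
  shows "exact_at (Hom R Z N) (pullback Y g) (Hom R Y N) (pullback X f) (Hom R X N) \<longleftrightarrow>
    coexact R N X f Y g Z"
    (is "?lhs \<longleftrightarrow> ?rhs")
proof
  have ker: "pullback X f \<phi> = \<zero>\<^bsub>Hom R X N\<^esub> \<longleftrightarrow> (\<forall>x \<in> carrier X. \<phi> (f x) = \<zero>\<^bsub>N\<^esub>)" for \<phi>
    by (auto simp: pullback_def compose_def fun_eq_iff)
  {
    assume lhs: ?lhs
    show ?rhs
    proof (rule coexactI)
      fix \<phi> assume \<phi>: "\<phi> \<in> module_hom R Y N" "\<And>x. x \<in> carrier X \<Longrightarrow> \<phi> (f x) = \<zero>\<^bsub>N\<^esub>"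
      let ?\<phi> = "restrict \<phi> (carrier Y)"
      have "?\<phi> \<in> carrier (Hom R Y N)" by (rule Hom_restrict[OF Y \<phi>(1)])
      moreover have "pullback X f ?\<phi> = \<zero>\<^bsub>Hom R X N\<^esub>"
        unfolding ker using \<phi>(2) module_homD(1)[OF f] by simp
      ultimately have "?\<phi> \<in> pullback Y g ` carrier (Hom R Z N)" by (rule exact_atD(2)[OF lhs])
      then obtain \<psi> where \<psi>: "\<psi> \<in> module_hom R Z N" "?\<phi> = pullback Y g \<psi>" by auto
      have "\<psi> (g y) = \<phi> y" if "y \<in> carrier Y" for y
        using fun_cong[OF \<psi>(2), of y] that by (simp add: pullback_def compose_def)
      with \<psi>(1) show "\<exists>\<psi> \<in> module_hom R Z N. \<forall>y \<in> carrier Y. \<psi> (g y) = \<phi> y" by blast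
    qed
  next
    assume rhs: ?rhs
    show ?lhs
      unfolding exact_at_iff ker
    proof (intro equalityI subsetI)
      fix \<phi> assume "\<phi> \<in> pullback Y g ` carrier (Hom R Z N)"
      then obtain \<psi> where \<psi>: "\<psi> \<in> module_hom R Z N" "\<phi> = pullback Y g \<psi>" by auto
      then show "\<phi> \<in> {\<phi> \<in> carrier (Hom R Y N). \<forall>x \<in> carrier X. \<phi> (f x) = \<zero>\<^bsub>N\<^esub>}"
        using pullback_hom[OF Y g \<psi>(1)] gf module_hom_zero[OF Z N \<psi>(1)] module_homD(1)[OF f]
        by (auto simp: pullback_def compose_def)
    next
      fix \<phi> assume \<phi>: "\<phi> \<in> {\<phi> \<in> carrier (Hom R Y N). \<forall>x \<in> carrier X. \<phi> (f x) = \<zero>\<^bsub>N\<^esub>}"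
      then obtain \<psi> where \<psi>: "\<psi> \<in> module_hom R Z N" "\<And>y. y \<in> carrier Y \<Longrightarrow> \<psi> (g y) = \<phi> y"
        using coexactD[OF rhs, of \<phi>] by auto
      have "\<phi> = pullback Y g (restrict \<psi> (carrier Z))"
        using \<phi> \<psi>(2) module_homD(1)[OF g]
        by (auto simp: pullback_def compose_def fun_eq_iff extensional_def)
      then show "\<phi> \<in> pullback Y g ` carrier (Hom R Z N)"
        using Hom_restrict[OF Z \<psi>(1)] by blast
    qed
  }
qed

text \<open>Every homomorphism kills the zero map, so exactness with zero on the left is
  surjectivity. In this form the first clause of \<open>hom_exact\<close> falls under the same
  transfer lemmas as the others; the zero endomorphism of \<open>Y\<close> avoids a separate zero
  module.\<close>

lemma surj_Hom_iff:
  assumes Y: "left_module R Y" and Z: "left_module R Z" and N: "left_module R N"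
    and g: "g \<in> module_hom R Y Z"
  shows "pullback Y g ` carrier (Hom R Z N) = carrier (Hom R Y N) \<longleftrightarrow>
    coexact R N Y (\<lambda>_. \<zero>\<^bsub>Y\<^esub>) Y g Z"
proof -
  have zero: "g \<zero>\<^bsub>Y\<^esub> = \<zero>\<^bsub>Z\<^esub>" by (rule module_hom_zero[OF Y Z g])
  have "pullback Y (\<lambda>_. \<zero>\<^bsub>Y\<^esub>) \<phi> = \<zero>\<^bsub>Hom R Y N\<^esub>" if "\<phi> \<in> carrier (Hom R Y N)" for \<phi>
    using that module_hom_zero[OF Y N] by (auto simp: pullback_def compose_def)
  then show ?thesis
    unfolding exact_at_Hom_iff[OF Y Y Z N module_hom_const_zero[OF Y] g zero, symmetric] exact_at_iff
    by blast
qed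

section \<open>Vanishing of cohomology as exactness\<close>

lemma (in normal) trivial_FactGroup_iff: "trivial_group (G Mod H) \<longleftrightarrow> H = carrier G"
proof
  assume "trivial_group (G Mod H)"
  then have eq: "carrier (G Mod H) = {H}" by (simp add: trivial_group_def)
  have "x \<in> H" if x: "x \<in> carrier G" for x
  proof -
    have "H #> x \<in> carrier (G Mod H)"
      unfolding FactGroup_def using rcosetsI[OF subset x] by simp
    then have "H #> x = H" using eq by blast
    then show ?thesis using rcos_self[OF x is_subgroup] by blast
  qed
  then show "H = carrier G" using subset by blast
next
  assume eq: "H = carrier G"
  have "H #> x = H" if "x \<in> carrier G" for x
    using rcos_const[OF is_group] that eq by blast
  then have "carrier (G Mod H) = {H}"
    using one_closed by (auto simp: FactGroup_def RCOSETS_def eq)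
  then show "trivial_group (G Mod H)"
    by (simp add: trivial_group_def factorgroup_is_group)
qed

lemma trivial_group_hom_cohomology_iff:
  assumes P: "\<And>n. left_module R (P n)" and N: "left_module R N"
    and d: "\<And>n. d n \<in> module_hom R (P (Suc n)) (P n)"
    and dd: "\<And>n x. x \<in> carrier (P (Suc (Suc n))) \<Longrightarrow> d n (d (Suc n) x) = \<zero>\<^bsub>P n\<^esub>"
  shows "trivial_group (hom_cohomology R P d N (Suc k)) \<longleftrightarrow>
    coexact R N (P (Suc (Suc k))) (d (Suc k)) (P (Suc k)) (d k) (P k)"
proof -
  let ?H = "Hom R (P (Suc k)) N"
  let ?K = "a_kernel ?H (Hom R (P (Suc (Suc k))) N) (pullback (P (Suc (Suc k))) (d (Suc k)))"
  let ?I = "pullback (P (Suc k)) (d k) ` carrier (Hom R (P k) N)"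
  interpret H: abelian_group ?H by (rule abelian_group_Hom[OF P N])
  have hom: "group_hom (add_monoid (Hom R (P n) N)) (add_monoid (Hom R (P (Suc n)) N)) (pullback (P (Suc n)) (d n))" for n
  proof -
    interpret A: abelian_group "Hom R (P n) N" by (rule abelian_group_Hom[OF P N])
    interpret B: abelian_group "Hom R (P (Suc n)) N" by (rule abelian_group_Hom[OF P N])
    show ?thesis
    proof (intro group_hom.intro group_hom_axioms.intro A.a_group B.a_group homI)
      show "pullback (P (Suc n)) (d n) f \<in> carrier (add_monoid (Hom R (P (Suc n)) N))"
        if "f \<in> carrier (add_monoid (Hom R (P n) N))" for f
        using that pullback_hom[OF P d] by auto
    qed (use module_homD(1)[OF d] in \<open>auto simp: pullback_def compose_def fun_eq_iff\<close>)
  qed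
  have K: "subgroup ?K (add_monoid ?H)"
    unfolding a_kernel_def by (rule group_hom.subgroup_kernel[OF hom])
  have I: "subgroup ?I (add_monoid ?H)"
    using group_hom.img_is_subgroup[OF hom] by simp
  have IK: "?I \<subseteq> ?K"
    using pullback_hom[OF P d] module_homD(1)[OF d] dd module_hom_zero[OF P N]
    by (auto simp: a_kernel_def' pullback_def compose_def fun_eq_iff)
  \<comment> \<open>The cocycles as a group of their own. It is commutative, so the coboundaries are
    normal in it, and the quotient is trivial exactly when they exhaust it.\<close>
  let ?G = "add_monoid (?H\<lparr>carrier := ?K\<rparr>)"
  have G: "comm_group ?G"
  proof (rule group.group_comm_groupI)
    show "group ?G" using subgroup.subgroup_is_group[OF K H.a_group] by simp
    show "x \<otimes>\<^bsub>?G\<^esub> y = y \<otimes>\<^bsub>?G\<^esub> x" if "x \<in> carrier ?G" "y \<in> carrier ?G" for x y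
      using that subgroup.subset[OF K] H.a_comm[of x y] by auto
  qed
  interpret G: comm_group ?G by (rule G)
  have "subgroup ?I ?G" using group.subgroup_incl[OF H.a_group I K IK] by simp
  then interpret nI: normal ?I ?G by (rule G.subgroup_imp_normal)
  have C: "hom_cohomology R P d N (Suc k) = ?G Mod ?I"
    by (simp add: hom_cohomology_def A_FactGroup_def)
  have "trivial_group (?G Mod ?I) \<longleftrightarrow> ?I = ?K"
    unfolding nI.trivial_FactGroup_iff by simp
  also have "?I = ?K \<longleftrightarrow> coexact R N (P (Suc (Suc k))) (d (Suc k)) (P (Suc k)) (d k) (P k)"
    using exact_at_Hom_iff[OF P P P N d d dd] by (simp add: exact_at_def)
  finally show ?thesis using C by simp
qed


section \<open>Restriction of scalars\<close>

lemma finsum_regular_module [simp]: "finsum (regular_module R) = finsum R"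
  by (intro ext) (simp add: finsum_def finprod_def)

lemma restrict_scalars_simps [simp]:
  "carrier (restrict_scalars \<iota> M) = carrier M"
  "zero (restrict_scalars \<iota> M) = zero M"
  "add (restrict_scalars \<iota> M) = add M"
  "smult (restrict_scalars \<iota> M) r x = \<iota> r \<odot>\<^bsub>M\<^esub> x"
  by (simp_all add: restrict_scalars_def)

lemma finsum_restrict_scalars [simp]: "finsum (restrict_scalars \<iota> M) = finsum M"
  by (intro ext) (simp add: finsum_def finprod_def)

lemma abelian_group_cong:
  assumes "abelian_group M" and "carrier N = carrier M" and "zero N = zero M" and "add N = add M"
  shows "abelian_group N"
proof -
  interpret M: abelian_group M by fact
  show ?thesis
  proof (rule abelian_groupI)
    show "\<exists>y \<in> carrier N. y \<oplus>\<^bsub>N\<^esub> x = \<zero>\<^bsub>N\<^esub>" if "x \<in> carrier N" for x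
      using that by (intro bexI[of _ "\<ominus>\<^bsub>M\<^esub> x"]) (simp_all add: assms M.l_neg)
  qed (simp_all add: assms M.a_ac)
qed

lemma left_module_restrict_scalars:
  fixes R :: "'r ring" and A :: "'a ring"
  assumes "left_module A M" and "ring R" and \<iota>: "\<iota> \<in> ring_hom R A"
  shows "left_module R (restrict_scalars \<iota> M)"
proof -
  interpret M: left_module A M by fact
  interpret R: ring R by fact
  have "abelian_group (restrict_scalars \<iota> M)"
    by (rule abelian_group_cong[OF M.M.abelian_group_axioms]) simp_all
  then show ?thesis
    using ring_hom_closed[OF \<iota>] ring_hom_add[OF \<iota>] ring_hom_mult[OF \<iota>] ring_hom_one[OF \<iota>]
    by (intro left_module.intro left_module_axioms.intro R.ring_axioms)
      (auto simp: M.smult_l_distr M.smult_r_distr M.smult_assoc1)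
qed

lemma module_hom_restrict_scalars:
  fixes R :: "'r ring" and A :: "'a ring"
  assumes "f \<in> module_hom A M N" and "\<iota> \<in> ring_hom R A"
  shows "f \<in> module_hom R (restrict_scalars \<iota> M) (restrict_scalars \<iota> N)"
  using module_homD[OF assms(1)] ring_hom_closed[OF assms(2)] by (intro module_homI) auto


section \<open>Coinduced modules over a Frobenius extension\<close>

definition coinduced :: "'r ring \<Rightarrow> 'a ring \<Rightarrow> ('r \<Rightarrow> 'a) \<Rightarrow> ('r, 'm) module \<Rightarrow> ('a, 'a \<Rightarrow> 'm) module" where
  "coinduced R A \<iota> M =
    \<lparr>carrier = carrier (Hom R (restrict_scalars \<iota> (regular_module A)) M), mult = undefined, one = undefined,
     zero = (\<lambda>x \<in> carrier A. \<zero>\<^bsub>M\<^esub>), add = (\<lambda>f g. \<lambda>x \<in> carrier A. f x \<oplus>\<^bsub>M\<^esub> g x),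
     smult = (\<lambda>a f. \<lambda>x \<in> carrier A. f (x \<otimes>\<^bsub>A\<^esub> a))\<rparr>"

text \<open>The result is kept extensional, so that equality in a coinduced module remains equality
  of functions.\<close>

definition coinduced_map :: "'a ring \<Rightarrow> ('m \<Rightarrow> 'n) \<Rightarrow> ('a \<Rightarrow> 'm) \<Rightarrow> 'a \<Rightarrow> 'n" where
  "coinduced_map A f h = (\<lambda>a \<in> carrier A. f (h a))"

lemma coinduced_simps [simp]:
  "zero (coinduced R A \<iota> M) = (\<lambda>x \<in> carrier A. \<zero>\<^bsub>M\<^esub>)"
  "add (coinduced R A \<iota> M) f g = (\<lambda>x \<in> carrier A. f x \<oplus>\<^bsub>M\<^esub> g x)"
  "smult (coinduced R A \<iota> M) a f = (\<lambda>x \<in> carrier A. f (x \<otimes>\<^bsub>A\<^esub> a))"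
  by (simp_all add: coinduced_def)

lemma coinduced_carrierI:
  assumes "\<And>a. a \<in> carrier A \<Longrightarrow> h a \<in> carrier M"
    and "\<And>a b. a \<in> carrier A \<Longrightarrow> b \<in> carrier A \<Longrightarrow> h (a \<oplus>\<^bsub>A\<^esub> b) = h a \<oplus>\<^bsub>M\<^esub> h b"
    and "\<And>r a. r \<in> carrier R \<Longrightarrow> a \<in> carrier A \<Longrightarrow> h (\<iota> r \<otimes>\<^bsub>A\<^esub> a) = r \<odot>\<^bsub>M\<^esub> h a"
    and "h \<in> extensional (carrier A)"
  shows "h \<in> carrier (coinduced R A \<iota> M)"
  using assms by (auto simp: coinduced_def intro!: module_homI)

lemma coinduced_carrierD:
  assumes "h \<in> carrier (coinduced R A \<iota> M)"
  shows "a \<in> carrier A \<Longrightarrow> h a \<in> carrier M"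
    and "a \<in> carrier A \<Longrightarrow> b \<in> carrier A \<Longrightarrow> h (a \<oplus>\<^bsub>A\<^esub> b) = h a \<oplus>\<^bsub>M\<^esub> h b"
    and "r \<in> carrier R \<Longrightarrow> a \<in> carrier A \<Longrightarrow> h (\<iota> r \<otimes>\<^bsub>A\<^esub> a) = r \<odot>\<^bsub>M\<^esub> h a"
    and "h \<in> extensional (carrier A)"
  using assms
    module_homD[of h R "restrict_scalars \<iota> (regular_module A)" M] by (auto simp: coinduced_def)

lemma coinduced_eqI:
  assumes "h \<in> carrier (coinduced R A \<iota> M)" and "k \<in> carrier (coinduced R A \<iota> M)"
    and "\<And>a. a \<in> carrier A \<Longrightarrow> h a = k a"
  shows "h = k"
  using assms(3) coinduced_carrierD(4)[OF assms(1)] coinduced_carrierD(4)[OF assms(2)]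
  by (rule extensionalityI[rotated 2])

locale ring_extension =
  R: ring R + A: ring A for R :: "'r ring" and A :: "'a ring" +
  fixes \<iota> :: "'r \<Rightarrow> 'a"
  assumes iota: "\<iota> \<in> ring_hom R A"
begin

lemmas iota_closed [simp] = ring_hom_closed[OF iota]
  and iota_mult = ring_hom_mult[OF iota]
  and iota_add = ring_hom_add[OF iota]
  and iota_one = ring_hom_one[OF iota]

abbreviation "res \<equiv> restrict_scalars \<iota>"
abbreviation "coind \<equiv> coinduced R A \<iota>"
abbreviation "cmap \<equiv> coinduced_map A"

lemmas left_module_res = left_module_restrict_scalars[OF _ R.ring_axioms iota]
lemmas res_hom = module_hom_restrict_scalars[OF _ iota]

lemma left_module_coind:
  assumes "left_module R M" shows "left_module A (coind M)"
proof -
  interpret M: left_module R M by fact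
  have "abelian_group (coind M)"
    by (rule abelian_group_cong[OF abelian_group_Hom[OF
            left_module_res[OF left_module_regular[OF A.ring_axioms]] assms]])
      (auto simp: coinduced_def Hom_def)
  moreover have cl: "a \<odot>\<^bsub>coind M\<^esub> h \<in> carrier (coind M)" if "a \<in> carrier A" "h \<in> carrier (coind M)" for a h
    by (rule coinduced_carrierI)
      (use that coinduced_carrierD[OF that(2)] in \<open>auto simp: A.l_distr A.m_assoc\<close>)
  moreover have "\<one>\<^bsub>A\<^esub> \<odot>\<^bsub>coind M\<^esub> h = h" if "h \<in> carrier (coind M)" for h
    by (rule coinduced_eqI[OF cl[OF _ that] that]) auto
  ultimately show ?thesis
    by (intro left_module.intro left_module_axioms.intro A.ring_axioms)
      (auto simp: coinduced_carrierD fun_eq_iff A.m_assoc A.r_distr)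
qed

lemma coind_finsum:
  assumes M: "left_module R M" and "finite I" and g: "g \<in> I \<rightarrow> carrier (coind M)" and a: "a \<in> carrier A"
  shows "finsum (coind M) g I a = finsum M (\<lambda>i. g i a) I"
  by (rule additive_finsum[where f = "\<lambda>h. h a"])
    (use assms left_module.axioms(2)[OF M] left_module.axioms(2)[OF left_module_coind[OF M]]
      in \<open>auto simp: coinduced_carrierD\<close>)

lemma cmap_hom:
  assumes "f \<in> module_hom R M N"
  shows "cmap f \<in> module_hom A (coind M) (coind N)"
proof (rule module_homI)
  note f = module_homD[OF assms]
  show "cmap f h \<in> carrier (coind N)" if "h \<in> carrier (coind M)" for h
    by (rule coinduced_carrierI) (use coinduced_carrierD[OF that] f in \<open>auto simp: coinduced_map_def\<close>)
qed (use module_homD[OF assms] in \<open>auto simp: coinduced_map_def coinduced_carrierD fun_eq_iff\<close>)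

end

text \<open>A Frobenius homomorphism with dual bases. \<open>dual_left\<close> exhibits A as a
  finitely generated projective left R-module with coordinate functionals a \<mapsto> E(a y_i), and
  \<open>dual_right\<close> is its mirror image. \<open>E_right\<close> is what later makes
  \<open>eta\<close> linear over R.\<close>

locale frobenius_system = ring_extension +
  fixes E :: "'b \<Rightarrow> 'a" and n :: nat and x y :: "nat \<Rightarrow> 'b"
  assumes E_closed [simp]: "a \<in> carrier A \<Longrightarrow> E a \<in> carrier R"
    and E_add: "a \<in> carrier A \<Longrightarrow> b \<in> carrier A \<Longrightarrow> E (a \<oplus>\<^bsub>A\<^esub> b) = E a \<oplus>\<^bsub>R\<^esub> E b"
    and E_left: "r \<in> carrier R \<Longrightarrow> a \<in> carrier A \<Longrightarrow> E (\<iota> r \<otimes>\<^bsub>A\<^esub> a) = r \<otimes>\<^bsub>R\<^esub> E a"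
    and E_right: "r \<in> carrier R \<Longrightarrow> a \<in> carrier A \<Longrightarrow> E (a \<otimes>\<^bsub>A\<^esub> \<iota> r) = E a \<otimes>\<^bsub>R\<^esub> r"
    and x_closed [simp]: "i < n \<Longrightarrow> x i \<in> carrier A"
    and y_closed [simp]: "i < n \<Longrightarrow> y i \<in> carrier A"
    and dual_left: "a \<in> carrier A \<Longrightarrow> finsum A (\<lambda>i. \<iota> (E (a \<otimes>\<^bsub>A\<^esub> y i)) \<otimes>\<^bsub>A\<^esub> x i) {..<n} = a"
    and dual_right: "a \<in> carrier A \<Longrightarrow> finsum A (\<lambda>i. y i \<otimes>\<^bsub>A\<^esub> \<iota> (E (x i \<otimes>\<^bsub>A\<^esub> a))) {..<n} = a"

text \<open>With \<open>\<phi>\<close> the given bimodule isomorphism, \<open>E = \<phi>(1)\<close>; the \<open>x\<^sub>i\<close> generate \<open>A\<close> over \<open>R\<close> and the \<open>y\<^sub>i\<close>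
  are the \<open>\<phi>\<close>-preimages of the coordinate functions.  The second dual basis identity follows by
  applying \<open>\<phi>\<close> and using the first.\<close>

lemma frobenius_extension_system:
  assumes "frobenius_extension R A \<iota>"
  obtains E n x y where "frobenius_system R A \<iota> E n x y"
proof -
  let ?A = "restrict_scalars \<iota> (regular_module A)" and ?R = "regular_module R"
  obtain \<phi> where "ring R" and "ring A" and iota: "\<iota> \<in> ring_hom R A"
    and fg: "fin_gen_module R ?A" and proj: "projective_module R ?A"
    and bij: "bij_betw \<phi> (carrier A) (carrier (Hom R ?A ?R))"
    and left: "\<And>a b. a \<in> carrier A \<Longrightarrow> b \<in> carrier A \<Longrightarrow>
      \<phi> (a \<otimes>\<^bsub>A\<^esub> b) = (\<lambda>x \<in> carrier A. \<phi> b (x \<otimes>\<^bsub>A\<^esub> a))"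
    and right: "\<And>b r. b \<in> carrier A \<Longrightarrow> r \<in> carrier R \<Longrightarrow>
      \<phi> (b \<otimes>\<^bsub>A\<^esub> \<iota> r) = (\<lambda>x \<in> carrier A. \<phi> b x \<otimes>\<^bsub>R\<^esub> r)"
    using assms unfolding frobenius_extension_def Let_def by blast
  interpret R: ring R by fact
  interpret A: ring A by fact
  interpret ring_extension R A \<iota> by unfold_locales (rule iota)
  obtain n :: nat and f z where f: "\<And>k. k < n \<Longrightarrow> f k \<in> module_hom R ?A ?R"
    and z: "\<And>k. k < n \<Longrightarrow> z k \<in> carrier ?A"
    and fz: "\<And>a. a \<in> carrier ?A \<Longrightarrow> finsum ?A (\<lambda>k. f k a \<odot>\<^bsub>?A\<^esub> z k) {..<n} = a"
    using in_add_regular_expansion[OF R.ring_axioms fin_gen_projective_in_add_regular[OF fg proj]]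
    by blast
  define E where "E = \<phi> \<one>\<^bsub>A\<^esub>"
  have E: "E \<in> module_hom R ?A ?R"
    using bij_betwE[OF bij] unfolding E_def by auto
  note E' = module_homD[OF E, simplified]
  \<comment> \<open>Left linearity, applied to a product with one, recovers \<open>\<phi>\<close>
    from \<open>E\<close>.\<close>
  have \<phi>E: "\<phi> a c = E (c \<otimes>\<^bsub>A\<^esub> a)" if "a \<in> carrier A" "c \<in> carrier A" for a c
    using left[of a "\<one>\<^bsub>A\<^esub>"] that by (simp add: E_def)
  have E_right: "E (a \<otimes>\<^bsub>A\<^esub> \<iota> r) = E a \<otimes>\<^bsub>R\<^esub> r" if "r \<in> carrier R" "a \<in> carrier A" for r a
    using \<phi>E[of "\<iota> r" a] right[of "\<one>\<^bsub>A\<^esub>" r] that by (simp add: E_def)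
  have "\<exists>y. y \<in> carrier A \<and> \<phi> y = restrict (f k) (carrier A)" if "k < n" for k
  proof -
    have "restrict (f k) (carrier ?A) \<in> carrier (Hom R ?A ?R)"
      by (rule Hom_restrict[OF projective_left_module[OF proj] f[OF that]])
    then have "restrict (f k) (carrier A) \<in> \<phi> ` carrier A"
      using bij by (simp add: bij_betw_def)
    then show ?thesis by (metis imageE)
  qed
  then obtain y where y: "\<And>k. k < n \<Longrightarrow> y k \<in> carrier A"
      "\<And>k. k < n \<Longrightarrow> \<phi> (y k) = restrict (f k) (carrier A)" by metis
  have fE: "f k a = E (a \<otimes>\<^bsub>A\<^esub> y k)" if "k < n" "a \<in> carrier A" for k a
    using \<phi>E[OF y(1) that(2)] y(2) that by simp
  have dual_left: "finsum A (\<lambda>i. \<iota> (E (a \<otimes>\<^bsub>A\<^esub> y i)) \<otimes>\<^bsub>A\<^esub> z i) {..<n} = a" if a: "a \<in> carrier A" for a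
  proof -
    have "finsum A (\<lambda>i. \<iota> (E (a \<otimes>\<^bsub>A\<^esub> y i)) \<otimes>\<^bsub>A\<^esub> z i) {..<n} = finsum A (\<lambda>k. \<iota> (f k a) \<otimes>\<^bsub>A\<^esub> z k) {..<n}"
      by (rule A.finsum_cong') (use a y z E' fE in auto)
    then show ?thesis using fz a by simp
  qed
  have dual_right: "finsum A (\<lambda>i. y i \<otimes>\<^bsub>A\<^esub> \<iota> (E (z i \<otimes>\<^bsub>A\<^esub> a))) {..<n} = a" (is "?s = a") if a: "a \<in> carrier A" for a
  proof -
    have sc: "?s \<in> carrier A"
      by (rule A.finsum_closed) (use a y z E' in auto)
    \<comment> \<open>As \<open>\<phi>\<close> is injective, the two sides are compared as
      functionals, at each point \<open>c\<close>.\<close>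
    have "\<phi> ?s c = \<phi> a c" if c: "c \<in> carrier A" for c
    proof -
      let ?t = "\<lambda>i. \<iota> (E (c \<otimes>\<^bsub>A\<^esub> y i)) \<otimes>\<^bsub>A\<^esub> z i"
      have t: "?t \<in> {..<n} \<rightarrow> carrier A" using c y z E' by auto
      have add: "(\<lambda>b. E (c \<otimes>\<^bsub>A\<^esub> b)) \<in> carrier A \<rightarrow> carrier R"
        "(\<lambda>b. E (b \<otimes>\<^bsub>A\<^esub> a)) \<in> carrier A \<rightarrow> carrier R"
        using a c E' by auto
      have "E (c \<otimes>\<^bsub>A\<^esub> ?s) = finsum R (\<lambda>i. E (c \<otimes>\<^bsub>A\<^esub> (y i \<otimes>\<^bsub>A\<^esub> \<iota> (E (z i \<otimes>\<^bsub>A\<^esub> a))))) {..<n}"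
        by (rule additive_finsum[OF A.abelian_group_axioms R.abelian_group_axioms add(1)])
          (use a c y z E' in \<open>auto simp: A.r_distr\<close>)
      also have "\<dots> = finsum R (\<lambda>i. E (?t i \<otimes>\<^bsub>A\<^esub> a)) {..<n}"
      proof (rule R.finsum_cong')
        show "(\<lambda>i. E (?t i \<otimes>\<^bsub>A\<^esub> a)) \<in> {..<n} \<rightarrow> carrier R" using a E'(1) funcset_mem[OF t] by auto
        fix i assume "i \<in> {..<n}"
        then have yz: "y i \<in> carrier A" "z i \<in> carrier A" using y z by auto
        \<comment> \<open>The scalar E(z_i a) leaves \<open>E\<close> by right linearity, then E(c
          y_i) enters by left linearity. After summation the first dual basis identity can be
          applied to \<open>c\<close>.\<close>
        have "E (c \<otimes>\<^bsub>A\<^esub> (y i \<otimes>\<^bsub>A\<^esub> \<iota> (E (z i \<otimes>\<^bsub>A\<^esub> a)))) = E (c \<otimes>\<^bsub>A\<^esub> y i) \<otimes>\<^bsub>R\<^esub> E (z i \<otimes>\<^bsub>A\<^esub> a)"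
          using yz a c E'(1) by (simp add: E_right flip: A.m_assoc)
        also have "\<dots> = E (?t i \<otimes>\<^bsub>A\<^esub> a)"
          using yz a c E'(1,3) by (simp add: A.m_assoc)
        finally show "E (c \<otimes>\<^bsub>A\<^esub> (y i \<otimes>\<^bsub>A\<^esub> \<iota> (E (z i \<otimes>\<^bsub>A\<^esub> a)))) = E (?t i \<otimes>\<^bsub>A\<^esub> a)" .
      qed simp
      also have "\<dots> = E (finsum A ?t {..<n} \<otimes>\<^bsub>A\<^esub> a)"
        by (rule additive_finsum[OF A.abelian_group_axioms R.abelian_group_axioms add(2), symmetric])
          (use a c t E' in \<open>auto simp: A.l_distr\<close>)
      also have "finsum A ?t {..<n} = c" by (rule dual_left[OF c])
      finally show ?thesis using \<phi>E[OF sc c] \<phi>E[OF a c] by simp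
    qed
    moreover have "\<phi> ?s \<in> carrier (Hom R ?A ?R)" "\<phi> a \<in> carrier (Hom R ?A ?R)"
      using bij_betwE[OF bij] sc a by auto
    ultimately have "\<phi> ?s = \<phi> a"
      by (intro extensionalityI[of _ "carrier A"]) auto
    then show ?thesis using bij sc a by (auto simp: bij_betw_def inj_on_def)
  qed
  have "frobenius_system R A \<iota> E n z y"
    by unfold_locales (use E' E_right y z dual_left dual_right in auto)
  then show ?thesis by (rule that)
qed

context frobenius_system
begin

text \<open>\<open>eta\<close> corresponds to \<open>m \<mapsto> 1 \<otimes> m\<close>, and \<open>adj Z u\<close> is the \<open>A\<close>-linear map \<open>a \<otimes> m \<mapsto> a u(m)\<close>, computed
  from the expansion \<open>h = \<Sum> y\<^sub>i (1 \<otimes> h(x\<^sub>i))\<close>.\<close>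

definition eta :: "('a, 'm) module \<Rightarrow> 'm \<Rightarrow> 'b \<Rightarrow> 'm" where
  "eta M m = (\<lambda>a \<in> carrier A. E a \<odot>\<^bsub>M\<^esub> m)"

definition adj :: "('b, 'z) module \<Rightarrow> ('m \<Rightarrow> 'z) \<Rightarrow> ('b \<Rightarrow> 'm) \<Rightarrow> 'z" where
  "adj Z u h = finsum Z (\<lambda>i. y i \<odot>\<^bsub>Z\<^esub> u (h (x i))) {..<n}"

text \<open>Compatibility with scalars rests on right linearity of \<open>E\<close>: E(a) r = E(a
  \<iota>(r)), where the right-hand side is the value at \<open>a\<close> after the action of
  \<iota>(r).\<close>

lemma eta_hom:
  assumes "left_module R M"
  shows "eta M \<in> module_hom R M (res (coind M))"
proof -
  interpret M: left_module R M by fact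
  show ?thesis
  proof (rule module_homI)
    show "eta M m \<in> carrier (res (coind M))" if "m \<in> carrier M" for m
      unfolding restrict_scalars_simps
      by (rule coinduced_carrierI)
        (use that in \<open>auto simp: eta_def E_add E_left M.smult_l_distr M.smult_assoc1\<close>)
  qed (auto simp: eta_def fun_eq_iff M.smult_r_distr E_right M.smult_assoc1)
qed

lemma eta_closed: "left_module R M \<Longrightarrow> m \<in> carrier M \<Longrightarrow> eta M m \<in> carrier (coind M)"
  using module_homD(1)[OF eta_hom] by simp

text \<open>At a point \<open>a\<close> the sum has terms E(a y_i) h(x_i). Linearity of
  \<open>h\<close> moves the scalars into the argument, where \<open>dual_left\<close> restores
  \<open>a\<close>.\<close>

lemma coind_expansion:
  assumes M: "left_module R M" and h: "h \<in> carrier (coind M)"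
  shows "adj (coind M) (eta M) h = h"
proof (rule coinduced_eqI[OF _ h])
  interpret M: left_module R M by fact
  interpret F: left_module A "coind M" by (rule left_module_coind[OF M])
  note h' = coinduced_carrierD[OF h]
  have c: "(\<lambda>i. y i \<odot>\<^bsub>coind M\<^esub> eta M (h (x i))) \<in> {..<n} \<rightarrow> carrier (coind M)"
    using eta_closed[OF M] h' by (auto simp del: coinduced_simps)
  then show "adj (coind M) (eta M) h \<in> carrier (coind M)"
    unfolding adj_def by (rule F.M.finsum_closed)
  fix a assume a: "a \<in> carrier A"
  have "adj (coind M) (eta M) h a = finsum M (\<lambda>i. (y i \<odot>\<^bsub>coind M\<^esub> eta M (h (x i))) a) {..<n}"
    unfolding adj_def by (rule coind_finsum[OF M finite_lessThan c a])
  also have "\<dots> = finsum M (\<lambda>i. h (\<iota> (E (a \<otimes>\<^bsub>A\<^esub> y i)) \<otimes>\<^bsub>A\<^esub> x i)) {..<n}"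
    by (rule M.M.finsum_cong') (use a h' in \<open>auto simp: eta_def\<close>)
  also have "\<dots> = h (finsum A (\<lambda>i. \<iota> (E (a \<otimes>\<^bsub>A\<^esub> y i)) \<otimes>\<^bsub>A\<^esub> x i) {..<n})"
    by (rule additive_finsum[OF A.abelian_group_axioms M.M.abelian_group_axioms, symmetric])
      (use a h' in auto)
  also have "\<dots> = h a" by (simp add: dual_left[OF a])
  finally show "adj (coind M) (eta M) h a = h a" .
qed

text \<open>At x_i the given element takes the value E(x_i b) m. Linearity of \<open>u\<close> moves
  this scalar next to y_i, and \<open>dual_right\<close> sums the products to
  \<open>b\<close>.\<close>

lemma adj_smult_eta:
  assumes M: "left_module R M" and Z: "left_module A Z" and u: "u \<in> module_hom R M (res Z)"
    and b: "b \<in> carrier A" and m: "m \<in> carrier M"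
  shows "adj Z u (b \<odot>\<^bsub>coind M\<^esub> eta M m) = b \<odot>\<^bsub>Z\<^esub> u m"
proof -
  interpret M: left_module R M by fact
  interpret Z: left_module A Z by fact
  note u' = module_homD[OF u, simplified]
  have "adj Z u (b \<odot>\<^bsub>coind M\<^esub> eta M m) = finsum Z (\<lambda>i. (y i \<otimes>\<^bsub>A\<^esub> \<iota> (E (x i \<otimes>\<^bsub>A\<^esub> b))) \<odot>\<^bsub>Z\<^esub> u m) {..<n}"
    unfolding adj_def
    by (rule Z.M.finsum_cong') (use b m u' in \<open>auto simp: eta_def Z.smult_assoc1\<close>)
  also have "\<dots> = finsum A (\<lambda>i. y i \<otimes>\<^bsub>A\<^esub> \<iota> (E (x i \<otimes>\<^bsub>A\<^esub> b))) {..<n} \<odot>\<^bsub>Z\<^esub> u m"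
    by (rule additive_finsum[where f = "\<lambda>c. c \<odot>\<^bsub>Z\<^esub> u m",
          OF A.abelian_group_axioms Z.M.abelian_group_axioms, symmetric])
      (use b m u' in \<open>auto simp: Z.smult_l_distr\<close>)
  also have "\<dots> = b \<odot>\<^bsub>Z\<^esub> u m" by (simp add: dual_right[OF b])
  finally show ?thesis .
qed

text \<open>The defining formula does not display linearity over A. Expanding \<open>h\<close>
  before multiplying by \<open>a\<close> leaves only multiples of elements in the image of
  \<open>eta\<close>, whose values \<open>adj_smult_eta\<close> provides.\<close>

lemma adj_hom:
  assumes M: "left_module R M" and Z: "left_module A Z" and u: "u \<in> module_hom R M (res Z)"
  shows "adj Z u \<in> module_hom A (coind M) Z"
proof -
  interpret M: left_module R M by fact
  interpret Z: left_module A Z by fact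
  interpret F: left_module A "coind M" by (rule left_module_coind[OF M])
  note u' = module_homD[OF u, simplified]
  have closed: "adj Z u h \<in> carrier Z" if "h \<in> carrier (coind M)" for h
    unfolding adj_def using coinduced_carrierD[OF that] u' by (intro Z.M.finsum_closed) auto
  have add: "adj Z u (h \<oplus>\<^bsub>coind M\<^esub> k) = adj Z u h \<oplus>\<^bsub>Z\<^esub> adj Z u k"
    if "h \<in> carrier (coind M)" "k \<in> carrier (coind M)" for h k
  proof -
    note h = coinduced_carrierD[OF that(1)] and k = coinduced_carrierD[OF that(2)]
    have "adj Z u (h \<oplus>\<^bsub>coind M\<^esub> k) =
        finsum Z (\<lambda>i. y i \<odot>\<^bsub>Z\<^esub> u (h (x i)) \<oplus>\<^bsub>Z\<^esub> y i \<odot>\<^bsub>Z\<^esub> u (k (x i))) {..<n}"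
      unfolding adj_def by (rule Z.M.finsum_cong') (use h k u' in \<open>auto simp: Z.smult_r_distr\<close>)
    also have "\<dots> = adj Z u h \<oplus>\<^bsub>Z\<^esub> adj Z u k"
      unfolding adj_def by (rule Z.M.finsum_addf) (use h k u' in auto)
    finally show ?thesis .
  qed
  show ?thesis
  proof (rule module_homI)
    show "adj Z u h \<in> carrier Z" if "h \<in> carrier (coind M)" for h by (rule closed[OF that])
    show "adj Z u (h \<oplus>\<^bsub>coind M\<^esub> k) = adj Z u h \<oplus>\<^bsub>Z\<^esub> adj Z u k"
      if "h \<in> carrier (coind M)" "k \<in> carrier (coind M)" for h k by (rule add[OF that])
    fix a h assume a: "a \<in> carrier A" and h: "h \<in> carrier (coind M)"
    note h' = coinduced_carrierD[OF h]
    have e: "eta M (h (x i)) \<in> carrier (coind M)" if "i < n" for i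
      using eta_closed[OF M] h' that by simp
    have "a \<odot>\<^bsub>coind M\<^esub> h = a \<odot>\<^bsub>coind M\<^esub> adj (coind M) (eta M) h"
      by (simp only: coind_expansion[OF M h])
    also have "\<dots> = finsum (coind M) (\<lambda>i. a \<odot>\<^bsub>coind M\<^esub> (y i \<odot>\<^bsub>coind M\<^esub> eta M (h (x i)))) {..<n}"
      unfolding adj_def by (rule F.finsum_smult) (use a e in \<open>auto simp del: coinduced_simps\<close>)
    also have "\<dots> = finsum (coind M) (\<lambda>i. (a \<otimes>\<^bsub>A\<^esub> y i) \<odot>\<^bsub>coind M\<^esub> eta M (h (x i))) {..<n}"
      by (rule F.M.finsum_cong') (use a e in \<open>auto simp: F.smult_assoc1 simp del: coinduced_simps\<close>)
    finally have "adj Z u (a \<odot>\<^bsub>coind M\<^esub> h) =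
        adj Z u (finsum (coind M) (\<lambda>i. (a \<otimes>\<^bsub>A\<^esub> y i) \<odot>\<^bsub>coind M\<^esub> eta M (h (x i))) {..<n})"
      by simp
    also have "\<dots> = finsum Z (\<lambda>i. adj Z u ((a \<otimes>\<^bsub>A\<^esub> y i) \<odot>\<^bsub>coind M\<^esub> eta M (h (x i)))) {..<n}"
      by (rule additive_finsum[OF F.M.abelian_group_axioms Z.M.abelian_group_axioms])
        (use a e closed add in \<open>auto simp del: coinduced_simps\<close>)
    also have "\<dots> = finsum Z (\<lambda>i. a \<odot>\<^bsub>Z\<^esub> (y i \<odot>\<^bsub>Z\<^esub> u (h (x i)))) {..<n}"
      by (rule Z.M.finsum_cong')
        (use a h' u' in \<open>auto simp: adj_smult_eta[OF M Z u] Z.smult_assoc1 simp del: coinduced_simps\<close>)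
    also have "\<dots> = a \<odot>\<^bsub>Z\<^esub> adj Z u h"
      unfolding adj_def by (rule Z.finsum_smult[symmetric]) (use a h' u' in auto)
    finally show "adj Z u (a \<odot>\<^bsub>coind M\<^esub> h) = a \<odot>\<^bsub>Z\<^esub> adj Z u h" .
  qed
qed

text \<open>The uniqueness half of the adjunction: by the expansion, multiples of elements in the
  image of \<open>eta\<close> generate, so their values determine \<open>\<phi>\<close>.\<close>

lemma hom_eq_adj:
  assumes M: "left_module R M" and Z: "left_module A Z" and \<phi>: "\<phi> \<in> module_hom A (coind M) Z"
    and h: "h \<in> carrier (coind M)"
  shows "adj Z (\<lambda>m. \<phi> (eta M m)) h = \<phi> h"
proof -
  interpret Z: left_module A Z by fact
  interpret F: left_module A "coind M" by (rule left_module_coind[OF M])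
  note h' = coinduced_carrierD[OF h]
  have e: "eta M (h (x i)) \<in> carrier (coind M)" if "i < n" for i
    using eta_closed[OF M] h' that by simp
  have "\<phi> h = \<phi> (adj (coind M) (eta M) h)" by (simp add: coind_expansion[OF M h])
  also have "\<dots> = finsum Z (\<lambda>i. \<phi> (y i \<odot>\<^bsub>coind M\<^esub> eta M (h (x i)))) {..<n}"
    unfolding adj_def by (rule module_hom_finsum[OF F.left_module_axioms Z \<phi>])
      (use e in \<open>auto simp del: coinduced_simps\<close>)
  also have "\<dots> = adj Z (\<lambda>m. \<phi> (eta M m)) h"
    unfolding adj_def by (rule Z.M.finsum_cong')
      (use e module_homD[OF \<phi>] in \<open>auto simp del: coinduced_simps\<close>)
  finally show ?thesis ..
qed

section \<open>Coinduction preserves exactness, Hom-exactness, projectivity and add\<close>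

lemma cmap_eta:
  "f \<in> module_hom R M N \<Longrightarrow> m \<in> carrier M \<Longrightarrow> cmap f (eta M m) = eta N (f m)"
  by (auto simp: coinduced_map_def eta_def module_homD)

text \<open>The nontrivial half of exactness, due to A being finitely generated projective.
  Preimages are picked for the finitely many values h(x_i) and recombined as in the expansion;
  naturality of \<open>eta\<close> shows that the result maps to \<open>h\<close>.\<close>

lemma cmap_image:
  assumes M: "left_module R M" and N: "left_module R N" and f: "f \<in> module_hom R M N"
    and h: "h \<in> carrier (coind N)" and im: "\<And>a. a \<in> carrier A \<Longrightarrow> h a \<in> f ` carrier M"
  shows "h \<in> cmap f ` carrier (coind M)"
proof -
  interpret F: left_module A "coind M" by (rule left_module_coind[OF M])
  interpret G: left_module A "coind N" by (rule left_module_coind[OF N])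
  note h' = coinduced_carrierD[OF h]
  have "\<exists>l. l \<in> carrier M \<and> f l = h (x i)" if "i < n" for i
    using im[of "x i"] that by (metis imageE x_closed)
  then obtain l where l: "\<And>i. i < n \<Longrightarrow> l i \<in> carrier M" "\<And>i. i < n \<Longrightarrow> f (l i) = h (x i)" by metis
  let ?k = "finsum (coind M) (\<lambda>i. y i \<odot>\<^bsub>coind M\<^esub> eta M (l i)) {..<n}"
  have e: "eta M (l i) \<in> carrier (coind M)" if "i < n" for i
    using eta_closed[OF M l(1)[OF that]] .
  have "cmap f ?k = finsum (coind N) (\<lambda>i. cmap f (y i \<odot>\<^bsub>coind M\<^esub> eta M (l i))) {..<n}"
    by (rule module_hom_finsum[OF F.left_module_axioms G.left_module_axioms cmap_hom[OF f]])
      (use e in \<open>auto simp del: coinduced_simps\<close>)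
  also have "\<dots> = adj (coind N) (eta N) h"
    unfolding adj_def
    by (rule G.M.finsum_cong')
      (use e l h' eta_closed[OF N] module_homD(3)[OF cmap_hom[OF f]] cmap_eta[OF f] in \<open>auto simp del: coinduced_simps\<close>)
  also have "\<dots> = h" by (rule coind_expansion[OF N h])
  finally have "cmap f ?k = h" .
  moreover have "?k \<in> carrier (coind M)"
    by (rule F.M.finsum_closed) (use e in \<open>auto simp del: coinduced_simps\<close>)
  ultimately show ?thesis by blast
qed

text \<open>The kernel of a coinduced map is found point by point; \<open>cmap_image\<close> turns
  pointwise preimages into one linear preimage.\<close>

lemma cmap_exact_at:
  assumes L: "left_module R L" and M: "left_module R M"
    and f: "f \<in> module_hom R L M" and ex: "exact_at L f M g N"
  shows "exact_at (coind L) (cmap f) (coind M) (cmap g) (coind N)"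
  unfolding exact_at_iff
proof (intro equalityI subsetI)
  fix h assume "h \<in> cmap f ` carrier (coind L)"
  then obtain k where k: "k \<in> carrier (coind L)" "h = cmap f k" by blast
  moreover have "cmap g (cmap f k) = \<zero>\<^bsub>coind N\<^esub>"
    using exact_atD(1)[OF ex] coinduced_carrierD(1)[OF k(1)] by (auto simp: coinduced_map_def)
  ultimately show "h \<in> {h \<in> carrier (coind M). cmap g h = \<zero>\<^bsub>coind N\<^esub>}"
    using module_homD(1)[OF cmap_hom[OF f] k(1)] by simp
next
  fix h assume h: "h \<in> {h \<in> carrier (coind M). cmap g h = \<zero>\<^bsub>coind N\<^esub>}"
  show "h \<in> cmap f ` carrier (coind L)"
  proof (rule cmap_image[OF L M f])
    fix a assume a: "a \<in> carrier A"
    have "cmap g h a = \<zero>\<^bsub>coind N\<^esub> a" using h by simp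
    then have "g (h a) = \<zero>\<^bsub>N\<^esub>" using a by (simp add: coinduced_map_def)
    then show "h a \<in> f ` carrier L"
      by (rule exact_atD(2)[OF ex coinduced_carrierD(1)[OF _ a], rotated]) (use h in blast)
  qed (use h in blast)
qed

text \<open>The adjunction at work: composing with \<open>eta\<close> turns the extension problem
  over A into one over R, and \<open>adj\<close> carries its solution back.\<close>

lemma cmap_coexact:
  assumes X: "left_module R X" and Y: "left_module R Y" and Z: "left_module R Z" and N: "left_module A N"
    and f: "f \<in> module_hom R X Y" and g: "g \<in> module_hom R Y Z"
    and coex: "coexact R (res N) X f Y g Z"
  shows "coexact A N (coind X) (cmap f) (coind Y) (cmap g) (coind Z)"
proof (rule coexactI)
  interpret N: left_module A N by fact
  fix \<phi> assume \<phi>: "\<phi> \<in> module_hom A (coind Y) N"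
    and \<phi>f: "\<And>h. h \<in> carrier (coind X) \<Longrightarrow> \<phi> (cmap f h) = \<zero>\<^bsub>N\<^esub>"
  have "(\<lambda>m. \<phi> (eta Y m)) \<in> module_hom R Y (res N)"
    by (rule module_hom_comp[OF eta_hom[OF Y] res_hom[OF \<phi>]])
  moreover have "\<phi> (eta Y (f m)) = \<zero>\<^bsub>res N\<^esub>" if "m \<in> carrier X" for m
    using \<phi>f[OF eta_closed[OF X that]] cmap_eta[OF f that] by simp
  ultimately obtain \<psi> where \<psi>: "\<psi> \<in> module_hom R Z (res N)"
      "\<And>m. m \<in> carrier Y \<Longrightarrow> \<psi> (g m) = \<phi> (eta Y m)"
    using coexactD[OF coex] by blast
  have "adj N \<psi> (cmap g h) = \<phi> h" if h: "h \<in> carrier (coind Y)" for h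
  proof -
    note h' = coinduced_carrierD[OF h]
    have "adj N \<psi> (cmap g h) = adj N (\<lambda>m. \<phi> (eta Y m)) h"
      unfolding adj_def coinduced_map_def
      by (rule N.M.finsum_cong') (use h' \<psi> eta_closed[OF Y] module_homD(1)[OF \<phi>] in auto)
    then show ?thesis using hom_eq_adj[OF Y N \<phi> h] by simp
  qed
  with adj_hom[OF Z N \<psi>(1)]
  show "\<exists>\<psi> \<in> module_hom A (coind Z) N. \<forall>h \<in> carrier (coind Y). \<psi> (cmap g h) = \<phi> h" by blast
qed

text \<open>The left adjoint of an exact functor preserves projectives: \<open>eta\<close> lifts
  over R through a free cover of the coinduced module, and the adjoint of this lift splits the
  cover.\<close>

lemma coind_projective:
  assumes P: "projective_module R P"
  shows "projective_module A (coind P)"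
proof -
  note lP = projective_left_module[OF P]
  note lF = left_module_coind[OF lP]
  let ?C = "free_module A (carrier (coind P))" and ?\<pi> = "lin_comb (coind P) A (carrier (coind P)) (\<lambda>x. x)"
  have C: "left_module A ?C" by (rule left_module_free[OF A.ring_axioms])
  interpret F: left_module A "coind P" by (rule lF)
  have \<pi>: "?\<pi> \<in> module_hom A ?C (coind P)" by (rule lin_comb_hom[OF lF]) auto
  have "?\<pi> ` carrier ?C = carrier (coind P)" by (rule lin_comb_image[OF lF]) auto
  then have "eta P ` carrier P \<subseteq> ?\<pi> ` carrier (res ?C)"
    using eta_closed[OF lP] by (simp del: free_module_simps) blast
  then obtain s where s: "s \<in> module_hom R P (res ?C)" "\<And>m. m \<in> carrier P \<Longrightarrow> ?\<pi> (s m) = eta P m"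
    using projective_lift[OF P left_module_res[OF C] left_module_res[OF lF] res_hom[OF \<pi>] eta_hom[OF lP]]
    by blast
  show ?thesis
  proof (rule projective_moduleI[OF lF adj_hom[OF lP C s(1)]])
    fix h assume h: "h \<in> carrier (coind P)"
    note h' = coinduced_carrierD[OF h]
    interpret C: left_module A ?C by (rule C)
    have s': "s m \<in> carrier ?C" if "m \<in> carrier P" for m
      using module_homD(1)[OF s(1) that] by simp
    have "?\<pi> (adj ?C s h) = finsum (coind P) (\<lambda>i. ?\<pi> (y i \<odot>\<^bsub>?C\<^esub> s (h (x i)))) {..<n}"
      unfolding adj_def
      by (rule module_hom_finsum[OF C lF \<pi>]) (use s' h' in \<open>auto simp del: free_module_simps\<close>)
    also have "\<dots> = adj (coind P) (eta P) h"
      unfolding adj_def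
      by (rule F.M.finsum_cong')
        (use s' s(2) h' eta_closed[OF lP] module_homD(3)[OF \<pi>] in \<open>auto simp del: free_module_simps coinduced_simps\<close>)
    also have "\<dots> = h" by (rule coind_expansion[OF lP h])
    finally show "?\<pi> (adj ?C s h) = h" .
  qed
qed

text \<open>The inverse \<open>g\<close> enters as an additive map with prescribed values, which is
  what the universal property of a tensor product of abelian groups supplies. That \<open>g\<close>
  undoes \<open>adj Z u\<close> then follows from the expansion.\<close>

lemma adj_iso:
  assumes M: "left_module R M" and Z: "left_module A Z" and u: "u \<in> module_hom R M (res Z)"
    and g: "g \<in> carrier Z \<rightarrow> carrier (coind M)"
    and add: "\<And>z w. z \<in> carrier Z \<Longrightarrow> w \<in> carrier Z \<Longrightarrow> g (z \<oplus>\<^bsub>Z\<^esub> w) = g z \<oplus>\<^bsub>coind M\<^esub> g w"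
    and gu: "\<And>a m. a \<in> carrier A \<Longrightarrow> m \<in> carrier M \<Longrightarrow> g (a \<odot>\<^bsub>Z\<^esub> u m) = a \<odot>\<^bsub>coind M\<^esub> eta M m"
    and right_inv: "\<And>z. z \<in> carrier Z \<Longrightarrow> adj Z u (g z) = z"
  shows "adj Z u \<in> module_iso A (coind M) Z"
proof -
  interpret Z: left_module A Z by fact
  interpret F: left_module A "coind M" by (rule left_module_coind[OF M])
  note hom = adj_hom[OF M Z u]
  have "g (adj Z u h) = h" if h: "h \<in> carrier (coind M)" for h
  proof -
    note h' = coinduced_carrierD[OF h] and u' = module_homD[OF u, simplified]
    have "g (adj Z u h) = finsum (coind M) (\<lambda>i. g (y i \<odot>\<^bsub>Z\<^esub> u (h (x i)))) {..<n}"
      unfolding adj_def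
      by (rule additive_finsum[OF Z.M.abelian_group_axioms F.M.abelian_group_axioms g add])
        (use h' u' in auto)
    also have "\<dots> = adj (coind M) (eta M) h"
      unfolding adj_def
      by (rule F.M.finsum_cong') (use h' gu eta_closed[OF M] in \<open>auto simp del: coinduced_simps\<close>)
    also have "\<dots> = h" by (rule coind_expansion[OF M h])
    finally show ?thesis .
  qed
  then have "bij_betw (adj Z u) (carrier (coind M)) (carrier Z)"
    using module_homD(1)[OF hom] g right_inv
    by (intro bij_betw_byWitness[where f' = g]) auto
  with hom show ?thesis by (simp add: module_iso_def)
qed

lemma coind_regular_iso:
  "adj (regular_module A) \<iota> \<in> module_iso A (coind (regular_module R)) (regular_module A)"
proof -
  note lR = left_module_regular[OF R.ring_axioms] and lA = left_module_regular[OF A.ring_axioms]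
  interpret F: left_module A "coind (regular_module R)" by (rule left_module_coind[OF lR])
  have u: "\<iota> \<in> module_hom R (regular_module R) (res (regular_module A))"
    by (rule module_homI) (auto simp: iota_add iota_mult)
  \<comment> \<open>The Frobenius isomorphism, sending \<open>a\<close> to the functional c
    \<mapsto> E(c a).\<close>
  let ?g = "\<lambda>a. a \<odot>\<^bsub>coind (regular_module R)\<^esub> eta (regular_module R) \<one>\<^bsub>R\<^esub>"
  have e: "eta (regular_module R) \<one>\<^bsub>R\<^esub> \<in> carrier (coind (regular_module R))"
    by (rule eta_closed[OF lR]) simp
  show ?thesis
  proof (rule adj_iso[OF lR lA u, where g = ?g])
    show "?g \<in> carrier (regular_module A) \<rightarrow> carrier (coind (regular_module R))"
      using e by (auto simp del: coinduced_simps)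
    show "?g (a \<oplus>\<^bsub>regular_module A\<^esub> b) = ?g a \<oplus>\<^bsub>coind (regular_module R)\<^esub> ?g b"
      if "a \<in> carrier (regular_module A)" "b \<in> carrier (regular_module A)" for a b
      using F.smult_l_distr[OF _ _ e] that by (simp del: coinduced_simps)
    show "?g (a \<odot>\<^bsub>regular_module A\<^esub> \<iota> r) = a \<odot>\<^bsub>coind (regular_module R)\<^esub> eta (regular_module R) r"
      if "a \<in> carrier A" "r \<in> carrier (regular_module R)" for a r
      using that by (auto simp: eta_def E_right simp flip: A.m_assoc)
    show "adj (regular_module A) \<iota> (?g a) = a" if "a \<in> carrier (regular_module A)" for a
      using adj_smult_eta[OF lR lA u, of a "\<one>\<^bsub>R\<^esub>"] that by (simp add: iota_one del: coinduced_simps)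
  qed
qed

text \<open>Sums in a coinduced module are pointwise, so coinduction preserves the equation of a
  family retract. \<open>\<theta>\<close> exchanges the coinduced module for the given copy
  \<open>Z\<close>.\<close>

lemma coind_in_add:
  assumes X: "left_module R X" and Z: "left_module A Z" and \<theta>: "\<theta> \<in> module_iso A (coind X) Z"
    and P: "in_add R X P"
  shows "in_add A Z (coind P)"
proof -
  have lP: "left_module R P" and ret: "family_retract R X P"
    using P in_add_iff_family_retract[OF X] by auto
  interpret P: left_module R P by (rule lP)
  interpret F: left_module A "coind P" by (rule left_module_coind[OF lP])
  obtain k :: nat and i p where i: "\<And>j. j < k \<Longrightarrow> i j \<in> module_hom R P X"
    and p: "\<And>j. j < k \<Longrightarrow> p j \<in> module_hom R X P"
    and pi: "\<And>m. m \<in> carrier P \<Longrightarrow> finsum P (\<lambda>j. p j (i j m)) {..<k} = m"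
    using family_retractE[OF ret] by blast
  obtain \<theta>' where \<theta>': "\<theta>' \<in> module_iso A Z (coind X)" "\<And>h. h \<in> carrier (coind X) \<Longrightarrow> \<theta>' (\<theta> h) = h"
    by (rule module_iso_inverse[OF left_module_coind[OF X] \<theta>]) (rule that)
  note ih = module_homD(1)[OF cmap_hom[OF i]] and ph = module_homD(1)[OF cmap_hom[OF p]]
  have "family_retract A Z (coind P)"
  proof (rule family_retractI)
    show "(\<lambda>h. \<theta> (cmap (i j) h)) \<in> module_hom A (coind P) Z" if "j < k" for j
      by (rule module_hom_comp[OF cmap_hom[OF i[OF that]] module_iso_hom[OF \<theta>]])
    show "(\<lambda>z. cmap (p j) (\<theta>' z)) \<in> module_hom A Z (coind P)" if "j < k" for j
      by (rule module_hom_comp[OF module_iso_hom[OF \<theta>'(1)] cmap_hom[OF p[OF that]]])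
    fix h assume h: "h \<in> carrier (coind P)"
    note h' = coinduced_carrierD[OF h]
    have "finsum (coind P) (\<lambda>j. cmap (p j) (\<theta>' (\<theta> (cmap (i j) h)))) {..<k} =
        finsum (coind P) (\<lambda>j. cmap (p j) (cmap (i j) h)) {..<k}" (is "_ = ?s")
      by (rule F.M.finsum_cong') (use h ih ph \<theta>'(2) in auto)
    also have "?s = h"
    proof (rule coinduced_eqI[OF _ h])
      have c: "(\<lambda>j. cmap (p j) (cmap (i j) h)) \<in> {..<k} \<rightarrow> carrier (coind P)"
        using h ih ph by auto
      then show "?s \<in> carrier (coind P)" by (rule F.M.finsum_closed)
      fix a assume a: "a \<in> carrier A"
      have "?s a = finsum P (\<lambda>j. cmap (p j) (cmap (i j) h) a) {..<k}"
        by (rule coind_finsum[OF lP finite_lessThan c a])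
      also have "\<dots> = finsum P (\<lambda>j. p j (i j (h a))) {..<k}"
        by (rule P.M.finsum_cong') (use a h' module_homD(1)[OF i] module_homD(1)[OF p] in \<open>auto simp: coinduced_map_def\<close>)
      also have "\<dots> = h a" using pi h' a by simp
      finally show "?s a = h a" .
    qed
    finally show "finsum (coind P) (\<lambda>j. cmap (p j) (\<theta>' (\<theta> (cmap (i j) h)))) {..<k} = h" .
  qed
  then show ?thesis using in_add_iff_family_retract[OF Z] F.left_module_axioms by blast
qed

end


section \<open>Transport along isomorphisms\<close>

lemma exact_at_iso:
  assumes N: "left_module R N" and N': "left_module R N'"
    and \<alpha>: "\<alpha> \<in> module_iso R L L'" and \<beta>: "\<beta> \<in> module_iso R M M'" and \<gamma>: "\<gamma> \<in> module_iso R N N'"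
    and f: "\<And>x. x \<in> carrier L \<Longrightarrow> f' (\<alpha> x) = \<beta> (f x)" and g: "\<And>x. x \<in> carrier M \<Longrightarrow> g' (\<beta> x) = \<gamma> (g x)"
    and gc: "\<And>x. x \<in> carrier M \<Longrightarrow> g x \<in> carrier N"
    and ex: "exact_at L f M g N"
  shows "exact_at L' f' M' g' N'"
proof -
  interpret N: left_module R N by fact
  have b: "\<alpha> ` carrier L = carrier L'" "\<beta> ` carrier M = carrier M'" "inj_on \<gamma> (carrier N)"
    using \<alpha> \<beta> \<gamma> by (auto simp: module_iso_def bij_betw_def)
  have ker: "g' (\<beta> x) = \<zero>\<^bsub>N'\<^esub> \<longleftrightarrow> g x = \<zero>\<^bsub>N\<^esub>" if "x \<in> carrier M" for x
    using inj_onD[OF b(3), of "g x" "\<zero>\<^bsub>N\<^esub>"] gc[OF that] g[OF that]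
      module_hom_zero[OF N N' module_iso_hom[OF \<gamma>]] by auto
  have "f' ` carrier L' = \<beta> ` f ` carrier L"
    using f unfolding b(1)[symmetric] image_image by (intro image_cong) auto
  also have "\<dots> = \<beta> ` {x \<in> carrier M. g x = \<zero>\<^bsub>N\<^esub>}" using ex by (simp add: exact_at_iff)
  also have "\<dots> = {y \<in> carrier M'. g' y = \<zero>\<^bsub>N'\<^esub>}"
    using ker unfolding b(2)[symmetric] by auto
  finally show ?thesis unfolding exact_at_iff .
qed

lemma coexact_iso:
  assumes Z: "left_module R Z" and \<alpha>: "\<alpha> \<in> module_iso R X X'" and \<beta>: "\<beta> \<in> module_iso R Y Y'"
    and \<gamma>: "\<gamma> \<in> module_iso R Z Z'"
    and f: "\<And>x. x \<in> carrier X \<Longrightarrow> f' (\<alpha> x) = \<beta> (f x)" and g: "\<And>x. x \<in> carrier Y \<Longrightarrow> g' (\<beta> x) = \<gamma> (g x)"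
    and fc: "\<And>x. x \<in> carrier X \<Longrightarrow> f x \<in> carrier Y"
    and gc: "\<And>x. x \<in> carrier Y \<Longrightarrow> g x \<in> carrier Z"
    and coex: "coexact R N X f Y g Z"
  shows "coexact R N X' f' Y' g' Z'"
proof (rule coexactI)
  fix \<phi> assume \<phi>: "\<phi> \<in> module_hom R Y' N" and \<phi>f: "\<And>x. x \<in> carrier X' \<Longrightarrow> \<phi> (f' x) = \<zero>\<^bsub>N\<^esub>"
  have "\<phi> (\<beta> (f x)) = \<zero>\<^bsub>N\<^esub>" if "x \<in> carrier X" for x
    using \<phi>f[OF module_homD(1)[OF module_iso_hom[OF \<alpha>] that]] f[OF that] by simp
  from coexactD[OF coex module_hom_comp[OF module_iso_hom[OF \<beta>] \<phi>] this]
  obtain \<psi> where \<psi>: "\<psi> \<in> module_hom R Z N" "\<And>y. y \<in> carrier Y \<Longrightarrow> \<psi> (g y) = \<phi> (\<beta> y)"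
    by blast
  obtain \<gamma>' where \<gamma>': "\<gamma>' \<in> module_iso R Z' Z" "\<And>z. z \<in> carrier Z \<Longrightarrow> \<gamma>' (\<gamma> z) = z"
    "\<And>z. z \<in> carrier Z' \<Longrightarrow> \<gamma> (\<gamma>' z) = z"
    by (rule module_iso_inverse[OF Z \<gamma>]) (rule that)
  have eq: "\<psi> (\<gamma>' (g' y')) = \<phi> y'" if y': "y' \<in> carrier Y'" for y'
  proof -
    have "y' \<in> \<beta> ` carrier Y" using \<beta> y' by (simp add: module_iso_def bij_betw_def)
    then obtain y where y: "y \<in> carrier Y" "y' = \<beta> y" by blast
    then show ?thesis using g[OF y(1)] \<gamma>'(2)[OF gc[OF y(1)]] \<psi>(2)[OF y(1)] by simp
  qed
  show "\<exists>\<psi> \<in> module_hom R Z' N. \<forall>y \<in> carrier Y'. \<psi> (g' y) = \<phi> y"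
    by (rule bexI[OF _ module_hom_comp[OF module_iso_hom[OF \<gamma>'(1)] \<psi>(1)]], rule ballI, rule eq)
qed

text \<open>Each component of \<open>\<phi>\<close> in \<open>T\<close> extends, and the extensions
  are recombined through \<open>p\<close>. This is how membership of the restricted tensor product
  in add of \<open>T\<close> is exploited.\<close>

lemma coexact_family_retract:
  assumes T: "left_module R T" and N: "left_module R N" and ret: "family_retract R T N"
    and coex: "coexact R T X f Y g Z" and g: "g \<in> module_hom R Y Z"
  shows "coexact R N X f Y g Z"
proof (rule coexactI)
  interpret N: left_module R N by fact
  obtain k :: nat and i p where i: "\<And>j. j < k \<Longrightarrow> i j \<in> module_hom R N T"
    and p: "\<And>j. j < k \<Longrightarrow> p j \<in> module_hom R T N"
    and pi: "\<And>x. x \<in> carrier N \<Longrightarrow> finsum N (\<lambda>j. p j (i j x)) {..<k} = x"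
    using family_retractE[OF ret] by blast
  fix \<phi> assume \<phi>: "\<phi> \<in> module_hom R Y N" and \<phi>f: "\<And>x. x \<in> carrier X \<Longrightarrow> \<phi> (f x) = \<zero>\<^bsub>N\<^esub>"
  have "\<exists>\<psi>. \<psi> \<in> module_hom R Z T \<and> (\<forall>y \<in> carrier Y. \<psi> (g y) = i j (\<phi> y))" if j: "j < k" for j
  proof -
    have "i j (\<phi> (f x)) = \<zero>\<^bsub>T\<^esub>" if "x \<in> carrier X" for x
      using \<phi>f[OF that] module_hom_zero[OF N T i[OF j]] by simp
    from coexactD[OF coex module_hom_comp[OF \<phi> i[OF j]] this] show ?thesis
      unfolding Bex_def .
  qed
  then obtain \<psi> where \<psi>: "\<And>j. j < k \<Longrightarrow> \<psi> j \<in> module_hom R Z T"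
      "\<And>j y. j < k \<Longrightarrow> y \<in> carrier Y \<Longrightarrow> \<psi> j (g y) = i j (\<phi> y)"
    by metis
  have hom: "(\<lambda>z. finsum N (\<lambda>j. p j (\<psi> j z)) {..<k}) \<in> module_hom R Z N"
    by (rule module_hom_finsum_maps[OF N]) (use module_hom_comp[OF \<psi>(1) p] in auto)
  have eq: "finsum N (\<lambda>j. p j (\<psi> j (g y))) {..<k} = \<phi> y" if y: "y \<in> carrier Y" for y
  proof -
    note c = module_homD(1)[OF \<phi> y]
    have "finsum N (\<lambda>j. p j (\<psi> j (g y))) {..<k} = finsum N (\<lambda>j. p j (i j (\<phi> y))) {..<k}"
      by (rule N.M.finsum_cong') (use \<psi>(2) y module_homD(1)[OF p] module_homD(1)[OF i c] in auto)
    then show ?thesis using pi[OF c] by simp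
  qed
  show "\<exists>\<psi> \<in> module_hom R Z N. \<forall>y \<in> carrier Y. \<psi> (g y) = \<phi> y"
    by (rule bexI[OF _ hom], rule ballI, rule eq)
qed

text \<open>A change of element type: the summand of a power to which \<open>M\<close> is isomorphic
  consists of sequences, as \<open>fp_infinity\<close> and \<open>wakamatsu_tilting\<close>
  demand.\<close>

lemma in_add_representative:
  fixes X :: "('r, 'x) module" and M :: "('r, 'm) module"
  assumes X: "left_module R X" and M: "in_add R X M"
  shows "\<exists>M' :: ('r, nat \<Rightarrow> 'x) module. in_add R X M' \<and> (\<exists>\<sigma>. \<sigma> \<in> module_iso R M M')"
proof -
  obtain n where n: "iso_to_summand R M (direct_power X n)" using M unfolding in_add_def by blast
  obtain K where K: "direct_summand R K (direct_power X n)"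
    and iso: "module_iso R M (direct_power X n\<lparr>carrier := K\<rparr>) \<noteq> {}"
    using n unfolding iso_to_summand_def by blast
  let ?M' = "direct_power X n\<lparr>carrier := K\<rparr>"
  have "left_module R ?M'"
    using left_module_submodule[OF left_module_direct_power[OF X]] K by (simp add: direct_summand_def)
  moreover have "module_iso R ?M' (direct_power X n\<lparr>carrier := K\<rparr>) \<noteq> {}"
    using module_iso_id by blast
  ultimately have "in_add R X ?M'" unfolding in_add_def iso_to_summand_def using K by blast
  with iso show ?thesis by blast
qed

section \<open>Resolutions and coresolutions conjugated by isomorphisms\<close>

lemma in_add_left_module: "in_add R T M \<Longrightarrow> left_module R M"
  by (auto simp: in_add_def iso_to_summand_def)

lemma resolution_transport:
  assumes P: "projective_resolution R M P d \<epsilon>" and M: "left_module R M"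
    and P': "\<And>n. projective_module R (P' n)" and \<sigma>: "\<And>n. \<sigma> n \<in> module_iso R (P n) (P' n)"
  shows "\<exists>d' \<epsilon>'. projective_resolution R M P' d' \<epsilon>'"
proof -
  note p = projective_resolutionD[OF P] and l' = projective_left_module[OF P']
  have "\<exists>\<tau>. \<tau> \<in> module_iso R (P' n) (P n) \<and> (\<forall>x \<in> carrier (P n). \<tau> (\<sigma> n x) = x)" for n
    by (rule module_iso_inverse[OF p(2) \<sigma>]) blast
  then obtain \<tau> where \<tau>: "\<And>n. \<tau> n \<in> module_iso R (P' n) (P n)"
      "\<And>n x. x \<in> carrier (P n) \<Longrightarrow> \<tau> n (\<sigma> n x) = x" by metis
  let ?d = "\<lambda>n x. \<sigma> n (d n (\<tau> (Suc n) x))" and ?\<epsilon> = "\<lambda>x. \<epsilon> (\<tau> 0 x)"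
  have \<epsilon>: "?\<epsilon> \<in> module_hom R (P' 0) M" by (rule module_hom_comp[OF module_iso_hom[OF \<tau>(1)] p(4)])
  have d: "?d n \<in> module_hom R (P' (Suc n)) (P' n)" for n
    by (rule module_hom_comp[OF module_hom_comp[OF module_iso_hom[OF \<tau>(1)] p(3)] module_iso_hom[OF \<sigma>]])
  have "\<tau> 0 ` carrier (P' 0) = carrier (P 0)" using \<tau>(1)[of 0] by (simp add: module_iso_def bij_betw_def)
  then have "?\<epsilon> ` carrier (P' 0) = carrier M" using p(5) by (metis image_image)
  moreover have "exact_at (P' (Suc 0)) (?d 0) (P' 0) ?\<epsilon> M"
    by (rule exact_at_iso[OF M M \<sigma> \<sigma> module_iso_id _ _ _ p(6)])
      (simp_all add: \<tau>(2) module_homD(1)[OF p(4)])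
  moreover have "exact_at (P' (Suc (Suc n))) (?d (Suc n)) (P' (Suc n)) (?d n) (P' n)" for n
    by (rule exact_at_iso[OF p(2) l' \<sigma> \<sigma> \<sigma> _ _ _ p(7)])
      (simp_all add: \<tau>(2) module_homD(1)[OF p(3)])
  ultimately have "projective_resolution R M P' ?d ?\<epsilon>"
    unfolding projective_resolution_def using P' \<epsilon> d by simp
  then show ?thesis by blast
qed

lemma exact_coresolutionD:
  assumes "exact_coresolution R M \<eta> C \<delta>"
  shows "\<eta> \<in> module_hom R M (C 0)" and "\<delta> n \<in> module_hom R (C n) (C (Suc n))"
    and "inj_on \<eta> (carrier M)" and "exact_at M \<eta> (C 0) (\<delta> 0) (C (Suc 0))"
    and "exact_at (C n) (\<delta> n) (C (Suc n)) (\<delta> (Suc n)) (C (Suc (Suc n)))"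
  using assms unfolding exact_coresolution_def by auto

lemma hom_exact_iff:
  assumes M: "left_module R M" and C: "\<And>n. left_module R (C n)" and T: "left_module R T"
    and co: "exact_coresolution R M \<eta> C \<delta>"
  shows "hom_exact R T M \<eta> C \<delta> \<longleftrightarrow> coexact R T M (\<lambda>_. \<zero>\<^bsub>M\<^esub>) M \<eta> (C 0) \<and>
    coexact R T M \<eta> (C 0) (\<delta> 0) (C (Suc 0)) \<and>
    (\<forall>n. coexact R T (C n) (\<delta> n) (C (Suc n)) (\<delta> (Suc n)) (C (Suc (Suc n))))"
proof -
  note c = exact_coresolutionD[OF co]
  have "exact_at (Hom R (C (Suc 0)) T) (pullback (C 0) (\<delta> 0)) (Hom R (C 0) T) (pullback M \<eta>) (Hom R M T) \<longleftrightarrow>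
      coexact R T M \<eta> (C 0) (\<delta> 0) (C (Suc 0))"
    by (rule exact_at_Hom_iff[OF M C C T c(1) c(2)]) (rule exact_atD(1)[OF c(4)])
  moreover have "exact_at (Hom R (C (Suc (Suc n))) T) (pullback (C (Suc n)) (\<delta> (Suc n)))
        (Hom R (C (Suc n)) T) (pullback (C n) (\<delta> n)) (Hom R (C n) T) \<longleftrightarrow>
      coexact R T (C n) (\<delta> n) (C (Suc n)) (\<delta> (Suc n)) (C (Suc (Suc n)))" for n
    by (rule exact_at_Hom_iff[OF C C C T c(2) c(2)]) (rule exact_atD(1)[OF c(5)])
  ultimately show ?thesis
    unfolding hom_exact_def surj_Hom_iff[OF M C T c(1)] One_nat_def by simp
qed

text \<open>The coresolved module is exchanged too, because coinduction of the regular R-module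
  yields the regular A-module only up to isomorphism.\<close>

lemma coresolution_transport:
  assumes M: "left_module R M" and M': "left_module R M'"
    and C: "\<And>n. left_module R (C n)" and C': "\<And>n. left_module R (C' n)" and T: "left_module R T"
    and co: "exact_coresolution R M \<eta> C \<delta>" and he: "hom_exact R T M \<eta> C \<delta>"
    and \<mu>: "\<mu> \<in> module_iso R M M'" and \<sigma>: "\<And>n. \<sigma> n \<in> module_iso R (C n) (C' n)"
  shows "\<exists>\<eta>' \<delta>'. exact_coresolution R M' \<eta>' C' \<delta>' \<and> hom_exact R T M' \<eta>' C' \<delta>'"
proof -
  note c = exact_coresolutionD[OF co]
  have "\<exists>\<tau>. \<tau> \<in> module_iso R (C' n) (C n) \<and> (\<forall>x \<in> carrier (C n). \<tau> (\<sigma> n x) = x)" for n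
    by (rule module_iso_inverse[OF C \<sigma>]) blast
  then obtain \<tau> where \<tau>: "\<And>n. \<tau> n \<in> module_iso R (C' n) (C n)"
      "\<And>n x. x \<in> carrier (C n) \<Longrightarrow> \<tau> n (\<sigma> n x) = x" by metis
  obtain \<nu> where \<nu>: "\<nu> \<in> module_iso R M' M" "\<And>x. x \<in> carrier M \<Longrightarrow> \<nu> (\<mu> x) = x"
    "\<And>x. x \<in> carrier M' \<Longrightarrow> \<mu> (\<nu> x) = x"
    by (rule module_iso_inverse[OF M \<mu>]) (rule that)
  let ?\<eta> = "\<lambda>x. \<sigma> 0 (\<eta> (\<nu> x))" and ?\<delta> = "\<lambda>n x. \<sigma> (Suc n) (\<delta> n (\<tau> n x))"
  have \<eta>: "?\<eta> \<in> module_hom R M' (C' 0)"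
    by (rule module_hom_comp[OF module_hom_comp[OF module_iso_hom[OF \<nu>(1)] c(1)] module_iso_hom[OF \<sigma>]])
  have \<delta>: "?\<delta> n \<in> module_hom R (C' n) (C' (Suc n))" for n
    by (rule module_hom_comp[OF module_hom_comp[OF module_iso_hom[OF \<tau>(1)] c(2)] module_iso_hom[OF \<sigma>]])
  have "inj_on ?\<eta> (carrier M')"
  proof (rule inj_onI)
    fix x x' assume x: "x \<in> carrier M'" "x' \<in> carrier M'" and eq: "?\<eta> x = ?\<eta> x'"
    have \<nu>c: "\<nu> x \<in> carrier M" "\<nu> x' \<in> carrier M" using x module_homD(1)[OF module_iso_hom[OF \<nu>(1)]] by auto
    have "\<eta> (\<nu> x) = \<eta> (\<nu> x')"
      using arg_cong[OF eq, of "\<tau> 0"] \<tau>(2) module_homD(1)[OF c(1)] \<nu>c by simp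
    then have "\<nu> x = \<nu> x'" using inj_onD[OF c(3)] \<nu>c by blast
    then show "x = x'" using \<nu>(3) x by metis
  qed
  moreover have "exact_at M' ?\<eta> (C' 0) (?\<delta> 0) (C' (Suc 0))"
    by (rule exact_at_iso[OF C C' \<mu> \<sigma> \<sigma> _ _ _ c(4)])
      (simp_all add: \<tau>(2) \<nu>(2) module_homD(1)[OF c(2)])
  moreover have "exact_at (C' n) (?\<delta> n) (C' (Suc n)) (?\<delta> (Suc n)) (C' (Suc (Suc n)))" for n
    by (rule exact_at_iso[OF C C' \<sigma> \<sigma> \<sigma> _ _ _ c(5)])
      (simp_all add: \<tau>(2) module_homD(1)[OF c(2)])
  ultimately have co': "exact_coresolution R M' ?\<eta> C' ?\<delta>"
    unfolding exact_coresolution_def using \<eta> \<delta> by simp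
  interpret M: left_module R M by fact
  have z: "\<mu> \<zero>\<^bsub>M\<^esub> = \<zero>\<^bsub>M'\<^esub>" by (rule module_hom_zero[OF M M' module_iso_hom[OF \<mu>]])
  note ce = he[unfolded hom_exact_iff[OF M C T co]]
  have "coexact R T M' (\<lambda>_. \<zero>\<^bsub>M'\<^esub>) M' ?\<eta> (C' 0)"
    by (rule coexact_iso[OF C \<mu> \<mu> \<sigma> _ _ _ _ conjunct1[OF ce]])
      (simp_all add: z \<nu>(2) module_homD(1)[OF c(1)])
  moreover have "coexact R T M' ?\<eta> (C' 0) (?\<delta> 0) (C' (Suc 0))"
    by (rule coexact_iso[OF C \<mu> \<sigma> \<sigma> _ _ _ _ conjunct1[OF conjunct2[OF ce]]])
      (simp_all add: \<tau>(2) \<nu>(2) module_homD(1)[OF c(1)] module_homD(1)[OF c(2)])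
  moreover have "coexact R T (C' n) (?\<delta> n) (C' (Suc n)) (?\<delta> (Suc n)) (C' (Suc (Suc n)))" for n
    by (rule coexact_iso[OF C \<sigma> \<sigma> \<sigma> _ _ _ _ spec[OF conjunct2[OF conjunct2[OF ce]]]])
      (simp_all add: \<tau>(2) module_homD(1)[OF c(2)])
  ultimately have "hom_exact R T M' ?\<eta> C' ?\<delta>"
    unfolding hom_exact_iff[OF M' C' T co'] by blast
  with co' show ?thesis by blast
qed

text \<open>Frees \<open>Ext\<close> from its chosen resolution: by comparison in both directions,
  any resolution, of any element type, detects vanishing in positive degrees.\<close>

lemma Ext_trivial_iff_coexact:
  fixes R :: "'r ring" and M :: "('r, 'm) module"
  assumes M: "left_module R M" and N: "left_module R N" and Q: "projective_resolution R M Q d' \<epsilon>'"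
  shows "trivial_group (Ext R M N (Suc i)) \<longleftrightarrow>
    coexact R N (Q (Suc (Suc i))) (d' (Suc i)) (Q (Suc i)) (d' i) (Q i)"
proof -
  let ?X = "SOME (P :: nat \<Rightarrow> ('r, ('r, 'm) syz \<Rightarrow> 'r) module, d, \<epsilon>). projective_resolution R M P d \<epsilon>"
  obtain P\<^sub>0 :: "nat \<Rightarrow> ('r, ('r, 'm) syz \<Rightarrow> 'r) module" and d\<^sub>0 \<epsilon>\<^sub>0
    where "projective_resolution R M P\<^sub>0 d\<^sub>0 \<epsilon>\<^sub>0"
    using ex_projective_resolution[OF M] by blast
  then have "case (P\<^sub>0, d\<^sub>0, \<epsilon>\<^sub>0) of (P, d, \<epsilon>) \<Rightarrow> projective_resolution R M P d \<epsilon>" by simp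
  \<comment> \<open>Existence in exactly the type used by \<open>Ext\<close> guarantees that the
    choice really is a resolution.\<close>
  then have X: "case ?X of (P, d, \<epsilon>) \<Rightarrow> projective_resolution R M P d \<epsilon>" by (rule someI)
  obtain P d \<epsilon> where eq: "?X = (P, d, \<epsilon>)" by (cases ?X)
  have P: "projective_resolution R M P d \<epsilon>" using X unfolding eq by simp
  note p = projective_resolutionD[OF P]
  have "Ext R M N (Suc i) = hom_cohomology R P d N (Suc i)" unfolding Ext_def eq by simp
  then show ?thesis
    using trivial_group_hom_cohomology_iff[where P = P and d = d, OF p(2) N p(3) exact_atD(1)[OF p(7)]]
      coexact_resolution[OF P Q M N] coexact_resolution[OF Q P M N] by metis
qed

section \<open>Coinduced resolutions and coresolutions, and the tilting conditions\<close>

context frobenius_system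
begin

lemma coind_resolution:
  assumes P: "projective_resolution R M P d \<epsilon>" and M: "left_module R M" and Z: "left_module A Z"
    and \<theta>: "\<theta> \<in> module_iso A (coind M) Z"
  shows "projective_resolution A Z (\<lambda>n. coind (P n)) (\<lambda>n. cmap (d n)) (\<lambda>h. \<theta> (cmap \<epsilon> h))"
proof -
  note p = projective_resolutionD[OF P]
  have "cmap \<epsilon> ` carrier (coind (P 0)) = carrier (coind M)"
  proof (intro equalityI subsetI)
    show "h \<in> carrier (coind M)" if "h \<in> cmap \<epsilon> ` carrier (coind (P 0))" for h
      using that module_homD(1)[OF cmap_hom[OF p(4)]] by blast
    show "h \<in> cmap \<epsilon> ` carrier (coind (P 0))" if "h \<in> carrier (coind M)" for h
      by (rule cmap_image[OF p(2) M p(4) that]) (use p(5) coinduced_carrierD(1)[OF that] in auto)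
  qed
  then have "(\<lambda>h. \<theta> (cmap \<epsilon> h)) ` carrier (coind (P 0)) = \<theta> ` carrier (coind M)"
    by (metis image_image)
  also have "\<dots> = carrier Z" using \<theta> by (simp add: module_iso_def bij_betw_def)
  finally have surj: "(\<lambda>h. \<theta> (cmap \<epsilon> h)) ` carrier (coind (P 0)) = carrier Z" .
  have "exact_at (coind (P (Suc 0))) (cmap (d 0)) (coind (P 0)) (\<lambda>h. \<theta> (cmap \<epsilon> h)) Z"
    by (rule exact_at_iso[OF left_module_coind[OF M] Z module_iso_id module_iso_id \<theta> _ _ _
          cmap_exact_at[OF p(2) p(2) p(3) p(6)]])
      (simp_all add: module_homD(1)[OF cmap_hom[OF p(4)]])
  moreover have "exact_at (coind (P (Suc (Suc n)))) (cmap (d (Suc n))) (coind (P (Suc n))) (cmap (d n)) (coind (P n))" for n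
    by (rule cmap_exact_at[OF p(2) p(2) p(3) p(7)])
  ultimately show ?thesis
    unfolding projective_resolution_def
    using coind_projective[OF p(1)] cmap_hom[OF p(3)] surj
      module_hom_comp[OF cmap_hom[OF p(4)] module_iso_hom[OF \<theta>]] by simp
qed

lemma coind_coresolution:
  assumes M: "left_module R M" and C: "\<And>n. left_module R (C n)"
    and co: "exact_coresolution R M \<eta> C \<delta>"
  shows "exact_coresolution A (coind M) (cmap \<eta>) (\<lambda>n. coind (C n)) (\<lambda>n. cmap (\<delta> n))"
proof -
  note c = exact_coresolutionD[OF co]
  have "inj_on (cmap \<eta>) (carrier (coind M))"
  proof (rule inj_onI)
    fix h k assume hk: "h \<in> carrier (coind M)" "k \<in> carrier (coind M)" and eq: "cmap \<eta> h = cmap \<eta> k"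
    show "h = k"
    proof (rule coinduced_eqI[OF hk])
      fix a assume a: "a \<in> carrier A"
      have "\<eta> (h a) = \<eta> (k a)" using fun_cong[OF eq, of a] a by (simp add: coinduced_map_def)
      then show "h a = k a"
        using inj_onD[OF c(3)] coinduced_carrierD(1)[OF hk(1) a] coinduced_carrierD(1)[OF hk(2) a] by blast
    qed
  qed
  then show ?thesis
    unfolding exact_coresolution_def
    using cmap_hom[OF c(1)] cmap_hom[OF c(2)] cmap_exact_at[OF M C c(1) c(4)]
      cmap_exact_at[OF C C c(2) c(5)] by simp
qed

lemma coind_hom_exact:
  fixes M :: "('a, 'm) module"
  assumes M: "left_module R M" and C: "\<And>n. left_module R (C n)" and N: "left_module A N"
    and co: "exact_coresolution R M \<eta> C \<delta>" and he: "hom_exact R (res N) M \<eta> C \<delta>"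
  shows "hom_exact A N (coind M) (cmap \<eta>) (\<lambda>n. coind (C n)) (\<lambda>n. cmap (\<delta> n))"
proof -
  note c = exact_coresolutionD[OF co]
  note ce = he[unfolded hom_exact_iff[OF M C left_module_res[OF N] co]]
  \<comment> \<open>Coinduction sends the zero map to the zero map, so the surjectivity clause is an
    instance of \<open>cmap_coexact\<close>.\<close>
  have "cmap (\<lambda>_ :: 'm. \<zero>\<^bsub>M\<^esub>) = (\<lambda>_. \<zero>\<^bsub>coind M\<^esub>)" by (simp add: coinduced_map_def fun_eq_iff)
  then have "coexact A N (coind M) (\<lambda>_. \<zero>\<^bsub>coind M\<^esub>) (coind M) (cmap \<eta>) (coind (C 0))"
    using cmap_coexact[OF M M C N module_hom_const_zero[OF M] c(1) conjunct1[OF ce]] by simp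
  then show ?thesis
    unfolding hom_exact_iff[OF left_module_coind[OF M] left_module_coind[OF C] N coind_coresolution[OF M C co]]
    by (intro conjI allI cmap_coexact[OF M C C N c(1) c(2) conjunct1[OF conjunct2[OF ce]]]
        cmap_coexact[OF C C C N c(2) c(2) spec[OF conjunct2[OF conjunct2[OF ce]]]])
qed

text \<open>Stated for any \<open>N\<close> isomorphic to the coinduced module, so that the three
  conditions are checked without reference to the construction of the tensor product.\<close>

lemma wakamatsu_tilting_coind_iso:
  fixes T :: "('a, 't) module" and N :: "('b, 'z) module"
  assumes T: "wakamatsu_tilting R T" and N: "left_module A N" and \<theta>: "\<theta> \<in> module_iso A (coind T) N"
    and add: "in_add R T (res N)"
  shows "wakamatsu_tilting A N"
proof -
  note lR = left_module_regular[OF R.ring_axioms] and lA = left_module_regular[OF A.ring_axioms]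
  have lT: "left_module R T" using T by (simp add: wakamatsu_tilting_def)
  note lN = left_module_res[OF N]
  have ret: "family_retract R T (res N)" using add in_add_iff_family_retract[OF lT] by blast
  have "fp_infinity A N"
  proof -
    obtain P :: "nat \<Rightarrow> ('a, nat \<Rightarrow> 'a) module" and d \<epsilon> where P: "projective_resolution R T P d \<epsilon>"
      and fg: "\<And>n. fin_gen_module R (P n)"
      using T unfolding wakamatsu_tilting_def fp_infinity_def by blast
    \<comment> \<open>Finite generation and projectivity together mean membership in add of the
      regular module, which coinduction carries from R to A.\<close>
    have "in_add A (regular_module A) (coind (P n))" for n
      by (rule coind_in_add[OF lR lA coind_regular_iso
            fin_gen_projective_in_add_regular[OF fg projective_resolutionD(1)[OF P]]])
    then have "\<exists>P' :: ('b, nat \<Rightarrow> 'b) module. in_add A (regular_module A) P' \<and>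
        (\<exists>\<sigma>. \<sigma> \<in> module_iso A (coind (P n)) P')" for n
      by (rule in_add_representative[OF lA])
    then obtain P' :: "nat \<Rightarrow> ('b, nat \<Rightarrow> 'b) module" and \<sigma> where
      P': "\<And>n. in_add A (regular_module A) (P' n)" "\<And>n. \<sigma> n \<in> module_iso A (coind (P n)) (P' n)"
      by metis
    note fgp = in_add_regular_fin_gen_projective[OF A.ring_axioms P'(1)]
    show ?thesis
      using resolution_transport[OF coind_resolution[OF P lT N \<theta>] N fgp(1) P'(2)] fgp(2)
      unfolding fp_infinity_def by blast
  qed
  moreover have "trivial_group (Ext A N N i)" if i: "i > 0" for i
  proof -
    obtain k where k: "i = Suc k" using i gr0_implies_Suc by blast
    obtain P :: "nat \<Rightarrow> ('a, ('a, 't) syz \<Rightarrow> 'a) module" and d \<epsilon> where P: "projective_resolution R T P d \<epsilon>"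
      using ex_projective_resolution[OF lT] by blast
    note p = projective_resolutionD[OF P]
    have "trivial_group (Ext R T T i)" using T i by (simp add: wakamatsu_tilting_def)
    then have "coexact R T (P (Suc (Suc k))) (d (Suc k)) (P (Suc k)) (d k) (P k)"
      unfolding k Ext_trivial_iff_coexact[OF lT lT P] .
    \<comment> \<open>The coefficients change from \<open>T\<close> to the restriction of
      \<open>N\<close>, which is in add of \<open>T\<close>; the adjunction then moves the statement
      to A.\<close>
    then have "coexact R (res N) (P (Suc (Suc k))) (d (Suc k)) (P (Suc k)) (d k) (P k)"
      by (rule coexact_family_retract[OF lT lN ret _ p(3)])
    then show ?thesis
      unfolding k Ext_trivial_iff_coexact[OF N N coind_resolution[OF P lT N \<theta>]]
      by (rule cmap_coexact[OF p(2) p(2) p(2) N p(3) p(3)])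
  qed
  moreover have "\<exists>(C :: nat \<Rightarrow> ('b, nat \<Rightarrow> 'z) module) \<eta> \<delta>. (\<forall>j. in_add A N (C j)) \<and>
      exact_coresolution A (regular_module A) \<eta> C \<delta> \<and> hom_exact A N (regular_module A) \<eta> C \<delta>"
  proof -
    obtain C :: "nat \<Rightarrow> ('a, nat \<Rightarrow> 't) module" and \<eta> \<delta> where C: "\<And>j. in_add R T (C j)"
      and co: "exact_coresolution R (regular_module R) \<eta> C \<delta>"
      and he: "hom_exact R T (regular_module R) \<eta> C \<delta>"
      using T unfolding wakamatsu_tilting_def by blast
    note lC = in_add_left_module[OF C] and c = exact_coresolutionD[OF co]
    note ce = he[unfolded hom_exact_iff[OF lR lC lT co]]
    \<comment> \<open>The same change of coefficients, at every place of the augmented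
      sequence.\<close>
    have he': "hom_exact R (res N) (regular_module R) \<eta> C \<delta>"
      unfolding hom_exact_iff[OF lR lC lN co]
      by (intro conjI allI coexact_family_retract[OF lT lN ret conjunct1[OF ce] c(1)]
          coexact_family_retract[OF lT lN ret conjunct1[OF conjunct2[OF ce]] c(2)]
          coexact_family_retract[OF lT lN ret spec[OF conjunct2[OF conjunct2[OF ce]]] c(2)])
    have "\<exists>C' :: ('b, nat \<Rightarrow> 'z) module. in_add A N C' \<and> (\<exists>\<sigma>. \<sigma> \<in> module_iso A (coind (C j)) C')" for j
      by (rule in_add_representative[OF N coind_in_add[OF lT N \<theta> C]])
    then obtain C' :: "nat \<Rightarrow> ('b, nat \<Rightarrow> 'z) module" and \<sigma> where
      C': "\<And>j. in_add A N (C' j)" "\<And>j. \<sigma> j \<in> module_iso A (coind (C j)) (C' j)"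
      by metis
    have "\<exists>\<eta>' \<delta>'. exact_coresolution A (regular_module A) \<eta>' C' \<delta>' \<and>
        hom_exact A N (regular_module A) \<eta>' C' \<delta>'"
      by (rule coresolution_transport[OF left_module_coind[OF lR] lA left_module_coind[OF lC]
            in_add_left_module[OF C'(1)] N coind_coresolution[OF lR lC co]
            coind_hom_exact[OF lR lC N co he'] coind_regular_iso C'(2)])
    then show ?thesis using C'(1) by blast
  qed
  ultimately show ?thesis unfolding wakamatsu_tilting_def using N by blast
qed

end


section \<open>Extension of scalars is coinduction\<close>

locale scalar_extension = ring_extension +
  fixes T :: "('a, 't) module"
  assumes T: "left_module R T"
begin

sublocale T: left_module R T by (rule T)

abbreviation "tfree \<equiv> free_Abelian_group (carrier A \<times> carrier T)"
abbreviation "AT \<equiv> extend_scalars R A \<iota> T"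

text \<open>The ingredients of \<open>extend_scalars\<close> under separate names: the relation
  subgroup, the action on the free group and the quotient map, so that classes can be handled
  through representatives.\<close>

definition "trel = generate tfree (tensor_relations R A \<iota> T)"
definition "act a = frag_extend (\<lambda>(b, t). frag_of (a \<otimes>\<^bsub>A\<^esub> b, t))"
definition "cls x = trel #>\<^bsub>tfree\<^esub> x"

sublocale tfree: comm_group tfree by (rule abelian_free_Abelian_group)

section \<open>The relation subgroup and its stability under the action\<close>

lemma tensor_relations_closed: "tensor_relations R A \<iota> T \<subseteq> carrier tfree"
  by (auto simp: tensor_relations_def dest!: subsetD[OF keys_diff])

lemma tfree_diff_closed:
  "u \<in> carrier tfree \<Longrightarrow> v \<in> carrier tfree \<Longrightarrow> u - v \<in> carrier tfree"
  using keys_diff[of u v] by auto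

lemma subgroup_trel: "subgroup trel tfree"
  unfolding trel_def by (rule tfree.generate_is_subgroup[OF tensor_relations_closed])

sublocale trel: normal trel tfree
  by (rule tfree.subgroup_imp_normal[OF subgroup_trel])

lemma trel_rel: "z \<in> tensor_relations R A \<iota> T \<Longrightarrow> z \<in> trel"
  unfolding trel_def by (rule generate.incl)

lemma cls_eqI:
  assumes "x \<in> carrier tfree" and "y \<in> carrier tfree" and "x - y \<in> trel"
  shows "cls x = cls y"
proof -
  have "x = (x - y) \<otimes>\<^bsub>tfree\<^esub> y" by simp
  then have "x \<in> trel #>\<^bsub>tfree\<^esub> y" using assms(3) unfolding r_coset_def by blast
  then show ?thesis
    unfolding cls_def using tfree.repr_independence[OF _ assms(2) subgroup_trel] by simp
qed

lemma mem_cls: "z \<in> cls x \<longleftrightarrow> (\<exists>k \<in> trel. z = k + x)"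
  by (auto simp: cls_def r_coset_def)

lemma act_keys:
  assumes "a \<in> carrier A" and "Poly_Mapping.keys z \<subseteq> carrier A \<times> carrier T"
  shows "Poly_Mapping.keys (act a z) \<subseteq> carrier A \<times> carrier T"
  using assms(2)
proof (rule free_Abelian_group_induct)
  show "Poly_Mapping.keys (act a 0) \<subseteq> carrier A \<times> carrier T" by (simp add: act_def)
  show "Poly_Mapping.keys (act a (u - v)) \<subseteq> carrier A \<times> carrier T"
    if "Poly_Mapping.keys (act a u) \<subseteq> carrier A \<times> carrier T" "Poly_Mapping.keys (act a v) \<subseteq> carrier A \<times> carrier T" for u v
    using that keys_diff[of "act a u" "act a v"] by (auto simp: act_def frag_extend_diff)
  show "Poly_Mapping.keys (act a (frag_of p)) \<subseteq> carrier A \<times> carrier T" if "p \<in> carrier A \<times> carrier T" for p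
    using that assms(1) by (auto simp: act_def)
qed

lemma act_diff: "act a (z - w) = act a z - act a w"
  and act_add: "act a (z + w) = act a z + act a w"
  and act_frag_of: "act a (frag_of (b, t)) = frag_of (a \<otimes>\<^bsub>A\<^esub> b, t)"
  by (simp_all add: act_def frag_extend_diff frag_extend_add)

lemma act_hom: "a \<in> carrier A \<Longrightarrow> act a \<in> hom tfree tfree"
  using act_keys by (intro homI) (auto simp: act_add)

text \<open>The action of \<open>a\<close> is a group endomorphism that sends each generating
  relation to one of the same kind. This lets it descend to the quotient.\<close>

lemma act_trel:
  assumes a: "a \<in> carrier A" and z: "z \<in> trel"
  shows "act a z \<in> trel"
proof -
  have "act a ` trel = generate tfree (act a ` tensor_relations R A \<iota> T)"
    unfolding trel_def
    by (rule group_hom.generate_img[OF _ tensor_relations_closed, symmetric])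
      (intro group_hom.intro group_hom_axioms.intro tfree.is_group act_hom a)
  also have "\<dots> \<subseteq> trel"
    unfolding trel_def
  proof (rule tfree.mono_generate)
    show "act a ` tensor_relations R A \<iota> T \<subseteq> tensor_relations R A \<iota> T"
    proof (rule image_subsetI)
      fix z assume "z \<in> tensor_relations R A \<iota> T"
      then consider
        (left) b c t where "z = frag_of (b \<oplus>\<^bsub>A\<^esub> c, t) - frag_of (b, t) - frag_of (c, t)"
          "b \<in> carrier A" "c \<in> carrier A" "t \<in> carrier T"
      | (right) b s t where "z = frag_of (b, s \<oplus>\<^bsub>T\<^esub> t) - frag_of (b, s) - frag_of (b, t)"
          "b \<in> carrier A" "s \<in> carrier T" "t \<in> carrier T"
      | (balanced) b r t where "z = frag_of (b \<otimes>\<^bsub>A\<^esub> \<iota> r, t) - frag_of (b, r \<odot>\<^bsub>T\<^esub> t)"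
          "b \<in> carrier A" "r \<in> carrier R" "t \<in> carrier T"
        unfolding tensor_relations_def by blast
      then show "act a z \<in> tensor_relations R A \<iota> T"
      proof cases
        case left
        then have "act a z = frag_of (a \<otimes>\<^bsub>A\<^esub> b \<oplus>\<^bsub>A\<^esub> a \<otimes>\<^bsub>A\<^esub> c, t) - frag_of (a \<otimes>\<^bsub>A\<^esub> b, t) - frag_of (a \<otimes>\<^bsub>A\<^esub> c, t)"
          using a by (simp add: act_diff act_frag_of A.r_distr)
        moreover have "a \<otimes>\<^bsub>A\<^esub> b \<in> carrier A" "a \<otimes>\<^bsub>A\<^esub> c \<in> carrier A" using a left by auto
        ultimately show ?thesis using left unfolding tensor_relations_def by blast
      next
        case right
        then have "act a z = frag_of (a \<otimes>\<^bsub>A\<^esub> b, s \<oplus>\<^bsub>T\<^esub> t) - frag_of (a \<otimes>\<^bsub>A\<^esub> b, s) - frag_of (a \<otimes>\<^bsub>A\<^esub> b, t)"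
          by (simp add: act_diff act_frag_of)
        moreover have "a \<otimes>\<^bsub>A\<^esub> b \<in> carrier A" using a right by auto
        ultimately show ?thesis using right unfolding tensor_relations_def by blast
      next
        case balanced
        then have "act a z = frag_of ((a \<otimes>\<^bsub>A\<^esub> b) \<otimes>\<^bsub>A\<^esub> \<iota> r, t) - frag_of (a \<otimes>\<^bsub>A\<^esub> b, r \<odot>\<^bsub>T\<^esub> t)"
          using a by (simp add: act_diff act_frag_of A.m_assoc)
        moreover have "a \<otimes>\<^bsub>A\<^esub> b \<in> carrier A" using a balanced by auto
        ultimately show ?thesis using balanced unfolding tensor_relations_def by blast
      qed
    qed
  qed
  finally show ?thesis using z by blast
qed

section \<open>The module structure on the quotient\<close>

lemma carrier_AT: "carrier AT = cls ` carrier tfree"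
  by (auto simp: extend_scalars_def Let_def FactGroup_def RCOSETS_def cls_def trel_def)

lemma cls_closed: "x \<in> carrier tfree \<Longrightarrow> cls x \<in> carrier AT"
  unfolding carrier_AT by (rule imageI)

lemma zero_AT: "\<zero>\<^bsub>AT\<^esub> = cls 0"
  using trel.rcos_const[OF tfree.is_group, of 0] subgroup.one_closed[OF subgroup_trel]
  by (simp add: extend_scalars_def Let_def FactGroup_def cls_def trel_def)

lemma add_AT:
  assumes "x \<in> carrier tfree" and "y \<in> carrier tfree"
  shows "cls x \<oplus>\<^bsub>AT\<^esub> cls y = cls (x + y)"
  using trel.rcos_sum[OF assms]
  by (simp add: extend_scalars_def Let_def FactGroup_def cls_def trel_def)

text \<open>The definition takes a union over all representatives of a class. By
  \<open>act_trel\<close> they all contribute the same coset, so the union is that coset.\<close>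

lemma smult_AT:
  assumes a: "a \<in> carrier A" and x: "x \<in> carrier tfree"
  shows "a \<odot>\<^bsub>AT\<^esub> cls x = cls (act a x)"
proof -
  have "cls (act a z) = cls (act a x)" if "z \<in> cls x" for z
  proof -
    obtain k where k: "k \<in> trel" "z = k + x" using \<open>z \<in> cls x\<close> unfolding mem_cls by blast
    have kc: "k \<in> carrier tfree" using k(1) subgroup.subset[OF subgroup_trel] by blast
    have zc: "z \<in> carrier tfree" using tfree.m_closed[OF kc x] k(2) by simp
    have "act a z - act a x = act a k" by (simp add: k(2) act_add)
    then show ?thesis
      using act_keys[OF a] act_trel[OF a k(1)] x zc by (intro cls_eqI) simp_all
  qed
  moreover have "x \<in> cls x"
    unfolding mem_cls using subgroup.one_closed[OF subgroup_trel] by (intro bexI[of _ 0]) auto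
  ultimately have "(\<Union>z \<in> cls x. cls (act a z)) = cls (act a x)" by blast
  then show ?thesis by (simp add: extend_scalars_def Let_def cls_def act_def trel_def)
qed

lemma act_mult:
  assumes "a \<in> carrier A" and "b \<in> carrier A" and "Poly_Mapping.keys z \<subseteq> carrier A \<times> carrier T"
  shows "act (a \<otimes>\<^bsub>A\<^esub> b) z = act a (act b z)"
  using assms(3)
  by (rule free_Abelian_group_induct)
    (use assms(1,2) in \<open>auto simp: act_diff act_frag_of A.m_assoc, simp_all add: act_def\<close>)

lemma act_one:
  assumes "Poly_Mapping.keys z \<subseteq> carrier A \<times> carrier T"
  shows "act \<one>\<^bsub>A\<^esub> z = z"
  using assms
  by (rule free_Abelian_group_induct) (auto simp: act_diff act_frag_of, simp add: act_def)

text \<open>Unlike \<open>act_mult\<close> and \<open>act_one\<close>, which hold in the free group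
  itself, this law holds only modulo the relations. On a generator the defect is a relation of
  additivity in A, and the subgroup absorbs differences of defects.\<close>

lemma act_plus:
  assumes "a \<in> carrier A" and "b \<in> carrier A" and "Poly_Mapping.keys z \<subseteq> carrier A \<times> carrier T"
  shows "act (a \<oplus>\<^bsub>A\<^esub> b) z - (act a z + act b z) \<in> trel"
  using assms(3)
proof (rule free_Abelian_group_induct)
  show "act (a \<oplus>\<^bsub>A\<^esub> b) 0 - (act a 0 + act b 0) \<in> trel"
    using subgroup.one_closed[OF subgroup_trel] by (simp add: act_def)
next
  fix u v
  assume u: "act (a \<oplus>\<^bsub>A\<^esub> b) u - (act a u + act b u) \<in> trel" (is "?u \<in> _")
    and v: "act (a \<oplus>\<^bsub>A\<^esub> b) v - (act a v + act b v) \<in> trel" (is "?v \<in> _")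
  have "Poly_Mapping.keys ?v \<subseteq> carrier A \<times> carrier T"
    using subsetD[OF subgroup.subset[OF subgroup_trel] v] by simp
  then have "- ?v \<in> trel" using subgroup.m_inv_closed[OF subgroup_trel v] by simp
  then have "?u + - ?v \<in> trel" using subgroup.m_closed[OF subgroup_trel u] by simp
  then show "act (a \<oplus>\<^bsub>A\<^esub> b) (u - v) - (act a (u - v) + act b (u - v)) \<in> trel"
    by (simp add: act_diff algebra_simps)
next
  fix p assume "p \<in> carrier A \<times> carrier T"
  then obtain c t where p: "p = (c, t)" "c \<in> carrier A" "t \<in> carrier T" by blast
  have "frag_of (a \<otimes>\<^bsub>A\<^esub> c \<oplus>\<^bsub>A\<^esub> b \<otimes>\<^bsub>A\<^esub> c, t) - frag_of (a \<otimes>\<^bsub>A\<^esub> c, t) - frag_of (b \<otimes>\<^bsub>A\<^esub> c, t)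
      \<in> tensor_relations R A \<iota> T"
    unfolding tensor_relations_def using assms(1,2) p by blast
  then show "act (a \<oplus>\<^bsub>A\<^esub> b) (frag_of p) - (act a (frag_of p) + act b (frag_of p)) \<in> trel"
    using trel_rel assms(1,2) p by (simp add: act_frag_of A.l_distr diff_diff_eq)
qed

lemma left_module_AT: "left_module A AT"
proof -
  have "abelian_group AT"
  proof (rule abelian_groupI)
    show "\<exists>Y \<in> carrier AT. Y \<oplus>\<^bsub>AT\<^esub> X = \<zero>\<^bsub>AT\<^esub>" if X: "X \<in> carrier AT" for X
    proof -
      obtain x where x: "x \<in> carrier tfree" "X = cls x" using X carrier_AT by blast
      then show ?thesis
        unfolding carrier_AT by (intro bexI[of _ "cls (- x)"]) (auto simp: add_AT zero_AT)
    qed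
  qed (use add_AT tfree.m_closed in \<open>auto simp: carrier_AT zero_AT ac_simps\<close>)
  moreover have "cls (act (a \<oplus>\<^bsub>A\<^esub> b) z) = cls (act a z + act b z)"
    if "a \<in> carrier A" "b \<in> carrier A" "z \<in> carrier tfree" for a b z
    by (rule cls_eqI) (use that act_keys act_plus tfree.m_closed[of "act a z" "act b z"] in auto)
  ultimately show ?thesis
    using act_keys tfree.m_closed
    by (intro left_module.intro left_module_axioms.intro A.ring_axioms)
      (auto simp: carrier_AT smult_AT add_AT act_add act_mult act_one)
qed

text \<open>The canonical map t \<mapsto> 1 \<otimes> t, the unit of extension of scalars.\<close>

definition "tensor_unit t = cls (frag_of (\<one>\<^bsub>A\<^esub>, t))"

lemma smult_tensor_unit: "a \<in> carrier A \<Longrightarrow> t \<in> carrier T \<Longrightarrow> a \<odot>\<^bsub>AT\<^esub> tensor_unit t = cls (frag_of (a, t))"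
  by (simp add: tensor_unit_def smult_AT act_frag_of)

lemma tensor_unit_hom: "tensor_unit \<in> module_hom R T (res AT)"
proof (rule module_homI)
  show "tensor_unit t \<in> carrier (res AT)" if "t \<in> carrier T" for t
    using that by (simp add: tensor_unit_def carrier_AT)
  show "tensor_unit (s \<oplus>\<^bsub>T\<^esub> t) = tensor_unit s \<oplus>\<^bsub>res AT\<^esub> tensor_unit t" if "s \<in> carrier T" "t \<in> carrier T" for s t
  proof -
    have "frag_of (\<one>\<^bsub>A\<^esub>, s \<oplus>\<^bsub>T\<^esub> t) - frag_of (\<one>\<^bsub>A\<^esub>, s) - frag_of (\<one>\<^bsub>A\<^esub>, t) \<in> tensor_relations R A \<iota> T"
      unfolding tensor_relations_def using that by blast
    then have "cls (frag_of (\<one>\<^bsub>A\<^esub>, s \<oplus>\<^bsub>T\<^esub> t)) = cls (frag_of (\<one>\<^bsub>A\<^esub>, s) + frag_of (\<one>\<^bsub>A\<^esub>, t))"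
      using that tfree.m_closed[of "frag_of (\<one>\<^bsub>A\<^esub>, s)" "frag_of (\<one>\<^bsub>A\<^esub>, t)"] trel_rel
      by (intro cls_eqI) (auto simp: diff_diff_eq)
    then show ?thesis using that by (simp add: tensor_unit_def add_AT)
  qed
  show "tensor_unit (r \<odot>\<^bsub>T\<^esub> t) = r \<odot>\<^bsub>res AT\<^esub> tensor_unit t" if "r \<in> carrier R" "t \<in> carrier T" for r t
  proof -
    have "frag_of (\<one>\<^bsub>A\<^esub> \<otimes>\<^bsub>A\<^esub> \<iota> r, t) - frag_of (\<one>\<^bsub>A\<^esub>, r \<odot>\<^bsub>T\<^esub> t) \<in> tensor_relations R A \<iota> T"
      unfolding tensor_relations_def using that by blast
    then have "cls (frag_of (\<iota> r, t)) = cls (frag_of (\<one>\<^bsub>A\<^esub>, r \<odot>\<^bsub>T\<^esub> t))"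
      using that trel_rel by (intro cls_eqI) auto
    then show ?thesis using that smult_tensor_unit[of "\<iota> r" t] by (simp add: tensor_unit_def)
  qed
qed

text \<open>Closure under differences, as in the induction rule for free abelian groups, covers all
  integer coefficients at once.\<close>

lemma AT_induct:
  assumes X: "X \<in> carrier AT" and zero: "Q \<zero>\<^bsub>AT\<^esub>"
    and diff: "\<And>X Y. X \<in> carrier AT \<Longrightarrow> Y \<in> carrier AT \<Longrightarrow> Q X \<Longrightarrow> Q Y \<Longrightarrow> Q (X \<ominus>\<^bsub>AT\<^esub> Y)"
    and gen: "\<And>a t. a \<in> carrier A \<Longrightarrow> t \<in> carrier T \<Longrightarrow> Q (a \<odot>\<^bsub>AT\<^esub> tensor_unit t)"
  shows "Q X"
proof -
  interpret AT: left_module A AT by (rule left_module_AT)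
  obtain x where x: "x \<in> carrier tfree" "X = cls x" using X carrier_AT by blast
  have "Poly_Mapping.keys x \<subseteq> carrier A \<times> carrier T" using x by simp
  then have "Q (cls x)"
  proof (rule free_Abelian_group_induct)
    show "Q (cls 0)" using zero by (simp add: zero_AT)
    show "Q (cls (frag_of p))" if "p \<in> carrier A \<times> carrier T" for p
      using gen that by (auto simp: smult_tensor_unit)
    fix u v assume uv: "Poly_Mapping.keys u \<subseteq> carrier A \<times> carrier T"
      "Poly_Mapping.keys v \<subseteq> carrier A \<times> carrier T" and Q: "Q (cls u)" "Q (cls v)"
    have c: "cls u \<in> carrier AT" "cls v \<in> carrier AT" "cls (u - v) \<in> carrier AT"
      using uv tfree_diff_closed[of u v] by (simp_all add: cls_closed)
    have "cls (u - v) \<oplus>\<^bsub>AT\<^esub> cls v = cls u"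
      using uv tfree_diff_closed[of u v] by (subst add_AT) simp_all
    then have "cls u \<ominus>\<^bsub>AT\<^esub> cls v = cls (u - v)"
      using c by (metis AT.M.add.inv_solve_right' AT.M.minus_eq)
    then show "Q (cls (u - v))" using diff[OF c(1,2) Q] by simp
  qed
  then show ?thesis using x by simp
qed

text \<open>The map on the free group given by \<open>B\<close> kills each relation, hence the
  subgroup they generate, and so factors through the quotient. The target is just an abelian group,
  which matches the requirements of \<open>adj_iso\<close>.\<close>

lemma AT_universal:
  assumes M: "abelian_group M" and B: "\<And>a t. a \<in> carrier A \<Longrightarrow> t \<in> carrier T \<Longrightarrow> B a t \<in> carrier M"
    and B_add_left: "\<And>a b t. a \<in> carrier A \<Longrightarrow> b \<in> carrier A \<Longrightarrow> t \<in> carrier T \<Longrightarrow>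
      B (a \<oplus>\<^bsub>A\<^esub> b) t = B a t \<oplus>\<^bsub>M\<^esub> B b t"
    and B_add_right: "\<And>a s t. a \<in> carrier A \<Longrightarrow> s \<in> carrier T \<Longrightarrow> t \<in> carrier T \<Longrightarrow>
      B a (s \<oplus>\<^bsub>T\<^esub> t) = B a s \<oplus>\<^bsub>M\<^esub> B a t"
    and B_balanced: "\<And>a r t. a \<in> carrier A \<Longrightarrow> r \<in> carrier R \<Longrightarrow> t \<in> carrier T \<Longrightarrow>
      B (a \<otimes>\<^bsub>A\<^esub> \<iota> r) t = B a (r \<odot>\<^bsub>T\<^esub> t)"
  obtains g where "g \<in> carrier AT \<rightarrow> carrier M"
    and "\<And>X Y. X \<in> carrier AT \<Longrightarrow> Y \<in> carrier AT \<Longrightarrow> g (X \<oplus>\<^bsub>AT\<^esub> Y) = g X \<oplus>\<^bsub>M\<^esub> g Y"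
    and "\<And>a t. a \<in> carrier A \<Longrightarrow> t \<in> carrier T \<Longrightarrow> g (a \<odot>\<^bsub>AT\<^esub> tensor_unit t) = B a t"
proof -
  interpret M: abelian_group M by fact
  have "(\<lambda>(a, t). B a t) ` (carrier A \<times> carrier T) \<subseteq> carrier (add_monoid M)" using B by auto
  then obtain h where h: "h \<in> hom tfree (add_monoid M)"
    and hB: "\<And>p. p \<in> carrier A \<times> carrier T \<Longrightarrow> h (frag_of p) = (\<lambda>(a, t). B a t) p"
    by (rule comm_group.free_Abelian_group_universal[OF M.a_comm_group]) (rule that)
  interpret h: group_hom tfree "add_monoid M" h
    by (intro group_hom.intro group_hom_axioms.intro tfree.is_group M.a_group h)
  have hadd: "h (u + v) = h u \<oplus>\<^bsub>M\<^esub> h v" if "u \<in> carrier tfree" "v \<in> carrier tfree" for u v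
    using h.hom_mult[OF that] by simp
  have hc: "h u \<in> carrier M" if "u \<in> carrier tfree" for u
    using h.hom_closed[OF that] by simp
  have hdiff: "h (u - v) = h u \<ominus>\<^bsub>M\<^esub> h v" if "u \<in> carrier tfree" "v \<in> carrier tfree" for u v
  proof -
    have "u - v \<in> carrier tfree" by (rule tfree_diff_closed[OF that])
    then have "h u = h (u - v) \<oplus>\<^bsub>M\<^esub> h v" using hadd[of "u - v" v] that by simp
    then show ?thesis
      using hc[OF that(1)] hc[OF that(2)] hc[OF \<open>u - v \<in> carrier tfree\<close>]
      by (simp add: M.minus_eq M.a_assoc M.r_neg)
  qed
  have "tensor_relations R A \<iota> T \<subseteq> kernel tfree (add_monoid M) h"
  proof
    fix z assume z: "z \<in> tensor_relations R A \<iota> T"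
    have [simp]: "h (frag_of (a, t)) = B a t" if "a \<in> carrier A" "t \<in> carrier T" for a t
      using hB[of "(a, t)"] that by simp
    have canc': "u \<ominus>\<^bsub>M\<^esub> u = \<zero>\<^bsub>M\<^esub>" if "u \<in> carrier M" for u
      using that by (simp add: M.minus_eq M.r_neg)
    have canc: "u \<oplus>\<^bsub>M\<^esub> v \<ominus>\<^bsub>M\<^esub> u \<ominus>\<^bsub>M\<^esub> v = \<zero>\<^bsub>M\<^esub>" if "u \<in> carrier M" "v \<in> carrier M" for u v
    proof -
      have "u \<oplus>\<^bsub>M\<^esub> v \<ominus>\<^bsub>M\<^esub> u \<ominus>\<^bsub>M\<^esub> v = (u \<oplus>\<^bsub>M\<^esub> v) \<ominus>\<^bsub>M\<^esub> (u \<oplus>\<^bsub>M\<^esub> v)"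
        using that by (simp add: M.minus_eq M.minus_add M.a_assoc)
      then show ?thesis using that canc' by simp
    qed
    have "h z = \<zero>\<^bsub>M\<^esub>"
      using z unfolding tensor_relations_def
      by (elim UnE CollectE exE conjE)
        (simp_all add: hdiff tfree_diff_closed B canc canc' B_add_left B_add_right B_balanced del: carrier_free_Abelian_group_iff)
    then show "z \<in> kernel tfree (add_monoid M) h"
      using subsetD[OF tensor_relations_closed z] by (simp add: kernel_def)
  qed
  then have "trel \<subseteq> kernel tfree (add_monoid M) h"
    unfolding trel_def by (rule tfree.generate_subgroup_incl[OF _ h.subgroup_kernel])
  then have hk: "h k = \<zero>\<^bsub>M\<^esub>" "k \<in> carrier tfree" if "k \<in> trel" for k
    using that by (auto simp: kernel_def)
  \<comment> \<open>Any representative will do: two of them differ by an element of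
    \<open>trel\<close>, which \<open>h\<close> kills.\<close>
  define g where "g X = h (SOME x. x \<in> X)" for X
  have g: "g (cls x) = h x" if x: "x \<in> carrier tfree" for x
  proof -
    have "x \<in> cls x"
      unfolding mem_cls using subgroup.one_closed[OF subgroup_trel] by (intro bexI[of _ 0]) auto
    then have "(SOME z. z \<in> cls x) \<in> cls x" by (rule someI)
    then obtain k where "k \<in> trel" "(SOME z. z \<in> cls x) = k + x" unfolding mem_cls by blast
    then show ?thesis using hk hadd[of k x] x hc[OF x] by (simp add: g_def)
  qed
  show ?thesis
  proof (rule that[of g])
    show "g \<in> carrier AT \<rightarrow> carrier M"
    proof
      fix X assume "X \<in> carrier AT"
      then obtain u where "u \<in> carrier tfree" "X = cls u" unfolding carrier_AT by blast
      then show "g X \<in> carrier M" using g[of u] hc[of u] by metis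
    qed
    show "g (X \<oplus>\<^bsub>AT\<^esub> Y) = g X \<oplus>\<^bsub>M\<^esub> g Y" if XY: "X \<in> carrier AT" "Y \<in> carrier AT" for X Y
    proof -
      obtain u v where uv: "u \<in> carrier tfree" "v \<in> carrier tfree" "X = cls u" "Y = cls v"
        using XY unfolding carrier_AT by (elim imageE)
      have "u + v \<in> carrier tfree" using tfree.m_closed[OF uv(1,2)] by simp
      then show ?thesis
        by (simp only: uv(3,4) add_AT[OF uv(1,2)] g uv(1,2) hadd)
    qed
    show "g (a \<odot>\<^bsub>AT\<^esub> tensor_unit t) = B a t" if "a \<in> carrier A" "t \<in> carrier T" for a t
      using that hB[of "(a, t)"] g[of "frag_of (a, t)"] smult_tensor_unit[OF that] by simp
  qed
qed

end

text \<open>The isomorphism sends \<open>h\<close> to the sum of the elements y_i \<otimes> h(x_i).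
  Its inverse is induced by sending (a, t) to the \<open>a\<close>-multiple of
  \<open>eta T t\<close>, which is balanced because \<open>eta\<close> is linear. One composite is
  checked on elements a \<otimes> t, the other through \<open>adj_iso\<close>.\<close>

lemma (in frobenius_system) coind_extend_scalars_iso:
  fixes T :: "('a, 't) module"
  assumes T: "left_module R T"
  shows "left_module A (extend_scalars R A \<iota> T)"
    and "\<exists>\<theta>. \<theta> \<in> module_iso A (coind T) (extend_scalars R A \<iota> T)"
proof -
  interpret scalar_extension R A \<iota> T 
    by (intro scalar_extension.intro scalar_extension_axioms.intro ring_extension_axioms T)
  show "left_module A AT" by (rule left_module_AT)
  interpret AT: left_module A AT by (rule left_module_AT)
  interpret F: left_module A "coind T" by (rule left_module_coind[OF T])
  note e = eta_closed[OF T] and eh = module_homD[OF eta_hom[OF T], simplified restrict_scalars_simps]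
  obtain g where g: "g \<in> carrier AT \<rightarrow> carrier (coind T)"
    and gadd: "\<And>X Y. X \<in> carrier AT \<Longrightarrow> Y \<in> carrier AT \<Longrightarrow> g (X \<oplus>\<^bsub>AT\<^esub> Y) = g X \<oplus>\<^bsub>coind T\<^esub> g Y"
    and gu: "\<And>a t. a \<in> carrier A \<Longrightarrow> t \<in> carrier T \<Longrightarrow> g (a \<odot>\<^bsub>AT\<^esub> tensor_unit t) = a \<odot>\<^bsub>coind T\<^esub> eta T t"
  proof (rule AT_universal[OF F.M.abelian_group_axioms, of "\<lambda>a t. a \<odot>\<^bsub>coind T\<^esub> eta T t"])
    show "a \<odot>\<^bsub>coind T\<^esub> eta T t \<in> carrier (coind T)" if "a \<in> carrier A" "t \<in> carrier T" for a t
      by (rule F.smult_closed[OF that(1) e[OF that(2)]])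
    show "(a \<oplus>\<^bsub>A\<^esub> b) \<odot>\<^bsub>coind T\<^esub> eta T t = a \<odot>\<^bsub>coind T\<^esub> eta T t \<oplus>\<^bsub>coind T\<^esub> b \<odot>\<^bsub>coind T\<^esub> eta T t"
      if "a \<in> carrier A" "b \<in> carrier A" "t \<in> carrier T" for a b t
      by (rule F.smult_l_distr[OF that(1,2) e[OF that(3)]])
    show "a \<odot>\<^bsub>coind T\<^esub> eta T (s \<oplus>\<^bsub>T\<^esub> t) = a \<odot>\<^bsub>coind T\<^esub> eta T s \<oplus>\<^bsub>coind T\<^esub> a \<odot>\<^bsub>coind T\<^esub> eta T t"
      if "a \<in> carrier A" "s \<in> carrier T" "t \<in> carrier T" for a s t
      unfolding eh(2)[OF that(2,3)] by (rule F.smult_r_distr[OF that(1) e[OF that(2)] e[OF that(3)]])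
    show "(a \<otimes>\<^bsub>A\<^esub> \<iota> r) \<odot>\<^bsub>coind T\<^esub> eta T t = a \<odot>\<^bsub>coind T\<^esub> eta T (r \<odot>\<^bsub>T\<^esub> t)"
      if "a \<in> carrier A" "r \<in> carrier R" "t \<in> carrier T" for a r t
      unfolding eh(3)[OF that(2,3)] by (rule F.smult_assoc1[OF that(1) iota_closed[OF that(2)] e[OF that(3)]])
  qed (rule that)
  note adj = adj_hom[OF T left_module_AT tensor_unit_hom]
  have right_inv: "adj AT tensor_unit (g X) = X" if X: "X \<in> carrier AT" for X
  proof (rule AT_induct[OF X])
    have g0: "g \<zero>\<^bsub>AT\<^esub> = \<zero>\<^bsub>coind T\<^esub>"
      by (rule additive_zero[OF AT.M.abelian_group_axioms F.M.abelian_group_axioms g]) (rule gadd)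
    show "adj AT tensor_unit (g \<zero>\<^bsub>AT\<^esub>) = \<zero>\<^bsub>AT\<^esub>"
      unfolding g0 by (rule module_hom_zero[OF F.left_module_axioms left_module_AT adj])
    fix X Y assume XY: "X \<in> carrier AT" "Y \<in> carrier AT" and eq: "adj AT tensor_unit (g X) = X" "adj AT tensor_unit (g Y) = Y"
    show "adj AT tensor_unit (g (X \<ominus>\<^bsub>AT\<^esub> Y)) = X \<ominus>\<^bsub>AT\<^esub> Y"
    proof -
      have "g (X \<ominus>\<^bsub>AT\<^esub> Y) = g X \<ominus>\<^bsub>coind T\<^esub> g Y"
        by (rule additive_minus[OF AT.M.abelian_group_axioms F.M.abelian_group_axioms g _ XY]) (rule gadd)
      moreover have "g X \<in> carrier (coind T)" "g Y \<in> carrier (coind T)" using g XY by auto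
      ultimately show ?thesis
        using module_hom_minus[OF F.left_module_axioms left_module_AT adj] eq by simp
    qed
  next
    show "adj AT tensor_unit (g (a \<odot>\<^bsub>AT\<^esub> tensor_unit t)) = a \<odot>\<^bsub>AT\<^esub> tensor_unit t" if "a \<in> carrier A" "t \<in> carrier T" for a t
      unfolding gu[OF that] by (rule adj_smult_eta[OF T left_module_AT tensor_unit_hom that])
  qed
  have "adj AT tensor_unit \<in> module_iso A (coind T) AT"
    by (rule adj_iso[OF T left_module_AT tensor_unit_hom g]) (rule gadd gu right_inv; assumption)+
  then show "\<exists>\<theta>. \<theta> \<in> module_iso A (coind T) AT" by blast
qed

theorem corollary2p3:
  fixes R :: "'r ring" and A :: "'a ring" and \<iota> :: "'r \<Rightarrow> 'a" and T :: "('r, 't) module"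
  assumes "frobenius_extension R A \<iota>"
    and "wakamatsu_tilting R T"
    and "in_add R T (restrict_scalars \<iota> (extend_scalars R A \<iota> T))"
  shows "wakamatsu_tilting A (extend_scalars R A \<iota> T)"
proof -
  obtain E n x y where "frobenius_system R A \<iota> E n x y"
    by (rule frobenius_extension_system[OF assms(1)])
  then interpret frobenius_system R A \<iota> E n x y .
  have "left_module R T" using assms(2) by (simp add: wakamatsu_tilting_def)
  note AT = coind_extend_scalars_iso[OF this]
  show ?thesis
    using AT(2) wakamatsu_tilting_coind_iso[OF assms(2) AT(1) _ assms(3)] by blast
qed

end
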